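(* Let $\phi$ and $z$ be fixed constants. In the generalized Server Cloud Scheduling model with $z$ identical server machines, $k$ cloud contexts, communication delays depending on the direction and on the machine contexts, and an arbitrary cost function $\mathrm{cost}:\mathcal{J}\times\{c_1,\dots,c_k\}\to\mathbb{N}_0$, there is an FPTAS for budget-restrained makespan minimization (given a budget $b$, minimize the makespan among valid schedules with cost at most $b$) on task graphs whose maximum cardinality source and sink dividing cut is at most $\phi$.
   Context: Generalized Server Cloud Scheduling: the input is a directed acyclic task graph $G=(\mathcal{J},E)$ with one source $s$ and one sink $t$ (which must be processed on server machines: $p_s(s)=p_s(t)=0$, and their cloud processing times are $\infty$). There are $z$ identical server machines $s_1,\dots,s_z$ and $k$ cloud contexts $c_1,\dots,c_k$, each consisting of unboundedly many machines. Job $j$ has processing time $p_s(j)\in\mathbb{N}_0$ on any server machine and $p_{c_i}(j)\in\mathbb{N}_0$ on a machine of cloud context $c_i$. For each edge $(i,j)$ and machine types $m_1,m_2\in\{s,c_1,\dots,c_k\}$ there is a delay $c_{m_1,m_2}(i,j)\in\mathbb{N}_0$ (not necessarily symmetric), with $c_{m,m}(i,j)=0$. A schedule is a pair $(C,\eta)$ with completion times $C:\mathcal{J}\to\mathbb{N}_0$ and assignment $\eta:\mathcal{J}\to\{s_1,\dots,s_z\}\cup\{c_1,\dots,c_k\}$; write $p_{\eta(j)}(j)$ for the processing time of $j$ at its assigned location and use type $s$ for any server machine in delays. It is valid if (a) no two distinct jobs assigned to the same server machine overlap in time: $C(i)\le C(j)-p_s(j)$ or $C(i)-p_s(i)\ge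 C(j)$; (b) for every edge $(i,j)$: $C(i)+c_{\eta(i),\eta(j)}(i,j)\le C(j)-p_{\eta(j)}(j)$. The makespan is $C(t)$ and the cost is $\sum_{j:\eta(j)\in\{c_1,\dots,c_k\}}\mathrm{cost}(j,\eta(j))$. Maximum cardinality source and sink dividing cut: let $\mathcal{S}$ be the family of all sets $A\subseteq\mathcal{J}$ with $s\in A$ such that there is no edge $(j,k)\in E$ with $j\notin A$ and $k\in A$; then $\phi(G)=\max_{A\in\mathcal{S}}|\{(j,k)\in E: j\in A,\ k\notin A\}|$. *)

theory Defs
  imports Complex_Main
begin

datatype instr =
    IConst nat nat
  | IAdd nat nat nat
  | ISub nat nat nat
  | ILoad nat nat
  | IStore nat nat
  | IJz nat nat

type_synonym conf = "nat \<times> (nat \<Rightarrow> nat)"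

fun step :: "instr list \<Rightarrow> conf \<Rightarrow> conf" where
  "step P (pc, r) =
    (if length P \<le> pc then (pc, r) else
     (case P ! pc of
        IConst a v \<Rightarrow> (Suc pc, r(a := v))
      | IAdd a b c \<Rightarrow> (Suc pc, r(a := r b + r c))
      | ISub a b c \<Rightarrow> (Suc pc, r(a := r b - r c))
      | ILoad a b \<Rightarrow> (Suc pc, r(a := r (r b)))
      | IStore a b \<Rightarrow> (Suc pc, r(r a := r b))
      | IJz a l \<Rightarrow> (if r a = 0 then l else Suc pc, r)))"

text \<open>Input list xs: register 0 holds its length, registers 1..length xs its entries.
  The machine halts when the program counter leaves the program; the output is read
  in the same format.\<close>

definition init_conf :: "nat list \<Rightarrow> conf" where
  "init_conf xs = (0, \<lambda>i. if i = 0 then length xs else if i \<le> length xs then xs ! (i - 1) else 0)"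

definition output_of :: "(nat \<Rightarrow> nat) \<Rightarrow> nat list" where
  "output_of r = map (\<lambda>i. r (Suc i)) [0..<r 0]"

definition runs_within :: "instr list \<Rightarrow> nat list \<Rightarrow> nat \<Rightarrow> nat list \<Rightarrow> bool" where
  "runs_within P xs T ys \<longleftrightarrow>
     (\<exists>t\<le>T. length P \<le> fst ((step P ^^ t) (init_conf xs))
            \<and> output_of (snd ((step P ^^ t) (init_conf xs))) = ys)"

definition bitlen :: "nat \<Rightarrow> nat" where
  "bitlen x = (LEAST m. x < 2 ^ m)"

definition enc_size :: "nat list \<Rightarrow> nat" where
  "enc_size xs = length xs + sum_list (map bitlen xs)"

text \<open>Jobs are 0..<n. Machine types: None = server, Some i = cloud context i (i < k).\<close>

record inst =
  nj   :: nat
  src  :: nat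
  snk  :: nat
  edges :: "(nat \<times> nat) set"
  nz   :: nat
  nk   :: nat
  ps   :: "nat \<Rightarrow> nat"
  pcl  :: "nat \<Rightarrow> nat \<Rightarrow> nat"          (* pcl c j = p_{c}(j) *)
  dly  :: "nat option \<Rightarrow> nat option \<Rightarrow> nat \<Rightarrow> nat \<Rightarrow> nat"  (* dly m1 m2 i j = c_{m1,m2}(i,j) *)
  cst  :: "nat \<Rightarrow> nat \<Rightarrow> nat"          (* cst j c = cost(j, c) *)
  bud  :: nat

definition wf_inst :: "inst \<Rightarrow> bool" where
  "wf_inst I \<longleftrightarrow>
     src I < nj I \<and> snk I < nj I \<and> 1 \<le> nz I \<and>
     edges I \<subseteq> {0..<nj I} \<times> {0..<nj I} \<and> acyclic (edges I) \<and>
     (\<forall>j<nj I. (\<not>(\<exists>i. (i, j) \<in> edges I)) \<longleftrightarrow> j = src I) \<and>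
     (\<forall>j<nj I. (\<not>(\<exists>i. (j, i) \<in> edges I)) \<longleftrightarrow> j = snk I) \<and>
     ps I (src I) = 0 \<and> ps I (snk I) = 0 \<and>
     (\<forall>m i j. dly I m m i j = 0)"

definition dividing_sets :: "inst \<Rightarrow> nat set set" where
  "dividing_sets I = {A. A \<subseteq> {0..<nj I} \<and> src I \<in> A \<and>
        \<not> (\<exists>(j, k) \<in> edges I. j \<notin> A \<and> k \<in> A)}"

definition cut_phi :: "inst \<Rightarrow> nat" where
  "cut_phi I = Max ((\<lambda>A. card {(j, k) \<in> edges I. j \<in> A \<and> k \<notin> A}) ` dividing_sets I)"

text \<open>Standard encoding of an instance as a list of naturals (values that the model
  treats as irrelevant -- delays on non-edges, cloud times/costs of s and t -- are encoded as 0).\<close>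

definition mtypes :: "inst \<Rightarrow> nat option list" where
  "mtypes I = None # map Some [0..<nk I]"

definition enc :: "inst \<Rightarrow> nat list" where
  "enc I =
     [nj I, src I, snk I, nz I, nk I, bud I]
   @ [if (i, j) \<in> edges I then 1 else 0. i \<leftarrow> [0..<nj I], j \<leftarrow> [0..<nj I]]
   @ map (ps I) [0..<nj I]
   @ [if j = src I \<or> j = snk I then 0 else pcl I c j. c \<leftarrow> [0..<nk I], j \<leftarrow> [0..<nj I]]
   @ [if (i, j) \<in> edges I then dly I m1 m2 i j else 0.
        m1 \<leftarrow> mtypes I, m2 \<leftarrow> mtypes I, i \<leftarrow> [0..<nj I], j \<leftarrow> [0..<nj I]]
   @ [if j = src I \<or> j = snk I then 0 else cst I j c. j \<leftarrow> [0..<nj I], c \<leftarrow> [0..<nk I]]"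

datatype loc = Server nat | Cloud nat

fun ltype :: "loc \<Rightarrow> nat option" where
  "ltype (Server _) = None"
| "ltype (Cloud c) = Some c"

fun is_server :: "loc \<Rightarrow> bool" where
  "is_server (Server _) = True"
| "is_server (Cloud _) = False"

definition ptime :: "inst \<Rightarrow> (nat \<Rightarrow> loc) \<Rightarrow> nat \<Rightarrow> nat" where
  "ptime I \<eta> j = (case \<eta> j of Server _ \<Rightarrow> ps I j | Cloud c \<Rightarrow> pcl I c j)"

definition valid_sched :: "inst \<Rightarrow> (nat \<Rightarrow> nat) \<Rightarrow> (nat \<Rightarrow> loc) \<Rightarrow> bool" where
  "valid_sched I C \<eta> \<longleftrightarrow>
     (\<forall>j<nj I. case \<eta> j of Server m \<Rightarrow> m < nz I | Cloud c \<Rightarrow> c < nk I) \<and>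
     is_server (\<eta> (src I)) \<and> is_server (\<eta> (snk I)) \<and>
     (\<forall>i<nj I. \<forall>j<nj I. i \<noteq> j \<and> \<eta> i = \<eta> j \<and> is_server (\<eta> i) \<longrightarrow>
         int (C i) \<le> int (C j) - int (ps I j) \<or> int (C i) - int (ps I i) \<ge> int (C j)) \<and>
     (\<forall>(i, j) \<in> edges I.
         int (C i) + int (dly I (ltype (\<eta> i)) (ltype (\<eta> j)) i j) \<le> int (C j) - int (ptime I \<eta> j))"

definition sched_cost :: "inst \<Rightarrow> (nat \<Rightarrow> loc) \<Rightarrow> nat" where
  "sched_cost I \<eta> = (\<Sum>j\<in>{j. j < nj I \<and> \<not> is_server (\<eta> j)}.
                        (case \<eta> j of Cloud c \<Rightarrow> cst I j c | Server _ \<Rightarrow> 0))"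

definition makespan :: "inst \<Rightarrow> (nat \<Rightarrow> nat) \<Rightarrow> nat" where
  "makespan I C = C (snk I)"

text \<open>Decoding of a machine output: [C 0, code 0, C 1, code 1, ...], where code 2m is server m
  and code 2c+1 is cloud context c.\<close>

definition loc_of_code :: "nat \<Rightarrow> loc" where
  "loc_of_code x = (if even x then Server (x div 2) else Cloud (x div 2))"

definition dec_sched :: "nat list \<Rightarrow> (nat \<Rightarrow> nat) \<times> (nat \<Rightarrow> loc)" where
  "dec_sched ys = ((\<lambda>j. ys ! (2 * j)), (\<lambda>j. loc_of_code (ys ! (2 * j + 1))))"

end

theory Submission
  imports Defs "HOL-Library.Product_Lexorder"
begin

text \<open>
  Jobs are scheduled one at a time in the order of their start times, so that the scheduled jobs always
  form a dividing set.  For extending a partial schedule only the times at which the servers become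
  free and the types and completion times of the jobs with an unscheduled successor matter.  A dividing
  set is determined by its at most \<open>\<phi>\<close> crossing edges; hence, if times are rounded down to multiples
  of \<open>\<delta>\<close> and must stay below \<open>M * \<delta>\<close>, only polynomially many keys, that is rounded descriptions of
  this kind, occur.  Among the states with equal key a cheapest one is kept.  Each of the \<open>n\<close> rounds
  delays the tracked schedule by at most \<open>\<delta> - 1\<close>, so a schedule of makespan \<open>T\<close> within the budget leads
  to a stored one of makespan at most \<open>T + n * (\<delta> - 1)\<close>, provided that this is at most \<open>M * \<delta>\<close>.  Try
  \<open>\<delta> = 1, 2, 4, ...\<close> with \<open>M = 2 * n * e + n + 1\<close>.  If the first success has \<open>\<delta> = 1\<close>, it is optimal;
  otherwise the failure of \<open>\<delta> div 2\<close> shows that the optimum is at least \<open>n * e * \<delta>\<close>, so that the error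
  \<open>n * (\<delta> - 1)\<close> is at most the optimum divided by \<open>e\<close>.

  The algorithm is a program in a small functional language whose only loop runs a number of times
  determined by the input size, so that every program takes polynomial time by its syntax alone.  Loops
  over lists are cut off at a window \<open>W\<close>, a fixed power of that number, and polynomial bounds are needed
  only to see that nothing is lost.
\<close>

section \<open>Execution of machine code\<close>

definition code_at :: "instr list \<Rightarrow> nat \<Rightarrow> instr list \<Rightarrow> bool" where
  "code_at P p c \<longleftrightarrow> (\<forall>i < length c. p + i < length P \<and> P ! (p + i) = c ! i)"

lemma code_at_Nil [simp]: "code_at P p []"
  by (simp add: code_at_def)

lemma code_at_Cons [simp]:
  "code_at P p (x # c) \<longleftrightarrow> p < length P \<and> P ! p = x \<and> code_at P (Suc p) c"
  unfolding code_at_def by (auto simp: nth_Cons All_less_Suc2)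

lemma code_at_append [simp]:
  "code_at P p (c @ d) \<longleftrightarrow> code_at P p c \<and> code_at P (p + length c) d"
  by (induction c arbitrary: p) auto

definition reaches :: "instr list \<Rightarrow> nat \<Rightarrow> conf \<Rightarrow> conf \<Rightarrow> bool" where
  "reaches P k a b \<longleftrightarrow> (\<exists>j\<le>k. (step P ^^ j) a = b)"

lemma reaches_refl: "reaches P k a a"
  unfolding reaches_def by (rule exI[of _ 0]) simp

lemma reaches_trans:
  assumes "reaches P k a b" "reaches P l b c"
  shows "reaches P (k + l) a c"
proof -
  obtain i j where "i \<le> k" "j \<le> l" "(step P ^^ i) a = b" "(step P ^^ j) b = c"
    using assms unfolding reaches_def by blast
  then show ?thesis
    unfolding reaches_def by (intro exI[of _ "j + i"]) (simp add: funpow_add)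
qed

lemma reaches_mono: "reaches P k a b \<Longrightarrow> k \<le> l \<Longrightarrow> reaches P l a b"
  unfolding reaches_def using le_trans by blast

lemma reaches_step: "step P a = b \<Longrightarrow> reaches P 1 a b"
  unfolding reaches_def by (rule exI[of _ 1]) simp

lemma reaches_iterate:
  assumes "Inv 0 r"
    and "\<And>i r. i < n \<Longrightarrow> Inv i r \<Longrightarrow> \<exists>r'. reaches P k (p, r) (p, r') \<and> Inv (Suc i) r'"
  shows "\<exists>r'. reaches P (n * k) (p, r) (p, r') \<and> Inv n r'"
proof -
  have "\<exists>r'. reaches P (i * k) (p, r) (p, r') \<and> Inv i r'" if "i \<le> n" for i
    using that
  proof (induction i)
    case 0
    then show ?case using assms(1) reaches_refl by blast
  next
    case (Suc i)
    then obtain r' where r': "reaches P (i * k) (p, r) (p, r')" "Inv i r'" by auto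
    then obtain r'' where "reaches P k (p, r') (p, r'')" "Inv (Suc i) r''"
      using assms(2)[of i r'] Suc.prems by auto
    then show ?case using reaches_trans[OF r'(1)] by (auto simp: add.commute)
  qed
  then show ?thesis by simp
qed

fun effect :: "instr \<Rightarrow> (nat \<Rightarrow> nat) \<Rightarrow> nat \<Rightarrow> nat" where
  "effect (IConst a v) r = r(a := v)"
| "effect (IAdd a b c) r = r(a := r b + r c)"
| "effect (ISub a b c) r = r(a := r b - r c)"
| "effect (ILoad a b) r = r(a := r (r b))"
| "effect (IStore a b) r = r(r a := r b)"
| "effect (IJz a l) r = r"

fun is_jump :: "instr \<Rightarrow> bool" where
  "is_jump (IJz a l) \<longleftrightarrow> True"
| "is_jump _ \<longleftrightarrow> False"

abbreviation exec :: "instr list \<Rightarrow> (nat \<Rightarrow> nat) \<Rightarrow> nat \<Rightarrow> nat" where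
  "exec c r \<equiv> fold effect c r"

lemma reaches_exec:
  assumes "code_at P p c" "\<forall>i\<in>set c. \<not> is_jump i"
  shows "reaches P (length c) (p, r) (p + length c, exec c r)"
  using assms
proof (induction c arbitrary: p r)
  case Nil
  then show ?case by (simp add: reaches_refl)
next
  case (Cons i c)
  have "step P (p, r) = (Suc p, effect i r)" using Cons.prems by (cases i) auto
  moreover have "reaches P (length c) (Suc p, effect i r) (Suc p + length c, exec c (effect i r))"
    using Cons.IH[of "Suc p" "effect i r"] Cons.prems by simp
  ultimately show ?case using reaches_trans[OF reaches_step] by fastforce
qed

lemma reaches_jump:
  "code_at P p [IJz a l] \<Longrightarrow> reaches P 1 (p, r) (if r a = 0 then l else Suc p, r)"
  by (rule reaches_step) auto

text \<open>Register \<open>z\<close> holds 0, which turns the conditional jump at the end into an unconditional one.\<close>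

definition while_code :: "nat \<Rightarrow> nat \<Rightarrow> instr list \<Rightarrow> nat \<Rightarrow> instr list \<Rightarrow> instr list" where
  "while_code p z test a body =
     test @ [IJz a (p + length test + length body + 2)] @ body @ [IJz z p]"

lemma length_while_code [simp]:
  "length (while_code p z test a body) = length test + length body + 2"
  by (simp add: while_code_def)

lemma reaches_while:
  assumes code: "code_at P p (while_code p z test a body)"
    and straight: "\<forall>i \<in> set test \<union> set body. \<not> is_jump i"
    and init: "Inv 0 r"
    and iter: "\<And>i r. i < n \<Longrightarrow> Inv i r \<Longrightarrow>
      exec test r a \<noteq> 0 \<and> exec (test @ body) r z = 0 \<and> Inv (Suc i) (exec (test @ body) r)"
    and exit: "\<And>r. Inv n r \<Longrightarrow> exec test r a = 0"
    and "k = length test + length body + 2" "l = length test + 1" "q = p + k"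
  shows "\<exists>r'. Inv n r' \<and> reaches P (n * k + l) (p, r) (q, exec test r')"
proof -
  let ?m = "length test + length body + 2"
  have code: "code_at P p test" "code_at P (p + length test) [IJz a (p + ?m)]"
    "code_at P (Suc (p + length test)) body"
    "code_at P (Suc (p + length test) + length body) [IJz z p]"
    using code by (auto simp: while_code_def add.assoc)
  have test: "reaches P (length test) (p, r) (p + length test, exec test r)" for r
    using straight by (intro reaches_exec code) auto
  have body: "reaches P (length body) (Suc (p + length test), r)
      (Suc (p + length test) + length body, exec body r)" for r
    using straight by (intro reaches_exec code) auto
  have round: "\<exists>r'. reaches P ?m (p, r) (p, r') \<and> Inv (Suc i) r'" if "i < n" "Inv i r" for i r
  proof -
    let ?r' = "exec body (exec test r)"
    have round_i: "exec test r a \<noteq> 0" "?r' z = 0" "Inv (Suc i) ?r'" using iter[OF that] by auto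
    have "reaches P 1 (p + length test, exec test r) (Suc (p + length test), exec test r)"
      using reaches_jump[OF code(2), of "exec test r"] round_i(1) by simp
    moreover have "reaches P 1 (Suc (p + length test) + length body, ?r') (p, ?r')"
      using reaches_jump[OF code(4), of ?r'] round_i(2) by simp
    ultimately have "reaches P (length test + (1 + (length body + 1))) (p, r) (p, ?r')"
      using test body by (blast intro: reaches_trans)
    then show ?thesis using round_i(3) by (auto simp: add_ac)
  qed
  obtain r' where r': "reaches P (n * ?m) (p, r) (p, r')" "Inv n r'"
    using reaches_iterate[of Inv, OF init round] by blast
  have "reaches P 1 (p + length test, exec test r') (p + ?m, exec test r')"
    using reaches_jump[OF code(2), of "exec test r'"] exit[OF r'(2)] by simp
  from reaches_trans[OF reaches_trans[OF r'(1) test] this] r'(2) show ?thesis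
    using assms(6-) by auto
qed

section \<open>A functional language compiled to the random access machine\<close>

datatype data = Atom nat | Cell data data

datatype binop = Plus | Minus | Cons

datatype expr = Ident | Comp expr expr | Op binop expr expr | First | Second | Const nat
  | Cond expr expr expr | Iter expr

inductive op_value :: "binop \<Rightarrow> data \<Rightarrow> data \<Rightarrow> data \<Rightarrow> bool" where
  op_Plus: "op_value Plus (Atom a) (Atom b) (Atom (a + b))"
| op_Minus: "op_value Minus (Atom a) (Atom b) (Atom (a - b))"
| op_Cons: "op_value Cons u v (Cell u v)"

inductive evaluates :: "nat \<Rightarrow> expr \<Rightarrow> data \<Rightarrow> data \<Rightarrow> bool" for N where
  ev_Ident: "evaluates N Ident v v"
| ev_Comp: "evaluates N f u v \<Longrightarrow> evaluates N g v w \<Longrightarrow> evaluates N (Comp f g) u w"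
| ev_Op: "evaluates N f u v \<Longrightarrow> evaluates N g u w \<Longrightarrow> op_value b v w x \<Longrightarrow>
    evaluates N (Op b f g) u x"
| ev_First: "evaluates N First (Cell v w) v"
| ev_Second: "evaluates N Second (Cell v w) w"
| ev_Const: "evaluates N (Const n) u (Atom n)"
| ev_Cond: "evaluates N c u v \<Longrightarrow> evaluates N (if v = Atom 0 then g else f) u w \<Longrightarrow>
    evaluates N (Cond c f g) u w"
| ev_Iter: "(\<And>i. i < N \<Longrightarrow> evaluates N f (X i) (X (Suc i))) \<Longrightarrow>
    evaluates N (Iter f) (X 0) (X N)"

text \<open>\<open>compile p t f\<close> is code for address \<open>p\<close> that replaces the argument of \<open>f\<close> in register \<open>t\<close>
  by its value, using only registers from \<open>t\<close> on.  Registers 0, 1, 2, 3 hold the constants 0 and 1,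
  the first free heap cell and the iteration number \<open>N\<close>.\<close>

fun compile_op :: "nat \<Rightarrow> binop \<Rightarrow> instr list" where
  "compile_op t Plus = [IAdd t (t+1) (t+2)]"
| "compile_op t Minus = [ISub t (t+1) (t+2)]"
| "compile_op t Cons = [IStore 2 (t+1), IAdd 2 2 1, IStore 2 (t+2), ISub t 2 1, IAdd 2 2 1]"

fun compile :: "nat \<Rightarrow> nat \<Rightarrow> expr \<Rightarrow> instr list" where
  "compile p t Ident = []"
| "compile p t (Comp f g) = compile p t f @ compile (p + length (compile p t f)) t g"
| "compile p t (Op b f g) =
    (let x = compile (Suc p) (t+1) f; y = compile (p + length x + 2) (t+2) g in
     (IAdd (t+1) t 0 # x) @ (IAdd (t+2) t 0 # y) @ compile_op t b)"
| "compile p t First = [ILoad t t]"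
| "compile p t Second = [IAdd t t 1, ILoad t t]"
| "compile p t (Const n) = [IConst t n]"
| "compile p t (Cond c f g) =
    (let x = compile (Suc p) (t+1) c; y = compile (p + length x + 2) t f;
         q = p + length x + length y + 3; z = compile q t g in
     (IAdd (t+1) t 0 # x) @ [IJz (t+1) q] @ y @ [IJz 0 (q + length z)] @ z)"
| "compile p t (Iter f) =
    (let x = compile (p + 3) (t+1) f in
     [IAdd (t+1) t 0, IAdd t 3 0] @ [IJz t (p + 5 + length x)] @ x @
     [ISub t t 1] @ [IJz 0 (p + 2)] @ [IAdd t (t+1) 0])"

fun regs :: "expr \<Rightarrow> nat" where
  "regs (Comp f g) = regs f + regs g"
| "regs (Op b f g) = 3 + regs f + regs g"
| "regs (Cond c f g) = 2 + regs c + regs f + regs g"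
| "regs (Iter f) = 2 + regs f"
| "regs _ = 1"

lemma regs_pos: "0 < regs f"
  by (induction f) auto

fun steps :: "nat \<Rightarrow> expr \<Rightarrow> nat" where
  "steps N (Comp f g) = steps N f + steps N g"
| "steps N (Op b f g) = 7 + steps N f + steps N g"
| "steps N (Cond c f g) = 3 + steps N c + steps N f + steps N g"
| "steps N (Iter f) = 4 + N * (3 + steps N f)"
| "steps N _ = 2"

definition poly_bounded :: "(nat \<Rightarrow> nat) \<Rightarrow> bool" where
  "poly_bounded F \<longleftrightarrow> (\<exists>A d. \<forall>N. F N \<le> A * Suc N ^ d)"

lemma poly_bounded_const: "poly_bounded (\<lambda>N. a)"
  unfolding poly_bounded_def by (rule exI[of _ a], rule exI[of _ 0]) simp

lemma poly_bounded_ident: "poly_bounded (\<lambda>N. N)"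
  unfolding poly_bounded_def by (rule exI[of _ 1], rule exI[of _ 1]) simp

lemma poly_bounded_add:
  assumes "poly_bounded F" "poly_bounded G"
  shows "poly_bounded (\<lambda>N. F N + G N)"
proof -
  obtain A d B e where F_le: "\<And>N. F N \<le> A * Suc N ^ d" and G_le: "\<And>N. G N \<le> B * Suc N ^ e"
    using assms unfolding poly_bounded_def by blast
  have "F N + G N \<le> (A + B) * Suc N ^ (d + e)" for N
  proof -
    have "A * Suc N ^ d \<le> A * Suc N ^ (d + e)" "B * Suc N ^ e \<le> B * Suc N ^ (d + e)"
      by (intro mult_left_mono power_increasing; simp)+
    then show ?thesis using F_le[of N] G_le[of N] by (simp only: distrib_right)
  qed
  then show ?thesis unfolding poly_bounded_def by blast
qed

lemma poly_bounded_mult: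
  assumes "poly_bounded F" "poly_bounded G"
  shows "poly_bounded (\<lambda>N. F N * G N)"
proof -
  obtain A d B e where "\<And>N. F N \<le> A * Suc N ^ d" "\<And>N. G N \<le> B * Suc N ^ e"
    using assms unfolding poly_bounded_def by blast
  then have "F N * G N \<le> (A * Suc N ^ d) * (B * Suc N ^ e)" for N
    by (intro mult_le_mono)
  then have "F N * G N \<le> (A * B) * Suc N ^ (d + e)" for N
    by (simp only: power_add mult_ac)
  then show ?thesis unfolding poly_bounded_def by blast
qed

lemma poly_bounded_power: "poly_bounded F \<Longrightarrow> poly_bounded (\<lambda>N. F N ^ i)"
  by (induction i) (simp_all add: poly_bounded_const poly_bounded_mult)

lemmas poly_bounded_intros = poly_bounded_const poly_bounded_ident poly_bounded_add
  poly_bounded_mult poly_bounded_power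

lemma poly_bounded_steps: "poly_bounded (\<lambda>N. steps N f)"
  by (induction f) (simp_all only: steps.simps poly_bounded_intros)

definition runtime_ok :: "nat \<Rightarrow> nat \<Rightarrow> (nat \<Rightarrow> nat) \<Rightarrow> bool" where
  "runtime_ok H N r \<longleftrightarrow> r 0 = 0 \<and> r 1 = 1 \<and> r 3 = N \<and> H \<le> r 2"

definition preserves :: "nat \<Rightarrow> nat \<Rightarrow> (nat \<Rightarrow> nat) \<Rightarrow> (nat \<Rightarrow> nat) \<Rightarrow> bool" where
  "preserves H t r r' \<longleftrightarrow> (\<forall>i<t. i \<noteq> 2 \<longrightarrow> r' i = r i) \<and> r 2 \<le> r' 2 \<and>
     (\<forall>i. H \<le> i \<and> i < r 2 \<longrightarrow> r' i = r i)"

text \<open>Heap cells lie at addresses from \<open>H > 0\<close> on, so a pointer to a cell is never 0 and can be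
  tested against the empty list, which is represented by 0.\<close>

fun represents :: "nat \<Rightarrow> (nat \<Rightarrow> nat) \<Rightarrow> data \<Rightarrow> nat \<Rightarrow> bool" where
  "represents H r (Atom n) x \<longleftrightarrow> x = n"
| "represents H r (Cell u v) x \<longleftrightarrow>
     H \<le> x \<and> Suc x < r 2 \<and> represents H r u (r x) \<and> represents H r v (r (Suc x))"

lemma represents_preserves: "preserves H t r r' \<Longrightarrow> represents H r v x \<Longrightarrow> represents H r' v x"
  by (induction v arbitrary: x) (auto simp: preserves_def)

lemma preserves_refl: "preserves H t r r"
  by (simp add: preserves_def)

lemma preserves_trans:
  "preserves H t r r' \<Longrightarrow> preserves H t' r' r'' \<Longrightarrow> t \<le> t' \<Longrightarrow> preserves H t r r''"
  by (auto simp: preserves_def)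

lemma preserves_mono: "preserves H t' r r' \<Longrightarrow> t \<le> t' \<Longrightarrow> preserves H t r r'"
  by (auto simp: preserves_def)

lemma preserves_update: "t \<le> a \<Longrightarrow> 4 \<le> t \<Longrightarrow> a < H \<Longrightarrow> preserves H t r (r(a := x))"
  by (auto simp: preserves_def)

lemma runtime_ok_preserves:
  "runtime_ok H N r \<Longrightarrow> preserves H t r r' \<Longrightarrow> 4 \<le> t \<Longrightarrow> runtime_ok H N r'"
  by (auto simp: runtime_ok_def preserves_def)

definition compiles_correctly :: "nat \<Rightarrow> expr \<Rightarrow> data \<Rightarrow> data \<Rightarrow> bool" where
  "compiles_correctly N f u v \<longleftrightarrow> (\<forall>P p t H r.
     code_at P p (compile p t f) \<and> 4 \<le> t \<and> t + regs f \<le> H \<and> runtime_ok H N r \<and>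
         represents H r u (r t) \<longrightarrow>
     (\<exists>r'. reaches P (steps N f) (p, r) (p + length (compile p t f), r') \<and>
        preserves H t r r' \<and> represents H r' v (r' t)))"

lemma compiles_correctlyD:
  assumes "compiles_correctly N f u v"
    and "code_at P p (compile p t f)" "4 \<le> t" "t + regs f \<le> H" "runtime_ok H N r"
      "represents H r u (r t)"
  obtains r' where "reaches P (steps N f) (p, r) (p + length (compile p t f), r')"
    "preserves H t r r'" "represents H r' v (r' t)"
  using assms unfolding compiles_correctly_def by blast

lemma compiles_correctly_exec:
  assumes "\<And>p t. compile p t f = c t" "\<And>t. \<forall>i\<in>set (c t). \<not> is_jump i" "\<And>t. length (c t) \<le> steps N f"
    and "\<And>t H r. 4 \<le> t \<Longrightarrow> t < H \<Longrightarrow> runtime_ok H N r \<Longrightarrow> represents H r u (r t) \<Longrightarrow>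
      preserves H t r (exec (c t) r) \<and> represents H (exec (c t) r) v (exec (c t) r t)"
  shows "compiles_correctly N f u v"
  unfolding compiles_correctly_def
proof (intro allI impI, elim conjE)
  fix P p t H r
  assume code: "code_at P p (compile p t f)"
    and "4 \<le> t" "t + regs f \<le> H" "runtime_ok H N r" "represents H r u (r t)"
  then have "preserves H t r (exec (c t) r) \<and> represents H (exec (c t) r) v (exec (c t) r t)"
    using regs_pos[of f] by (intro assms(4)) auto
  moreover have "reaches P (steps N f) (p, r) (p + length (compile p t f), exec (c t) r)"
    using reaches_mono[OF reaches_exec assms(3)] code assms(1,2) by simp
  ultimately show "\<exists>r'. reaches P (steps N f) (p, r) (p + length (compile p t f), r') \<and>
      preserves H t r r' \<and> represents H r' v (r' t)" by blast
qed

lemma compiles_correctly_Ident: "compiles_correctly N Ident v v"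
  by (rule compiles_correctly_exec[where c = "\<lambda>t. []"]) (auto simp: preserves_refl)

lemma compiles_correctly_Const: "compiles_correctly N (Const n) u (Atom n)"
  by (rule compiles_correctly_exec[where c = "\<lambda>t. [IConst t n]"]) (auto simp: preserves_update)

lemma compiles_correctly_First: "compiles_correctly N First (Cell v w) v"
proof (rule compiles_correctly_exec[where c = "\<lambda>t. [ILoad t t]"])
  fix t H :: nat and r :: "nat \<Rightarrow> nat"
  assume cell: "4 \<le> t" "t < H" "represents H r (Cell v w) (r t)"
  then have "preserves H t r (r(t := r (r t)))" by (intro preserves_update) auto
  then show "preserves H t r (exec [ILoad t t] r) \<and>
      represents H (exec [ILoad t t] r) v (exec [ILoad t t] r t)"
    using cell(3) represents_preserves by simp
qed simp_all

lemma compiles_correctly_Second: "compiles_correctly N Second (Cell v w) w"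
proof (rule compiles_correctly_exec[where c = "\<lambda>t. [IAdd t t 1, ILoad t t]"])
  fix t H :: nat and r :: "nat \<Rightarrow> nat"
  assume cell: "4 \<le> t" "t < H" "runtime_ok H N r" "represents H r (Cell v w) (r t)"
  let ?r = "r(t := r (Suc (r t)))"
  have "exec [IAdd t t 1, ILoad t t] r = ?r" using cell by (auto simp: runtime_ok_def)
  moreover have update_preserves: "preserves H t r ?r" using cell by (intro preserves_update) auto
  moreover have "represents H ?r w (?r t)" using cell(4) represents_preserves[OF update_preserves]
    by simp
  ultimately show "preserves H t r (exec [IAdd t t 1, ILoad t t] r) \<and>
      represents H (exec [IAdd t t 1, ILoad t t] r) w (exec [IAdd t t 1, ILoad t t] r t)"
    by (simp only:)
qed simp_all

lemma compiles_correctly_Comp: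
  assumes f_correct: "compiles_correctly N f u v" and g_correct: "compiles_correctly N g v w"
  shows "compiles_correctly N (Comp f g) u w"
  unfolding compiles_correctly_def
proof (intro allI impI, elim conjE)
  fix P p t H r
  assume code: "code_at P p (compile p t (Comp f g))" and bounds: "4 \<le> t" "t + regs (Comp f g) \<le> H"
    and init: "runtime_ok H N r" "represents H r u (r t)"
  let ?q = "p + length (compile p t f)"
  obtain r1 where r1: "reaches P (steps N f) (p, r) (?q, r1)" "preserves H t r r1"
    "represents H r1 v (r1 t)"
    by (rule compiles_correctlyD[OF f_correct _ _ _ init]) (use code bounds in auto)
  have runtime: "runtime_ok H N r1" by (rule runtime_ok_preserves[OF init(1) r1(2) bounds(1)])
  obtain r2 where r2: "reaches P (steps N g) (?q, r1) (?q + length (compile ?q t g), r2)"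
    "preserves H t r1 r2" "represents H r2 w (r2 t)"
    by (rule compiles_correctlyD[OF g_correct _ _ _ runtime r1(3)]) (use code bounds in auto)
  show "\<exists>r'. reaches P (steps N (Comp f g)) (p, r) (p + length (compile p t (Comp f g)), r') \<and>
      preserves H t r r' \<and> represents H r' w (r' t)"
    using reaches_trans[OF r1(1) r2(1)] preserves_trans[OF r1(2) r2(2)] r2(3)
    by (auto simp: add.assoc)
qed

lemma compiles_correctly_on_copy:
  assumes f_correct: "compiles_correctly N f u v"
    and code: "code_at P p (IAdd s t 0 # compile (Suc p) s f)"
    and bounds: "4 \<le> t" "t < s" "s + regs f \<le> H"
    and init: "runtime_ok H N r" "represents H r u (r t)"
  obtains r' where "reaches P (Suc (steps N f)) (p, r) (p + length (compile (Suc p) s f) + 1, r')"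
    "preserves H s r r'" "represents H r' v (r' s)" "runtime_ok H N r'"
proof -
  let ?r = "r(s := r t)"
  have copy_preserves: "preserves H s r ?r" using bounds regs_pos[of f]
    by (intro preserves_update) auto
  have runtime: "runtime_ok H N ?r" using runtime_ok_preserves[OF init(1) copy_preserves] bounds
    by simp
  have "represents H ?r u (?r s)" using represents_preserves[OF copy_preserves init(2)] by simp
  then obtain r' where r':
    "reaches P (steps N f) (Suc p, ?r) (Suc p + length (compile (Suc p) s f), r')"
    "preserves H s ?r r'" "represents H r' v (r' s)"
    using compiles_correctlyD[OF f_correct, of P "Suc p" s H ?r] code bounds runtime by auto
  have "reaches P 1 (p, r) (Suc p, ?r)"
    using code init(1) by (intro reaches_step) (auto simp: runtime_ok_def)
  from reaches_trans[OF this r'(1)]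
  have "reaches P (Suc (steps N f)) (p, r) (p + length (compile (Suc p) s f) + 1, r')" by simp
  moreover have all_preserves: "preserves H s r r'"
    by (rule preserves_trans[OF copy_preserves r'(2) order_refl])
  moreover have "runtime_ok H N r'" using runtime_ok_preserves[OF init(1) all_preserves] bounds
    by simp
  ultimately show thesis using that r'(3) by blast
qed

lemma exec_compile_op:
  assumes "op_value b v w x" "4 \<le> t" "t + 3 \<le> H" "runtime_ok H N r"
    and "represents H r v (r (t+1))" "represents H r w (r (t+2))"
  shows "preserves H t r (exec (compile_op t b) r)"
    "represents H (exec (compile_op t b) r) x (exec (compile_op t b) r t)"
proof -
  have "preserves H t r (exec (compile_op t b) r) \<and>
      represents H (exec (compile_op t b) r) x (exec (compile_op t b) r t)"
    using assms(1)
  proof cases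
    case op_Cons
    define h where "h = r 2"
    have heap: "H \<le> h" "r 1 = 1" using assms(4) by (auto simp: h_def runtime_ok_def)
    have "exec (compile_op t Cons) r = r(h := r (t+1), Suc h := r (t+2), t := h, 2 := Suc (Suc h))"
      using assms(2,3) heap by (auto simp: h_def[symmetric] fun_eq_iff)
    moreover have update_preserves:
      "preserves H t r (r(h := r (t+1), Suc h := r (t+2), t := h, 2 := Suc (Suc h)))"
      using assms(2,3) heap by (auto simp: preserves_def h_def)
    ultimately show ?thesis
      using represents_preserves[OF update_preserves] assms(2,3,5,6) heap op_Cons by auto
  qed (use assms in \<open>auto intro: preserves_update\<close>)
  then show "preserves H t r (exec (compile_op t b) r)"
    "represents H (exec (compile_op t b) r) x (exec (compile_op t b) r t)" by auto
qed

lemma compiles_correctly_Op: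
  assumes f_correct: "compiles_correctly N f u v" and g_correct: "compiles_correctly N g u w"
    and op: "op_value b v w x"
  shows "compiles_correctly N (Op b f g) u x"
  unfolding compiles_correctly_def
proof (intro allI impI, elim conjE)
  fix P p t H r
  assume code: "code_at P p (compile p t (Op b f g))" and bounds: "4 \<le> t" "t + regs (Op b f g) \<le> H"
    and init: "runtime_ok H N r" "represents H r u (r t)"
  define q where "q = p + length (compile (Suc p) (t+1) f) + 1"
  define q' where "q' = q + length (compile (Suc q) (t+2) g) + 1"
  have code: "code_at P p (IAdd (t+1) t 0 # compile (Suc p) (t+1) f)"
    "code_at P q (IAdd (t+2) t 0 # compile (Suc q) (t+2) g)" "code_at P q' (compile_op t b)"
    using code by (simp_all add: q_def q'_def Let_def add_ac)
  obtain r1 where r1: "reaches P (Suc (steps N f)) (p, r) (q, r1)" "preserves H (t+1) r r1"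
      "represents H r1 v (r1 (t+1))" "runtime_ok H N r1"
    using compiles_correctly_on_copy[OF f_correct code(1) bounds(1) _ _ init] bounds unfolding q_def
    by auto
  have "represents H r1 u (r1 t)"
    using represents_preserves[OF r1(2) init(2)] r1(2) bounds by (simp add: preserves_def)
  from compiles_correctly_on_copy[OF g_correct code(2) bounds(1) _ _ r1(4) this]
  obtain r2 where r2: "reaches P (Suc (steps N g)) (q, r1) (q', r2)" "preserves H (t+2) r1 r2"
      "represents H r2 w (r2 (t+2))" "runtime_ok H N r2"
    using bounds unfolding q'_def by auto
  have "represents H r2 v (r2 (t+1))"
    using represents_preserves[OF r2(2) r1(3)] r2(2) bounds by (simp add: preserves_def)
  note op = exec_compile_op[OF op bounds(1) _ r2(4) this r2(3)]
  have "\<forall>i\<in>set (compile_op t b). \<not> is_jump i" "length (compile_op t b) \<le> 5" by (cases b; simp)+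
  then have "reaches P 5 (q', r2) (q' + length (compile_op t b), exec (compile_op t b) r2)"
    using reaches_mono[OF reaches_exec[OF code(3)]] by blast
  from reaches_trans[OF reaches_trans[OF r1(1) r2(1)] this]
  have "reaches P (steps N (Op b f g)) (p, r)
      (p + length (compile p t (Op b f g)), exec (compile_op t b) r2)"
    by (simp add: q_def q'_def Let_def add_ac)
  moreover have "preserves H t r2 (exec (compile_op t b) r2)" using op bounds by simp
  then have "preserves H t r (exec (compile_op t b) r2)"
    using preserves_mono[OF r1(2), of t] preserves_mono[OF r2(2), of t]
    by (auto intro: preserves_trans)
  ultimately show
    "\<exists>r'. reaches P (steps N (Op b f g)) (p, r) (p + length (compile p t (Op b f g)), r') \<and>
      preserves H t r r' \<and> represents H r' x (r' t)"
    using op bounds by auto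
qed

lemma compiles_correctly_Cond_branches:
  assumes branches_correct: "compiles_correctly N (if v = Atom 0 then g else f) u w"
    and code: "code_at P p [IJz s (Suc q)]" "code_at P (Suc p) (compile (Suc p) t f)"
      "code_at P q [IJz 0 l]" "code_at P (Suc q) (compile (Suc q) t g)"
    and q_eq: "q = Suc p + length (compile (Suc p) t f)"
    and l_eq: "l = Suc q + length (compile (Suc q) t g)"
    and bounds: "4 \<le> t" "t + regs f \<le> H" "t + regs g \<le> H"
    and init: "runtime_ok H N r" "represents H r u (r t)" "represents H r v (r s)"
  obtains r' where "reaches P (2 + steps N f + steps N g) (p, r) (l, r')"
    "preserves H t r r'" "represents H r' w (r' t)"
proof (cases "v = Atom 0")
  case True
  then have g_correct: "compiles_correctly N g u w" using branches_correct by simp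
  from compiles_correctlyD[OF g_correct code(4) bounds(1,3) init(1,2), folded l_eq]
  obtain r' where r': "reaches P (steps N g) (Suc q, r) (l, r')" "preserves H t r r'"
    "represents H r' w (r' t)" .
  have "reaches P 1 (p, r) (Suc q, r)" using reaches_jump[OF code(1), of r] init(3) True by simp
  then have "reaches P (1 + steps N g) (p, r) (l, r')" using r'(1) by (rule reaches_trans)
  then have "reaches P (2 + steps N f + steps N g) (p, r) (l, r')" by (rule reaches_mono) simp
  then show thesis using that r'(2,3) by blast
next
  case False
  then have f_correct: "compiles_correctly N f u w" using branches_correct by simp
  from compiles_correctlyD[OF f_correct code(2) bounds(1,2) init(1,2), folded q_eq]
  obtain r' where r': "reaches P (steps N f) (Suc p, r) (q, r')" "preserves H t r r'"
    "represents H r' w (r' t)" .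
  have "r s \<noteq> 0" using init(3) False bounds regs_pos[of f] by (cases v) auto
  then have "reaches P 1 (p, r) (Suc p, r)" using reaches_jump[OF code(1), of r] by simp
  moreover have "r' 0 = 0" using runtime_ok_preserves[OF init(1) r'(2) bounds(1)]
    by (simp add: runtime_ok_def)
  then have "reaches P 1 (q, r') (l, r')" using reaches_jump[OF code(3), of r'] by simp
  ultimately have "reaches P (1 + (steps N f + 1)) (p, r) (l, r')"
    using r'(1) by (blast intro: reaches_trans)
  then have "reaches P (2 + steps N f + steps N g) (p, r) (l, r')" by (rule reaches_mono) simp
  then show thesis using that r'(2,3) by blast
qed

lemma compiles_correctly_Cond:
  assumes c_correct: "compiles_correctly N c u v"
    and branches_correct: "compiles_correctly N (if v = Atom 0 then g else f) u w"
  shows "compiles_correctly N (Cond c f g) u w"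
  unfolding compiles_correctly_def
proof (intro allI impI, elim conjE)
  fix P p t H r
  assume code: "code_at P p (compile p t (Cond c f g))"
    and bounds: "4 \<le> t" "t + regs (Cond c f g) \<le> H"
    and init: "runtime_ok H N r" "represents H r u (r t)"
  define branch where "branch = p + length (compile (Suc p) (t+1) c) + 1"
  define skip where "skip = Suc branch + length (compile (Suc branch) t f)"
  define exit where "exit = Suc skip + length (compile (Suc skip) t g)"
  have code: "code_at P p (IAdd (t+1) t 0 # compile (Suc p) (t+1) c)"
    "code_at P branch [IJz (t+1) (Suc skip)]" "code_at P (Suc branch) (compile (Suc branch) t f)"
    "code_at P skip [IJz 0 exit]" "code_at P (Suc skip) (compile (Suc skip) t g)"
    and exit: "p + length (compile p t (Cond c f g)) = exit"
    using code by (simp_all add: branch_def skip_def exit_def Let_def add_ac numeral_eq_Suc)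
  obtain r1 where r1: "reaches P (Suc (steps N c)) (p, r) (branch, r1)" "preserves H (t+1) r r1"
      "represents H r1 v (r1 (t+1))" "runtime_ok H N r1"
    using compiles_correctly_on_copy[OF c_correct code(1) bounds(1) _ _ init] bounds
    unfolding branch_def by auto
  have arg: "represents H r1 u (r1 t)"
    using represents_preserves[OF r1(2) init(2)] r1(2) bounds by (simp add: preserves_def)
  obtain r2 where r2: "reaches P (2 + steps N f + steps N g) (branch, r1) (exit, r2)"
      "preserves H t r1 r2" "represents H r2 w (r2 t)"
    by (rule compiles_correctly_Cond_branches[OF branches_correct code(2-5) skip_def exit_def
      bounds(1) _ _ r1(4) arg r1(3)])
      (use bounds in auto)
  have "reaches P (steps N (Cond c f g)) (p, r) (p + length (compile p t (Cond c f g)), r2)"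
    using reaches_trans[OF r1(1) r2(1)] unfolding exit by (simp add: numeral_eq_Suc add_ac)
  moreover have "preserves H t r r2" using preserves_trans[OF preserves_mono[OF r1(2)] r2(2)]
    by simp
  ultimately show
    "\<exists>r'. reaches P (steps N (Cond c f g)) (p, r) (p + length (compile p t (Cond c f g)), r') \<and>
      preserves H t r r' \<and> represents H r' w (r' t)"
    using r2(3) by blast
qed

lemma compiles_correctly_Iter_round:
  assumes f_correct: "compiles_correctly N f u v"
    and code: "code_at P p ([IJz t l] @ compile (Suc p) (t+1) f @ [ISub t t 1] @ [IJz 0 p])"
    and bounds: "4 \<le> t" "t + regs f + 2 \<le> H"
    and init: "runtime_ok H N r" "represents H r u (r (t+1))" "r t = Suc m"
  obtains r' where "reaches P (3 + steps N f) (p, r) (p, r')"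
    "preserves H t r r'" "represents H r' v (r' (t+1))" "r' t = m"
proof -
  define q where "q = Suc p + length (compile (Suc p) (t+1) f)"
  have code: "code_at P p [IJz t l]" "code_at P (Suc p) (compile (Suc p) (t+1) f)"
    "code_at P q [ISub t t 1]" "code_at P (Suc q) [IJz 0 p]"
    using code by (auto simp: q_def)
  have enter: "reaches P 1 (p, r) (Suc p, r)" using reaches_jump[OF code(1), of r] init(3) by simp
  from compiles_correctlyD[OF f_correct code(2) _ _ init(1,2)]
  obtain r1 where r1: "reaches P (steps N f) (Suc p, r) (q, r1)" "preserves H (t+1) r r1"
    "represents H r1 v (r1 (t+1))"
    using bounds unfolding q_def by auto
  let ?r2 = "r1(t := m)"
  have runtime: "r1 1 = 1" "r1 0 = 0"
    using runtime_ok_preserves[OF init(1) r1(2)] bounds by (auto simp: runtime_ok_def)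
  have "r1 t = Suc m" using r1(2) init(3) bounds by (simp add: preserves_def)
  then have "reaches P 1 (q, r1) (Suc q, ?r2)" using code(3) runtime by (intro reaches_step) simp
  moreover have "reaches P 1 (Suc q, ?r2) (p, ?r2)"
    using reaches_jump[OF code(4), of ?r2] runtime bounds by simp
  ultimately have "reaches P (1 + (steps N f + (1 + 1))) (p, r) (p, ?r2)"
    using enter r1(1) by (blast intro: reaches_trans)
  then have "reaches P (3 + steps N f) (p, r) (p, ?r2)" by (simp add: numeral_eq_Suc)
  moreover have update_preserves: "preserves H t r1 ?r2" using bounds
    by (intro preserves_update) auto
  moreover have "preserves H t r ?r2"
    using preserves_trans[OF preserves_mono[OF r1(2)] update_preserves] by simp
  moreover have "represents H ?r2 v (?r2 (t+1))"
    using represents_preserves[OF update_preserves r1(3)] by simp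
  ultimately show thesis using that by simp
qed

lemma compiles_correctly_Iter_loop:
  assumes f_correct: "\<And>i. i < N \<Longrightarrow> compiles_correctly N f (X i) (X (Suc i))"
    and code: "code_at P p ([IJz t l] @ compile (Suc p) (t+1) f @ [ISub t t 1] @ [IJz 0 p])"
    and bounds: "4 \<le> t" "t + regs f + 2 \<le> H"
    and init: "runtime_ok H N r" "represents H r (X 0) (r (t+1))" "r t = N"
  obtains r' where "reaches P (N * (3 + steps N f)) (p, r) (p, r')"
    "preserves H t r r'" "represents H r' (X N) (r' (t+1))" "r' t = 0"
proof -
  define Inv where
    "Inv i s \<longleftrightarrow> preserves H t r s \<and> represents H s (X i) (s (t+1)) \<and> s t = N - i" for i s
  have "\<exists>s'. reaches P (3 + steps N f) (p, s) (p, s') \<and> Inv (Suc i) s'"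
    if inv: "i < N" "Inv i s" for i s
  proof -
    have state: "preserves H t r s" "represents H s (X i) (s (t+1))" "s t = Suc (N - Suc i)"
      using inv by (auto simp: Inv_def)
    have runtime: "runtime_ok H N s" by (rule runtime_ok_preserves[OF init(1) state(1) bounds(1)])
    obtain s' where "reaches P (3 + steps N f) (p, s) (p, s')" "preserves H t s s'"
        "represents H s' (X (Suc i)) (s' (t+1))" "s' t = N - Suc i"
      by (rule compiles_correctly_Iter_round[OF f_correct[OF inv(1)] code bounds runtime
        state(2,3)])
    then show ?thesis unfolding Inv_def using preserves_trans[OF state(1)] by blast
  qed
  moreover have "Inv 0 r" using init by (simp add: Inv_def preserves_refl)
  ultimately obtain r' where "reaches P (N * (3 + steps N f)) (p, r) (p, r')" "Inv N r'"
    using reaches_iterate[of Inv r] by blast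
  then show thesis using that by (auto simp: Inv_def)
qed

lemma compiles_correctly_Iter:
  assumes f_correct: "\<And>i. i < N \<Longrightarrow> compiles_correctly N f (X i) (X (Suc i))"
  shows "compiles_correctly N (Iter f) (X 0) (X N)"
  unfolding compiles_correctly_def
proof (intro allI impI, elim conjE)
  fix P p t H r
  assume code: "code_at P p (compile p t (Iter f))" and bounds: "4 \<le> t" "t + regs (Iter f) \<le> H"
    and init: "runtime_ok H N r" "represents H r (X 0) (r t)"
  define exit where "exit = p + 5 + length (compile (p + 3) (t+1) f)"
  have code: "code_at P p [IAdd (t+1) t 0, IAdd t 3 0]"
    "code_at P (p + 2) ([IJz t exit] @ compile (Suc (p + 2)) (t+1) f @ [ISub t t 1] @
        [IJz 0 (p + 2)])"
    "code_at P (p + 2) [IJz t exit]" "code_at P exit [IAdd t (t+1) 0]"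
    using code by (simp_all add: exit_def Let_def add_ac numeral_eq_Suc)
  let ?r1 = "r(t+1 := r t, t := N)"
  have "exec [IAdd (t+1) t 0, IAdd t 3 0] r = ?r1" using init bounds
    by (auto simp: runtime_ok_def fun_eq_iff)
  then have start: "reaches P 2 (p, r) (p + 2, ?r1)"
    using reaches_exec[OF code(1), of r] by (simp add: numeral_2_eq_2)
  have start_preserves: "preserves H t r ?r1" using bounds regs_pos[of f]
    by (auto simp: preserves_def)
  have runtime: "runtime_ok H N ?r1"
    by (rule runtime_ok_preserves[OF init(1) start_preserves bounds(1)])
  obtain r2 where r2: "reaches P (N * (3 + steps N f)) (p + 2, ?r1) (p + 2, r2)"
      "preserves H t ?r1 r2" "represents H r2 (X N) (r2 (t+1))" "r2 t = 0"
    by (rule compiles_correctly_Iter_loop[where X = X, OF f_correct code(2) bounds(1) _ runtime])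
      (use bounds represents_preserves[OF start_preserves init(2)] in auto)
  let ?r3 = "r2(t := r2 (t+1))"
  have "reaches P 1 (p + 2, r2) (exit, r2)" using reaches_jump[OF code(3), of r2] r2(4) by simp
  moreover have "r2 0 = 0" using runtime_ok_preserves[OF runtime r2(2) bounds(1)]
    by (simp add: runtime_ok_def)
  then have "reaches P 1 (exit, r2) (Suc exit, ?r3)" using code(4) by (intro reaches_step) simp
  ultimately have "reaches P (2 + (N * (3 + steps N f) + (1 + 1))) (p, r) (Suc exit, ?r3)"
    using start r2(1) by (blast intro: reaches_trans)
  then have "reaches P (steps N (Iter f)) (p, r) (p + length (compile p t (Iter f)), ?r3)"
    by (simp add: exit_def Let_def numeral_eq_Suc add_ac)
  moreover have final_preserves: "preserves H t r2 ?r3" using bounds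
    by (intro preserves_update) auto
  moreover have "represents H ?r3 (X N) (?r3 t)"
    using represents_preserves[OF final_preserves r2(3)] by simp
  ultimately show
    "\<exists>r'. reaches P (steps N (Iter f)) (p, r) (p + length (compile p t (Iter f)), r') \<and>
      preserves H t r r' \<and> represents H r' (X N) (r' t)"
    using preserves_trans[OF start_preserves r2(2)] preserves_trans[OF _ final_preserves] by blast
qed

lemma compile_correct: "evaluates N f u v \<Longrightarrow> compiles_correctly N f u v"
  by (induction rule: evaluates.induct)
    (blast intro: compiles_correctly_Ident compiles_correctly_Comp compiles_correctly_Op
      compiles_correctly_First compiles_correctly_Second compiles_correctly_Const
      compiles_correctly_Cond compiles_correctly_Iter)+

section \<open>Functions computable in polynomial time\<close>

class encodable = fixes encode :: "'a \<Rightarrow> data"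

instantiation nat :: encodable
begin
definition encode_nat :: "nat \<Rightarrow> data" where "encode_nat n = Atom n"
instance ..
end

instantiation bool :: encodable
begin
definition encode_bool :: "bool \<Rightarrow> data" where "encode_bool b = Atom (if b then 1 else 0)"
instance ..
end

instantiation prod :: (encodable, encodable) encodable
begin
definition encode_prod :: "'a \<times> 'b \<Rightarrow> data" where
  "encode_prod p = Cell (encode (fst p)) (encode (snd p))"
instance ..
end

instantiation list :: (encodable) encodable
begin
primrec encode_list :: "'a list \<Rightarrow> data" where
  "encode_list [] = Atom 0"
| "encode_list (x # xs) = Cell (encode x) (encode_list xs)"
instance ..
end

instantiation loc :: encodable
begin
fun encode_loc :: "loc \<Rightarrow> data" where
  "encode_loc (Server m) = Cell (Atom 0) (Atom m)"
| "encode_loc (Cloud c) = Cell (Atom 1) (Atom c)"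
instance ..
end

text \<open>No time bound is needed: every program is polynomial.  The first argument of \<open>f\<close> is the window
  \<open>N ^ D\<close>, after which loops over lists and numbers are cut off.\<close>

definition polytime :: "nat \<Rightarrow> (nat \<Rightarrow> 'a::encodable \<Rightarrow> 'b::encodable) \<Rightarrow> bool" where
  "polytime D f \<longleftrightarrow> (\<exists>c. \<forall>N x. evaluates N c (encode x) (encode (f (N ^ D) x)))"

abbreviation polytime2 ::
  "nat \<Rightarrow> (nat \<Rightarrow> 'a::encodable \<Rightarrow> 'b::encodable \<Rightarrow> 'c::encodable) \<Rightarrow> bool" where
  "polytime2 D F \<equiv> polytime D (\<lambda>W y. F W (fst y) (snd y))"

abbreviation polytime3 ::
  "nat \<Rightarrow> (nat \<Rightarrow> 'a::encodable \<Rightarrow> 'b::encodable \<Rightarrow> 'c::encodable \<Rightarrow> 'd::encodable) \<Rightarrow> bool" where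
  "polytime3 D F \<equiv> polytime D (\<lambda>W y. F W (fst y) (fst (snd y)) (snd (snd y)))"

abbreviation polytime4 ::
  "nat \<Rightarrow> (nat \<Rightarrow> 'a::encodable \<Rightarrow> 'b::encodable \<Rightarrow> 'c::encodable \<Rightarrow> 'd::encodable \<Rightarrow> 'e::encodable) \<Rightarrow> bool"
where
  "polytime4 D F \<equiv>
  polytime D (\<lambda>W y. F W (fst y) (fst (snd y)) (fst (snd (snd y))) (snd (snd (snd y))))"

abbreviation polytime5 ::
  "nat \<Rightarrow> (nat \<Rightarrow> 'a::encodable \<Rightarrow> 'b::encodable \<Rightarrow> 'c::encodable \<Rightarrow> 'd::encodable \<Rightarrow> 'e::encodable \<Rightarrow>
    'f::encodable) \<Rightarrow> bool"
where
  "polytime5 D F \<equiv>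
  polytime D (\<lambda>W y. F W (fst y) (fst (snd y)) (fst (snd (snd y))) (fst (snd (snd (snd y))))
    (snd (snd (snd (snd y)))))"

lemma polytimeI: "(\<And>N x. evaluates N c (encode x) (encode (f (N ^ D) x))) \<Longrightarrow> polytime D f"
  unfolding polytime_def by blast

lemma polytimeE:
  assumes "polytime D f"
  obtains c where "\<And>N x. evaluates N c (encode x) (encode (f (N ^ D) x))"
  using assms unfolding polytime_def by blast

lemma polytime_cong: "polytime D f \<Longrightarrow> (\<And>W x. f W x = g W x) \<Longrightarrow> polytime D g"
  unfolding polytime_def by simp

subsection \<open>Composition\<close>

lemma polytime_ident: "polytime D (\<lambda>W x. x)"
  by (rule polytimeI) (rule ev_Ident)

lemma polytime_compose: "polytime D g \<Longrightarrow> polytime D f \<Longrightarrow> polytime D (\<lambda>W x. g W (f W x))"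
  by (elim polytimeE) (rule polytimeI, rule ev_Comp, assumption+)

lemma polytime_op:
  assumes "polytime D f" "polytime D g"
    and "\<And>W x. op_value b (encode (f W x)) (encode (g W x)) (encode (h W x))"
  shows "polytime D h"
  using assms(1,2) by (elim polytimeE) (rule polytimeI, rule ev_Op, assumption+, rule assms(3))

lemma polytime_Pair: "polytime D f \<Longrightarrow> polytime D g \<Longrightarrow> polytime D (\<lambda>W x. (f W x, g W x))"
  by (rule polytime_op[of D f g Cons]) (simp_all add: encode_prod_def op_Cons)

lemma polytime_fst: "polytime D f \<Longrightarrow> polytime D (\<lambda>W x. fst (f W x))"
  by (rule polytime_compose[of D "\<lambda>W x. fst x"], rule polytimeI[of First])
    (simp_all add: encode_prod_def ev_First)

lemma polytime_snd: "polytime D f \<Longrightarrow> polytime D (\<lambda>W x. snd (f W x))"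
  by (rule polytime_compose[of D "\<lambda>W x. snd x"], rule polytimeI[of Second])
    (simp_all add: encode_prod_def ev_Second)

lemma polytime_compose2:
  "polytime2 D F \<Longrightarrow> polytime D a \<Longrightarrow> polytime D b \<Longrightarrow> polytime D (\<lambda>W x. F W (a W x) (b W x))"
  using polytime_compose[of D "\<lambda>W y. F W (fst y) (snd y)" "\<lambda>W x. (a W x, b W x)"]
  by (simp add: polytime_Pair)

lemma polytime_compose3:
  "polytime3 D F \<Longrightarrow> polytime D a \<Longrightarrow> polytime D b \<Longrightarrow> polytime D c \<Longrightarrow>
    polytime D (\<lambda>W x. F W (a W x) (b W x) (c W x))"
  using polytime_compose2[of D "\<lambda>W u v. F W u (fst v) (snd v)" a "\<lambda>W x. (b W x, c W x)"]
  by (simp add: polytime_Pair)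

lemma polytime_compose4:
  "polytime4 D F \<Longrightarrow> polytime D a \<Longrightarrow> polytime D b \<Longrightarrow> polytime D c \<Longrightarrow> polytime D d \<Longrightarrow>
    polytime D (\<lambda>W x. F W (a W x) (b W x) (c W x) (d W x))"
  using polytime_compose3[of D "\<lambda>W u v w. F W u v (fst w) (snd w)" a b "\<lambda>W x. (c W x, d W x)"]
  by (simp add: polytime_Pair)

lemma polytime_compose5:
  "polytime5 D F \<Longrightarrow> polytime D a \<Longrightarrow> polytime D b \<Longrightarrow> polytime D c \<Longrightarrow> polytime D d \<Longrightarrow> polytime D e \<Longrightarrow>
    polytime D (\<lambda>W x. F W (a W x) (b W x) (c W x) (d W x) (e W x))"
  using polytime_compose4[of D "\<lambda>W t u v w. F W t u v (fst w) (snd w)" a b c "\<lambda>W x. (d W x, e W x)"]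
  by (simp add: polytime_Pair)

lemma polytime_let:
  "polytime D f \<Longrightarrow> polytime2 D g \<Longrightarrow> polytime D (\<lambda>W x. let v = f W x in g W x v)"
  unfolding Let_def by (rule polytime_compose2[OF _ polytime_ident])

subsection \<open>Arithmetic and case distinctions\<close>

lemma polytime_const: "polytime D (\<lambda>W x. k :: nat)"
  by (rule polytimeI[of "Const k"]) (simp add: encode_nat_def ev_Const)

lemma polytime_True: "polytime D (\<lambda>W x. True)"
  by (rule polytimeI[of "Const 1"], unfold encode_bool_def if_True) (rule ev_Const)

lemma polytime_False: "polytime D (\<lambda>W x. False)"
  by (rule polytimeI[of "Const 0"], unfold encode_bool_def if_False) (rule ev_Const)

lemma polytime_Nil: "polytime D (\<lambda>W x. [])"
  by (rule polytimeI[of "Const 0"], unfold encode_list.simps) (rule ev_Const)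

lemma polytime_Cons: "polytime D f \<Longrightarrow> polytime D g \<Longrightarrow> polytime D (\<lambda>W x. f W x # g W x)"
  by (rule polytime_op[of D f g Cons]) (simp_all add: op_Cons)

lemma polytime_add: "polytime D f \<Longrightarrow> polytime D g \<Longrightarrow> polytime D (\<lambda>W x. f W x + g W x :: nat)"
  by (rule polytime_op[of D f g Plus]) (simp_all add: encode_nat_def op_Plus)

lemma polytime_diff: "polytime D f \<Longrightarrow> polytime D g \<Longrightarrow> polytime D (\<lambda>W x. f W x - g W x :: nat)"
  by (rule polytime_op[of D f g Minus]) (simp_all add: encode_nat_def op_Minus)

lemma polytime_Suc: "polytime D f \<Longrightarrow> polytime D (\<lambda>W x. Suc (f W x))"
  using polytime_add[OF _ polytime_const[of D 1], of f] by simp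

lemma polytime_cond:
  assumes "polytime D c" "polytime D f" "polytime D g"
  shows "polytime D (\<lambda>W x. if encode (c W x) = Atom 0 then g W x else f W x)"
proof -
  obtain p q r where "\<And>N x. evaluates N p (encode x) (encode (c (N ^ D) x))"
    "\<And>N x. evaluates N q (encode x) (encode (f (N ^ D) x))"
    "\<And>N x. evaluates N r (encode x) (encode (g (N ^ D) x))"
    using assms by (metis polytimeE)
  then show ?thesis by (intro polytimeI[of "Cond p q r"] ev_Cond) auto
qed

lemma polytime_if:
  "polytime D b \<Longrightarrow> polytime D f \<Longrightarrow> polytime D g \<Longrightarrow> polytime D (\<lambda>W x. if b W x then f W x else g W x)"
  by (rule polytime_cong[OF polytime_cond[of D b f g]]) (auto simp: encode_bool_def)

lemma polytime_eq_0: "polytime D f \<Longrightarrow> polytime D (\<lambda>W x. f W x = (0::nat))"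
  by (rule polytime_cong[OF polytime_cond[OF _ polytime_False polytime_True, of D f]])
    (auto simp: encode_nat_def)

lemma polytime_le: "polytime D f \<Longrightarrow> polytime D g \<Longrightarrow> polytime D (\<lambda>W x. f W x \<le> (g W x :: nat))"
  by (rule polytime_cong[OF polytime_eq_0[OF polytime_diff, of D f g]]) auto

lemma polytime_not: "polytime D b \<Longrightarrow> polytime D (\<lambda>W x. \<not> b W x)"
  by (rule polytime_cong[OF polytime_if[OF _ polytime_False polytime_True, of D b]]) auto

lemma polytime_conj: "polytime D b \<Longrightarrow> polytime D c \<Longrightarrow> polytime D (\<lambda>W x. b W x \<and> c W x)"
  by (rule polytime_cong[OF polytime_if[OF _ _ polytime_False, of D b c]]) auto

lemma polytime_disj: "polytime D b \<Longrightarrow> polytime D c \<Longrightarrow> polytime D (\<lambda>W x. b W x \<or> c W x)"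
  by (rule polytime_cong[OF polytime_if[OF _ polytime_True, of D b c]]) auto

lemma polytime_less: "polytime D f \<Longrightarrow> polytime D g \<Longrightarrow> polytime D (\<lambda>W x. f W x < (g W x :: nat))"
  by (rule polytime_cong[OF polytime_not[OF polytime_le, of D g f]]) auto

lemma polytime_eq: "polytime D f \<Longrightarrow> polytime D g \<Longrightarrow> polytime D (\<lambda>W x. f W x = (g W x :: nat))"
  by (rule polytime_cong[OF polytime_conj[OF polytime_le[of D f g] polytime_le[of D g f]]]) auto

lemma polytime_max: "polytime D f \<Longrightarrow> polytime D g \<Longrightarrow> polytime D (\<lambda>W x. max (f W x) (g W x :: nat))"
  unfolding max_def by (intro polytime_if polytime_le)

lemma polytime_eq_Nil: "polytime D l \<Longrightarrow> polytime D (\<lambda>W x. l W x = [])"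
proof (rule polytime_cong[OF polytime_cond[OF _ polytime_False polytime_True, of D l]])
  show "(if encode (l W x) = Atom 0 then True else False) = (l W x = [])" for W x
    by (cases "l W x") auto
qed

lemma polytime_tl: assumes "polytime D l" shows "polytime D (\<lambda>W x. tl (l W x))"
proof -
  obtain c where c: "\<And>N x. evaluates N c (encode x) (encode (l (N ^ D) x))"
    using polytimeE[OF assms] by blast
  have "evaluates N (Cond Ident Second Ident) (encode ys) (encode (tl ys))" for N
    and ys :: "'b list"
    by (cases ys; intro ev_Cond[OF ev_Ident]) (auto intro: ev_Second ev_Ident)
  with c show ?thesis by (intro polytimeI[of "Comp c (Cond Ident Second Ident)"] ev_Comp)
qed

lemma polytime_case_list:
  assumes l: "polytime D l" and f: "polytime D f" and g: "polytime3 D g"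
  shows "polytime D (\<lambda>W x. case l W x of [] \<Rightarrow> f W x | h # t \<Rightarrow> g W x h t)"
proof -
  obtain p q r where p: "\<And>N x. evaluates N p (encode x) (encode (l (N ^ D) x))"
    and q: "\<And>N x. evaluates N q (encode x) (encode (f (N ^ D) x))"
    and r: "\<And>N y. evaluates N r (encode y) (encode (g (N ^ D) (fst y) (fst (snd y)) (snd (snd y))))"
    using l f g unfolding polytime_def by blast
  have "evaluates N (Cond p (Comp (Op Cons Ident p) r) q) (encode x)
      (encode (case l (N ^ D) x of [] \<Rightarrow> f (N ^ D) x | h # t \<Rightarrow> g (N ^ D) x h t))" for N x
  proof (rule ev_Cond[OF p], cases "l (N ^ D) x")
    case (Cons h t)
    have "evaluates N (Op Cons Ident p) (encode x) (encode (x, h, t))"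
      using ev_Op[OF ev_Ident p op_Cons, of N] Cons
      by (simp add: encode_prod_def) (metis encode_list.simps(2))
    from ev_Comp[OF this r[of N "(x, h, t)"]]
    show "evaluates N (if encode (l (N ^ D) x) = Atom 0 then q
        else Comp (Op Cons Ident p) r) (encode x)
        (encode (case l (N ^ D) x of [] \<Rightarrow> f (N ^ D) x | h # t \<Rightarrow> g (N ^ D) x h t))"
      using Cons by simp
  qed (use q[of N x] in simp)
  then show ?thesis by (rule polytimeI)
qed

lemma polytime_Server: "polytime D f \<Longrightarrow> polytime D (\<lambda>W x. Server (f W x))"
  by (rule polytime_op[OF polytime_const[of D 0], of f Cons]) (simp_all add: encode_nat_def op_Cons)

lemma polytime_Cloud: "polytime D f \<Longrightarrow> polytime D (\<lambda>W x. Cloud (f W x))"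
  by (rule polytime_op[OF polytime_const[of D 1], of f Cons]) (simp_all add: encode_nat_def op_Cons)

definition loc_index :: "loc \<Rightarrow> nat" where
  "loc_index l = (case l of Server m \<Rightarrow> m | Cloud c \<Rightarrow> c)"

lemma polytime_is_cloud: "polytime D (\<lambda>W l. \<not> is_server l)"
proof (rule polytimeI[of First])
  show "evaluates N First (encode l) (encode (\<not> is_server l))" for N l
    by (cases l) (auto simp: encode_bool_def intro: ev_First)
qed

lemma polytime_loc_index: "polytime D (\<lambda>W l. loc_index l)"
proof (rule polytimeI[of Second])
  show "evaluates N Second (encode l) (encode (loc_index l))" for N l
    by (cases l) (auto simp: encode_nat_def loc_index_def intro: ev_Second)
qed

lemma polytime_case_loc:
  assumes "polytime D l" "polytime2 D f" "polytime2 D g"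
  shows "polytime D (\<lambda>W x. case l W x of Server m \<Rightarrow> f W x m | Cloud c \<Rightarrow> g W x c)"
proof -
  note index = polytime_compose[OF polytime_loc_index assms(1)]
  have "polytime D (\<lambda>W x. if \<not> is_server (l W x) then g W x (loc_index (l W x))
      else f W x (loc_index (l W x)))"
    by (rule polytime_if[OF polytime_compose[OF polytime_is_cloud assms(1)]
          polytime_compose2[OF assms(3) polytime_ident index]
            polytime_compose2[OF assms(2) polytime_ident index]])
  then show ?thesis
    by (rule polytime_cong) (auto simp: loc_index_def split: loc.split)
qed

lemmas polytime_basic = polytime_ident polytime_Pair polytime_fst polytime_snd polytime_const
  polytime_True polytime_False polytime_Nil polytime_Cons polytime_add polytime_diff polytime_Suc
  polytime_if polytime_let polytime_le polytime_less polytime_eq polytime_not polytime_conj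
  polytime_disj polytime_max polytime_eq_Nil polytime_tl polytime_Server polytime_Cloud

subsection \<open>Loops\<close>

fun iter_power :: "nat \<Rightarrow> expr \<Rightarrow> expr" where
  "iter_power 0 f = f"
| "iter_power (Suc D) f = Iter (iter_power D f)"

lemma evaluates_iter_power:
  assumes "\<And>k. evaluates N f (X k) (X (Suc k))"
  shows "evaluates N (iter_power D f) (X j) (X (j + N ^ D))"
proof (induction D arbitrary: j)
  case 0
  then show ?case using assms by simp
next
  case (Suc D)
  have "evaluates N (Iter (iter_power D f)) (X (j + 0 * N ^ D)) (X (j + N * N ^ D))"
    by (rule ev_Iter[of N _ "\<lambda>i. X (j + i * N ^ D)"]) (use Suc[of "j + _ * N ^ D"]
      in \<open>simp add: add_ac\<close>)
  then show ?case by simp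
qed

lemma polytime_iter:
  fixes f :: "nat \<Rightarrow> 'a::encodable \<Rightarrow> 'b::encodable \<Rightarrow> 'b"
  assumes "polytime2 D f" "polytime D i"
  shows "polytime D (\<lambda>W x. (f W x ^^ W) (i W x))"
proof -
  obtain c where c: "\<And>N y. evaluates N c (encode y) (encode (f (N ^ D) (fst y) (snd y)))"
    using assms(1)[unfolded polytime_def] by blast
  have "polytime D (\<lambda>W y. (fst y, (f W (fst y) ^^ W) (snd y)))"
  proof (rule polytimeI[of "iter_power D (Op Cons First c)"])
    fix N :: nat and y :: "'a \<times> 'b"
    define X where "X k = encode (fst y, (f (N ^ D) (fst y) ^^ k) (snd y))" for k
    have "evaluates N (Op Cons First c) (X k) (X (Suc k))" for k
    proof -
      have "evaluates N First (X k) (encode (fst y))" by (simp add: X_def encode_prod_def ev_First)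
      moreover have "evaluates N c (X k) (encode ((f (N ^ D) (fst y) ^^ Suc k) (snd y)))"
        using c[of N "(fst y, (f (N ^ D) (fst y) ^^ k) (snd y))"] by (simp add: X_def)
      ultimately show ?thesis
        unfolding X_def[of "Suc k"] encode_prod_def fst_conv snd_conv
        by (rule ev_Op[OF _ _ op_Cons])
    qed
    from evaluates_iter_power[of N _ X D 0, OF this]
    show "evaluates N (iter_power D (Op Cons First c)) (encode y)
        (encode (fst y, (f (N ^ D) (fst y) ^^ (N ^ D)) (snd y)))"
      by (simp add: X_def)
  qed
  from polytime_snd[OF polytime_compose[OF this polytime_Pair[OF polytime_ident assms(2)]]]
  show ?thesis by simp
qed

definition uncons_step :: "('a \<Rightarrow> 's \<Rightarrow> 's) \<Rightarrow> 'a list \<times> 's \<Rightarrow> 'a list \<times> 's" where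
  "uncons_step f y = (case fst y of [] \<Rightarrow> y | h # t \<Rightarrow> (t, f h (snd y)))"

lemma funpow_uncons_step: "(uncons_step f ^^ n) (xs, s) = (drop n xs, fold f (take n xs) s)"
proof (induction n arbitrary: xs s)
  case (Suc n)
  then show ?case
    by (cases xs) (auto simp: funpow_Suc_right uncons_step_def simp del: funpow.simps)
qed simp

lemma polytime_fold:
  assumes "polytime D l" "polytime D i" "polytime3 D f"
  shows "polytime D (\<lambda>W x. fold (\<lambda>a s. f W x a s) (take W (l W x)) (i W x))"
proof -
  have "polytime D (\<lambda>W z. f W (fst (fst z)) (fst (snd z)) (snd (snd (fst z))))"
    by (rule polytime_compose3[OF assms(3)]) (intro polytime_basic)+
  then have "polytime2 D (\<lambda>W x y. uncons_step (f W x) y)"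
    unfolding uncons_step_def by (intro polytime_basic polytime_case_list)
  from polytime_snd[OF polytime_iter[OF this polytime_Pair[OF assms(1,2)]]] show ?thesis
    by (simp add: funpow_uncons_step)
qed

lemma polytime_rev: "polytime D l \<Longrightarrow> polytime D (\<lambda>W x. rev (take W (l W x)))"
  unfolding rev_conv_fold by (intro polytime_fold polytime_basic)

lemma polytime_foldr:
  assumes "polytime D l" "polytime D i" "polytime3 D f"
  shows "polytime D (\<lambda>W x. foldr (\<lambda>a s. f W x a s) (take W (l W x)) (i W x))"
  using polytime_fold[OF polytime_rev[OF assms(1)] assms(2,3)] by (simp add: foldr_conv_fold)

lemma polytime_ignore_accumulator: "polytime2 D f \<Longrightarrow> polytime D (\<lambda>W y. f W (fst y) (fst (snd y)))"
  by (rule polytime_compose2[OF _ polytime_fst[OF polytime_ident]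
        polytime_fst[OF polytime_snd[OF polytime_ident]]])

lemma polytime_map:
  assumes "polytime D l" "polytime2 D f"
  shows "polytime D (\<lambda>W x. map (\<lambda>a. f W x a) (take W (l W x)))"
proof -
  have "polytime D (\<lambda>W x. foldr (\<lambda>a s. f W x a # s) (take W (l W x)) [])"
    using assms(1) polytime_ignore_accumulator[OF assms(2)] by (intro polytime_foldr polytime_basic)
  moreover have "foldr (\<lambda>a s. g a # s) xs [] = map g xs" for g :: "'b \<Rightarrow> 'c" and xs
    by (induction xs) auto
  ultimately show ?thesis by simp
qed

lemma polytime_filter:
  assumes "polytime D l" "polytime2 D f"
  shows "polytime D (\<lambda>W x. filter (\<lambda>a. f W x a) (take W (l W x)))"
proof -
  have "polytime D (\<lambda>W x. foldr (\<lambda>a s. if f W x a then a # s else s) (take W (l W x)) [])"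
    using assms(1) polytime_ignore_accumulator[OF assms(2)] by (intro polytime_foldr polytime_basic)
  moreover have "foldr (\<lambda>a s. if g a then a # s else s) xs [] = filter g xs" for g :: "'b \<Rightarrow> bool"
    and xs
    by (induction xs) auto
  ultimately show ?thesis by simp
qed

lemma polytime_list_ex:
  assumes "polytime D l" "polytime2 D f"
  shows "polytime D (\<lambda>W x. list_ex (\<lambda>a. f W x a) (take W (l W x)))"
proof -
  have "polytime D (\<lambda>W x. foldr (\<lambda>a s. f W x a \<or> s) (take W (l W x)) False)"
    using assms(1) polytime_ignore_accumulator[OF assms(2)] by (intro polytime_foldr polytime_basic)
  moreover have "foldr (\<lambda>a s. g a \<or> s) xs False = list_ex g xs" for g :: "'b \<Rightarrow> bool" and xs
    by (induction xs) auto
  ultimately show ?thesis by simp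
qed

lemma polytime_append:
  assumes "polytime D l" "polytime D m"
  shows "polytime D (\<lambda>W x. take W (l W x) @ m W x)"
proof -
  have "polytime D (\<lambda>W x. foldr (\<lambda>a s. a # s) (take W (l W x)) (m W x))"
    using assms by (intro polytime_foldr polytime_basic)
  moreover have "foldr (\<lambda>a s. a # s) xs ys = xs @ ys" for xs ys :: "'b list"
    by (induction xs) auto
  ultimately show ?thesis by simp
qed

definition concat_upto :: "nat \<Rightarrow> 'a list list \<Rightarrow> 'a list" where
  "concat_upto W xss = concat (map (take W) (take W xss))"

lemma concat_upto_eq:
  assumes "length xss \<le> W" "\<And>xs. xs \<in> set xss \<Longrightarrow> length xs \<le> W"
  shows "concat_upto W xss = concat xss"
proof -
  have "map (take W) xss = xss" using assms(2) by (intro map_idI) simp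
  then show ?thesis using assms(1) by (simp add: concat_upto_def)
qed

lemma polytime_concat: "polytime D l \<Longrightarrow> polytime D (\<lambda>W x. concat_upto W (l W x))"
proof -
  assume "polytime D l"
  then have "polytime D (\<lambda>W x. foldr (\<lambda>a s. take W a @ s) (take W (l W x)) [])"
    by (intro polytime_foldr polytime_basic polytime_append)
  moreover have "foldr (\<lambda>a s. take W a @ s) xss [] = concat (map (take W) xss)" for W
    and xss :: "'b list list"
    by (induction xss) auto
  ultimately show ?thesis by (simp add: concat_upto_def)
qed

definition decrement_step :: "('s \<Rightarrow> 's) \<Rightarrow> nat \<times> 's \<Rightarrow> nat \<times> 's" where
  "decrement_step f y = (if fst y = 0 then y else (fst y - 1, f (snd y)))"

lemma funpow_decrement_step: "(decrement_step f ^^ n) (k, s) = (k - n, (f ^^ min k n) s)"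
proof (induction n arbitrary: k s)
  case (Suc n)
  then show ?case
    by (cases k) (auto simp: decrement_step_def funpow_Suc_right funpow_swap1
      simp del: funpow.simps(2))
qed simp

lemma polytime_funpow:
  fixes f :: "nat \<Rightarrow> 'a::encodable \<Rightarrow> 'b::encodable \<Rightarrow> 'b"
  assumes "polytime D k" "polytime D i" "polytime2 D f"
  shows "polytime D (\<lambda>W x. (f W x ^^ min (k W x) W) (i W x))"
proof -
  have "polytime D (\<lambda>W y. f W (fst y) (snd (snd y)))"
    by (rule polytime_compose2[OF assms(3)]) (intro polytime_basic)+
  then have "polytime2 D (\<lambda>W x y. decrement_step (f W x) y)"
    unfolding decrement_step_def by (intro polytime_basic)
  from polytime_snd[OF polytime_iter[OF this polytime_Pair[OF assms(1,2)]]] show ?thesis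
    by (simp add: funpow_decrement_step)
qed

definition mult_upto :: "nat \<Rightarrow> nat \<Rightarrow> nat \<Rightarrow> nat" where
  "mult_upto W a b = a * min b W"

lemma mult_upto_eq: "b \<le> W \<Longrightarrow> mult_upto W a b = a * b"
  by (simp add: mult_upto_def)

lemma polytime_mult:
  assumes "polytime D f" "polytime D g"
  shows "polytime D (\<lambda>W x. mult_upto W (f W x) (g W x))"
proof -
  have "polytime D (\<lambda>W x. ((\<lambda>s. s + f W x) ^^ min (g W x) W) 0)"
    by (intro polytime_funpow polytime_basic assms polytime_compose[OF assms(1)])
  moreover have "((\<lambda>s. s + a) ^^ n) 0 = a * n" for a n :: nat by (induction n) auto
  ultimately show ?thesis by (simp add: mult_upto_def)
qed

definition nth_upto :: "nat \<Rightarrow> nat list \<Rightarrow> nat \<Rightarrow> nat" where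
  "nth_upto W xs i = (case drop (min i W) xs of [] \<Rightarrow> 0 | h # t \<Rightarrow> h)"

lemma nth_upto_eq: "i \<le> W \<Longrightarrow> i < length xs \<Longrightarrow> nth_upto W xs i = xs ! i"
  unfolding nth_upto_def by (simp add: Cons_nth_drop_Suc[symmetric])

lemma polytime_nth:
  assumes "polytime D l" "polytime D i"
  shows "polytime D (\<lambda>W x. nth_upto W (l W x) (i W x))"
proof -
  have "(tl ^^ n) xs = drop n xs" for n and xs :: "nat list"
    by (induction n arbitrary: xs) (auto simp: drop_Suc funpow_Suc_right simp del: funpow.simps(2))
  moreover have "polytime D (\<lambda>W x. ((\<lambda>l. tl l) ^^ min (i W x) W) (l W x))"
    using assms by (intro polytime_funpow polytime_basic)
  ultimately show ?thesis
    unfolding nth_upto_def by (intro polytime_case_list polytime_basic) simp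
qed

definition upt_upto :: "nat \<Rightarrow> nat \<Rightarrow> nat list" where
  "upt_upto W n = [n - W..<n]"

lemma upt_upto_eq: "n \<le> W \<Longrightarrow> upt_upto W n = [0..<n]"
  by (simp add: upt_upto_def)

lemma polytime_upt:
  assumes "polytime D n"
  shows "polytime D (\<lambda>W x. upt_upto W (n W x))"
proof -
  define g where "g y = (if fst y = 0 then y else (fst y - 1, (fst y - 1) # snd y))"
    for y :: "nat \<times> nat list"
  have g: "(g ^^ k) (m, []) = (m - k, [m - k..<m])" for k m
  proof (induction k)
    case (Suc k)
    then show ?case by (cases "k < m") (auto simp: g_def upt_conv_Cons Suc_diff_Suc)
  qed simp
  have "polytime D (\<lambda>W y. g (snd y))" unfolding g_def by (intro polytime_basic)
  from polytime_snd[OF polytime_iter[OF this polytime_Pair[OF assms polytime_Nil]]]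
  show ?thesis by (simp add: g upt_upto_def)
qed

definition subtract_step :: "nat \<Rightarrow> nat \<times> nat \<Rightarrow> nat \<times> nat" where
  "subtract_step d y = (if d \<le> fst y then (fst y - d, snd y + 1) else y)"

definition div_upto :: "nat \<Rightarrow> nat \<Rightarrow> nat \<Rightarrow> nat" where
  "div_upto W a d = snd ((subtract_step d ^^ W) (a, 0))"

lemma div_upto_eq:
  assumes "0 < d" "a div d \<le> W"
  shows "div_upto W a d = a div d"
proof -
  have "(subtract_step d ^^ k) (a, 0) = (a - min k (a div d) * d, min k (a div d))" for k
  proof (induction k)
    case (Suc k)
    show ?case
    proof (cases "k < a div d")
      case True
      then have "Suc k * d \<le> a" using assms(1) by (metis Suc_leI less_eq_div_iff_mult_less_eq)
      then show ?thesis using Suc True by (auto simp: subtract_step_def min_def)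
    next
      case False
      then have "a - a div d * d < d" using assms(1) by (simp add: minus_div_mult_eq_mod)
      then show ?thesis using Suc False by (auto simp: subtract_step_def min_def)
    qed
  qed simp
  then show ?thesis using assms(2) by (simp add: div_upto_def)
qed

lemma polytime_div:
  assumes "polytime D f" "polytime D g"
  shows "polytime D (\<lambda>W x. div_upto W (f W x) (g W x))"
proof -
  have "polytime D (\<lambda>W y. subtract_step (g W (fst y)) (snd y))"
    unfolding subtract_step_def by (intro polytime_basic polytime_compose[OF assms(2)])
  from polytime_snd[OF polytime_iter[OF this polytime_Pair[OF assms(1) polytime_const]]]
  show ?thesis by (simp add: div_upto_def)
qed

definition match_step :: "nat \<Rightarrow> bool \<times> nat list \<Rightarrow> bool \<times> nat list" where
  "match_step a s = (case snd s of [] \<Rightarrow> (False, []) | h # t \<Rightarrow> (fst s \<and> a = h, t))"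

definition eq_upto :: "nat \<Rightarrow> nat list \<Rightarrow> nat list \<Rightarrow> bool" where
  "eq_upto W xs ys \<longleftrightarrow> fold match_step (take W xs) (True, ys) = (True, [])"

lemma fold_match_step: "fold match_step xs (b, ys) = (True, []) \<longleftrightarrow> b \<and> xs = ys"
proof (induction xs arbitrary: b ys)
  case (Cons x xs)
  have "fold match_step xs (False, []) = (False, [])" for xs
    by (induction xs) (auto simp: match_step_def)
  then show ?case using Cons by (cases ys) (auto simp: match_step_def)
qed auto

lemma eq_upto_iff: "length xs \<le> W \<Longrightarrow> eq_upto W xs ys \<longleftrightarrow> xs = ys"
  by (simp add: eq_upto_def fold_match_step)

lemma polytime_eq_list:
  assumes "polytime D f" "polytime D g"
  shows "polytime D (\<lambda>W x. eq_upto W (f W x) (g W x))"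
proof -
  define s where "s W x = fold (\<lambda>a s. match_step a s) (take W (f W x)) (True, g W x)" for W x
  have "polytime D s"
    unfolding s_def match_step_def using assms
    by (intro polytime_fold polytime_basic polytime_case_list)
  then have "polytime D (\<lambda>W x. fst (s W x) \<and> snd (s W x) = [])" by (intro polytime_basic)
  then show ?thesis
    by (rule polytime_cong) (simp add: s_def eq_upto_def prod_eq_iff)
qed

lemmas polytime_intros = polytime_basic polytime_fold polytime_rev polytime_map polytime_filter
  polytime_list_ex polytime_append polytime_concat polytime_mult polytime_nth polytime_upt
  polytime_div polytime_eq_list polytime_case_list polytime_case_loc

section \<open>Input and output of the random access machine\<close>

lemma bitlen_le_iff: "bitlen x \<le> m \<longleftrightarrow> x < 2 ^ m"
proof
  assume "bitlen x \<le> m"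
  have "x < 2 ^ bitlen x" unfolding bitlen_def by (rule LeastI[of _ x]) (rule less_exp)
  also have "\<dots> \<le> 2 ^ m" using \<open>bitlen x \<le> m\<close> by (intro power_increasing) auto
  finally show "x < 2 ^ m" .
next
  assume "x < 2 ^ m"
  then show "bitlen x \<le> m" unfolding bitlen_def by (rule Least_le)
qed

definition input_size :: "nat list \<Rightarrow> nat" where
  "input_size xs = length xs + last xs + bitlen (sum_list xs)"

lemma reaches_execI:
  "code_at P p c \<Longrightarrow> \<forall>i\<in>set c. \<not> is_jump i \<Longrightarrow> exec c r = r' \<Longrightarrow> k = length c \<Longrightarrow> q = p + length c \<Longrightarrow>
    reaches P k (p, r) (q, r')"
  using reaches_exec by blast

subsection \<open>Reading the input\<close>

text \<open>The input of length \<open>L\<close> occupies all low registers, and only the length in register 0 may be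
  overwritten.  Doubling it gives the address of a free block, to which the registers 1, 2, ... are
  moved; register 1 then serves as the constant 1.\<close>

definition save_code :: "nat \<Rightarrow> instr list" where
  "save_code m = [IAdd 0 0 0, IStore 0 1, IConst 1 1] @
     concat (map (\<lambda>k. [IAdd 0 0 1, IStore 0 k]) [2..<Suc m])"

definition saved :: "nat list \<Rightarrow> nat \<Rightarrow> (nat \<Rightarrow> nat) \<Rightarrow> bool" where
  "saved xs m r \<longleftrightarrow> r 0 = 2 * length xs + m - 1 \<and> r 1 = 1 \<and>
     (\<forall>i<m. r (2 * length xs + i) = xs ! i) \<and> (\<forall>i. m < i \<and> i \<le> length xs \<longrightarrow> r i = xs ! (i - 1))"

lemma exec_save_code:
  assumes "1 \<le> m" "m \<le> length xs"
  shows "saved xs m (exec (save_code m) (snd (init_conf xs)))"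
  using assms
proof (induction m rule: dec_induct)
  case base
  then show ?case by (auto simp: saved_def save_code_def init_conf_def)
next
  case (step m)
  let ?r = "exec (save_code m) (snd (init_conf xs))"
  have "saved xs m ?r" using step by simp
  then have "saved xs (Suc m) (?r(0 := 2 * length xs + m, 2 * length xs + m := ?r (Suc m)))"
    using step.hyps step.prems by (auto simp: saved_def less_Suc_eq)
  moreover have "exec (save_code (Suc m)) (snd (init_conf xs)) =
      ?r(0 := 2 * length xs + m, 2 * length xs + m := ?r (Suc m))"
    using \<open>saved xs m ?r\<close> step.hyps step.prems by (auto simp: save_code_def saved_def)
  ultimately show ?case by (simp only:)
qed

text \<open>While the input is read, register 2 holds the first free heap cell, 4 the list built so far, 7 the
  sum of its elements and 8 the constant 0.\<close>

definition list_state :: "nat \<Rightarrow> nat list \<Rightarrow> (nat \<Rightarrow> nat) \<Rightarrow> bool" where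
  "list_state H ys r \<longleftrightarrow> r 1 = 1 \<and> r 8 = 0 \<and> H \<le> r 2 \<and> r 7 = sum_list ys \<and>
     represents H r (encode ys) (r 4)"

abbreviation push_body :: "instr list" where
  "push_body \<equiv> [ILoad 5 0, IAdd 7 7 5, IStore 2 5, IAdd 2 2 1, IStore 2 4, ISub 4 2 1, IAdd 2 2 1,
      ISub 0 0 1]"

definition push_code :: "nat \<Rightarrow> instr list" where
  "push_code p = while_code p 8 [ISub 5 0 6] 5 push_body"

lemma list_state_push:
  assumes list: "list_state H ys r" and addr: "r 0 = a" "10 \<le> a" "a < H"
  defines "r' \<equiv> exec ([ISub 5 0 6] @ push_body) r"
  shows "list_state H (r a # ys) r'" "r' 0 = a - 1" "\<forall>c<H. c \<notin> {0, 2, 4, 5, 7} \<longrightarrow> r' c = r c"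
proof -
  define h where "h = r 2"
  have heap: "H \<le> h" "r 1 = 1" using list by (auto simp: list_state_def h_def)
  have r'_eq: "r' = r(5 := r a, 7 := r 7 + r a, h := r a, Suc h := r 4, 4 := h,
      2 := Suc (Suc h), 0 := a - 1)"
    unfolding r'_def using heap addr by (auto simp: h_def[symmetric] fun_eq_iff)
  have "preserves H 0 r r'" using heap addr by (auto simp: preserves_def r'_eq h_def)
  then have "represents H r' (encode ys) (r 4)"
    using list by (auto simp: list_state_def intro: represents_preserves)
  then show "list_state H (r a # ys) r'"
    using list heap addr by (auto simp: list_state_def r'_eq encode_nat_def)
  show "r' 0 = a - 1" "\<forall>c<H. c \<notin> {0, 2, 4, 5, 7} \<longrightarrow> r' c = r c"
    using heap by (auto simp: r'_eq)
qed

lemma push_code_correct: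
  assumes code: "code_at P p (push_code p)" and list: "list_state H ys r"
    and bounds: "r 0 = b + m" "r 6 = b" "9 \<le> b" "b + m < H"
  shows "\<exists>r'. reaches P (m * 11 + 2) (p, r) (p + 11, r') \<and>
    list_state H (map r [Suc b..<Suc (b + m)] @ ys) r' \<and> (\<forall>a<H. a \<notin> {0, 2, 4, 5, 7} \<longrightarrow> r' a = r a)"
proof -
  define Inv where "Inv i s \<longleftrightarrow> s 0 = b + (m - i) \<and>
      list_state H (map r [Suc b + (m - i)..<Suc (b + m)] @ ys) s \<and>
    (\<forall>a<H. a \<notin> {0, 2, 4, 5, 7} \<longrightarrow> s a = r a)" for i s
  have lower: "s 6 = b" if "Inv i s" for i s using that bounds by (auto simp: Inv_def)
  have "\<exists>r'. Inv m r' \<and> reaches P (m * 11 + 2) (p, r) (p + 11, exec [ISub 5 0 6] r')"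
  proof (rule reaches_while[where Inv = Inv])
    show "code_at P p (while_code p 8 [ISub 5 0 6] 5 push_body)"
      using code by (simp add: push_code_def)
    show "Inv 0 r" using list bounds by (simp add: Inv_def)
    show "exec [ISub 5 0 6] s 5 = 0" if "Inv m s" for s using lower[OF that] that
      by (simp add: Inv_def)
  next
    fix i s
    assume inv: "i < m" "Inv i s"
    define a where "a = b + (m - i)"
    define s' where "s' = exec ([ISub 5 0 6] @ push_body) s"
    have addr: "10 \<le> a" "a < H" "a = Suc (a - 1)" "Suc b + (m - Suc i) = a"
      "b + (m - Suc i) = a - 1"
      using inv bounds by (auto simp: a_def)
    have state: "s 0 = a" "list_state H (map r [Suc a..<Suc (b + m)] @ ys) s"
      and same: "\<forall>c<H. c \<notin> {0, 2, 4, 5, 7} \<longrightarrow> s c = r c"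
      using inv(2) by (simp_all add: Inv_def a_def del: upt_Suc)
    have "s a = r a" using same addr by auto
    note push = list_state_push[OF state(2,1) addr(1,2), folded s'_def, unfolded \<open>s a = r a\<close>]
    have "map r [a..<Suc (b + m)] = r a # map r [Suc a..<Suc (b + m)]"
      using inv by (subst upt_conv_Cons) (auto simp: a_def)
    then have "Inv (Suc i) s'"
      unfolding Inv_def addr(4,5) using push same by (simp del: upt_Suc)
    moreover have "s' 8 = 0" using push(1) by (simp add: list_state_def)
    moreover have "exec [ISub 5 0 6] s 5 \<noteq> 0" using inv state(1) lower[OF inv(2)]
      by (simp add: a_def)
    ultimately show "exec [ISub 5 0 6] s 5 \<noteq> 0 \<and> exec ([ISub 5 0 6] @ push_body) s 8 = 0 \<and>
        Inv (Suc i) (exec ([ISub 5 0 6] @ push_body) s)"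
      unfolding s'_def by blast
  qed simp_all
  then obtain r' where r': "Inv m r'" "reaches P (m * 11 + 2) (p, r) (p + 11, exec [ISub 5 0 6] r')"
    by blast
  then have "list_state H (map r [Suc b..<Suc (b + m)] @ ys) (exec [ISub 5 0 6] r')"
    using represents_preserves[of H 5 r' "exec [ISub 5 0 6] r'"] bounds
    by (auto simp: Inv_def list_state_def preserves_def)
  then show ?thesis using r' by (auto simp: Inv_def)
qed

text \<open>Register 0 leaves \<open>save_code 9\<close> as \<open>2 * L + 8\<close>; the loop halves \<open>2 * L\<close>.\<close>

definition init_code :: "nat \<Rightarrow> instr list" where
  "init_code B = save_code 9 @ [IConst 6 8, ISub 5 0 6, IConst 6 2, IConst 3 0, IConst 8 0] @
     while_code 24 8 [] 5 [ISub 5 5 6, IAdd 3 3 1] @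
     [IConst 5 (B + 1), IAdd 2 0 5, IConst 4 0, IConst 7 0, IConst 6 9, IAdd 0 3 8]"

definition list_code :: "nat \<Rightarrow> instr list" where
  "list_code p = push_code p @ [IAdd 6 3 3, ISub 6 6 1, IConst 5 9, IAdd 0 6 5] @
      push_code (p + 15)"

definition size_code :: "nat \<Rightarrow> instr list" where
  "size_code p = [ILoad 5 3, IAdd 3 3 5, IConst 5 1, IAdd 7 7 1] @
     while_code (p + 4) 8 [ISub 9 7 5] 9 [IAdd 5 5 5, IAdd 3 3 1] @ [IConst 0 0]"

lemma length_save_code: "length (save_code 9) = 19"
  by (simp add: save_code_def upt_rec)

lemma length_init_code: "length (init_code B) = 34"
  by (simp add: init_code_def length_save_code)

lemma length_list_code: "length (list_code p) = 26"
  by (simp add: list_code_def push_code_def)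

lemma length_size_code: "length (size_code p) = 10"
  by (simp add: size_code_def)

lemma halving_loop_correct:
  assumes "code_at P p (while_code p 8 [] 5 [ISub 5 5 6, IAdd 3 3 1])"
    and init: "r 1 = 1" "r 3 = 0" "r 5 = 2 * n" "r 6 = 2" "r 8 = 0"
  shows "reaches P (4 * n + 1) (p, r) (p + 4, r(3 := n, 5 := 0))"
proof -
  define Inv where "Inv i s \<longleftrightarrow> s = r(3 := i, 5 := 2 * (n - i))" for i s
  have "\<exists>s. Inv n s \<and> reaches P (n * 4 + 1) (p, r) (p + 4, exec [] s)"
    by (rule reaches_while[OF assms(1), of Inv]) (use init in \<open>auto simp: Inv_def fun_eq_iff\<close>)
  then show ?thesis by (auto simp: Inv_def mult.commute)
qed

lemma init_code_correct:
  assumes length_ge: "10 \<le> length xs" and code: "code_at P 0 (init_code B)"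
  defines "L \<equiv> length xs"
  shows "\<exists>r. reaches P (4 * L + 31) (init_conf xs) (34, r) \<and> list_state (2 * L + 9 + B) [] r \<and>
    r 0 = L \<and> r 3 = L \<and> r 6 = 9 \<and> (\<forall>i. 9 < i \<and> i \<le> L \<longrightarrow> r i = xs ! (i - 1)) \<and>
        (\<forall>i<9. r (2 * L + i) = xs ! i)"
proof -
  let ?prepare = "[IConst 6 8, ISub 5 0 6, IConst 6 2, IConst 3 0, IConst 8 0]"
  let ?finish = "[IConst 5 (B + 1), IAdd 2 0 5, IConst 4 0, IConst 7 0, IConst 6 9, IAdd 0 3 8]"
  have code: "code_at P 0 (save_code 9)" "code_at P 19 ?prepare"
    "code_at P 24 (while_code 24 8 [] 5 [ISub 5 5 6, IAdd 3 3 1])" "code_at P 28 ?finish"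
    using code by (simp_all add: init_code_def length_save_code while_code_def)
  define r1 where "r1 = exec (save_code 9) (snd (init_conf xs))"
  have "saved xs 9 r1" unfolding r1_def using length_ge by (intro exec_save_code) auto
  then have r1: "r1 0 = 2 * L + 8" "r1 1 = 1" "\<forall>i<9. r1 (2 * L + i) = xs ! i"
      "\<forall>i. 9 < i \<and> i \<le> L \<longrightarrow> r1 i = xs ! (i - 1)"
    by (auto simp: saved_def L_def)
  have "\<forall>i\<in>set (save_code 9). \<not> is_jump i" by (auto simp: save_code_def)
  then have "reaches P 19 (0, snd (init_conf xs)) (19, r1)"
    unfolding r1_def using length_save_code by (intro reaches_execI[OF code(1)]) auto
  then have save: "reaches P 19 (init_conf xs) (19, r1)" by (simp add: init_conf_def)
  define r2 where "r2 = exec ?prepare r1"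
  have prepare: "reaches P 5 (19, r1) (24, r2)" unfolding r2_def
    by (rule reaches_execI[OF code(2)]) auto
  have halve: "reaches P (4 * L + 1) (24, r2) (24 + 4, r2(3 := L, 5 := 0))"
    by (rule halving_loop_correct[OF code(3)]) (use r1 in \<open>auto simp: r2_def\<close>)
  define r3 where "r3 = exec ?finish (r2(3 := L, 5 := 0))"
  have "reaches P 6 (24 + 4, r2(3 := L, 5 := 0)) (34, r3)"
    unfolding r3_def by (rule reaches_execI[of P _ ?finish]) (use code(4) in auto)
  then have "reaches P (19 + (5 + ((4 * L + 1) + 6))) (init_conf xs) (34, r3)"
    by (rule reaches_trans[OF save reaches_trans[OF prepare reaches_trans[OF halve]]])
  moreover have "list_state (2 * L + 9 + B) [] r3"
    using r1 by (auto simp: r3_def r2_def list_state_def)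
  moreover have "r3 i = r1 i" if "9 < i" for i using that by (simp add: r3_def r2_def)
  then have "\<forall>i. 9 < i \<and> i \<le> L \<longrightarrow> r3 i = xs ! (i - 1)" "\<forall>i<9. r3 (2 * L + i) = xs ! i"
    using r1 length_ge by (auto simp: L_def)
  moreover have "r3 0 = L" "r3 3 = L" "r3 6 = 9" by (auto simp: r3_def r2_def)
  ultimately show ?thesis by (intro exI[of _ r3]) (simp add: add_ac)
qed

lemma push_high_correct:
  assumes length_ge: "10 \<le> length xs" and code: "code_at P p (push_code p)"
    and H_ge: "2 * length xs + 9 \<le> H"
    and init: "list_state H [] r" "r 0 = length xs" "r 6 = 9"
    and high: "\<forall>i. 9 < i \<and> i \<le> length xs \<longrightarrow> r i = xs ! (i - 1)"
  shows "\<exists>r'. reaches P ((length xs - 9) * 11 + 2) (p, r) (p + 11, r') \<and>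
    list_state H (drop 9 xs) r' \<and> (\<forall>a<H. a \<notin> {0, 2, 4, 5, 7} \<longrightarrow> r' a = r a)"
proof -
  have "map r [Suc 9..<Suc (9 + (length xs - 9))] = drop 9 xs"
    using high length_ge by (auto simp del: upt_Suc intro!: nth_equalityI)
  then show ?thesis using push_code_correct[OF code init(1), of 9 "length xs - 9"] init length_ge
    H_ge by simp
qed

lemma push_low_correct:
  assumes length_ge: "10 \<le> length xs" and code: "code_at P p (push_code p)"
    and H_ge: "2 * length xs + 9 \<le> H"
    and init: "list_state H (drop 9 xs) r" "r 0 = 2 * length xs + 8" "r 6 = 2 * length xs - 1"
    and low: "\<forall>i<9. r (2 * length xs + i) = xs ! i"
  shows "\<exists>r'. reaches P (9 * 11 + 2) (p, r) (p + 11, r') \<and>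
    list_state H xs r' \<and> (\<forall>a<H. a \<notin> {0, 2, 4, 5, 7} \<longrightarrow> r' a = r a)"
proof -
  let ?b = "2 * length xs - 1"
  have "Suc ?b = 2 * length xs" "Suc (?b + 9) = 2 * length xs + 9" using length_ge by auto
  then have "map r [Suc ?b..<Suc (?b + 9)] = take 9 xs"
    using low length_ge by (auto simp del: upt_Suc intro!: nth_equalityI)
  then have "map r [Suc ?b..<Suc (?b + 9)] @ drop 9 xs = xs" by (simp del: upt_Suc)
  moreover have "r 0 = ?b + 9" "9 \<le> ?b" "?b + 9 < H" using init length_ge H_ge by auto
  ultimately show ?thesis using push_code_correct[OF code init(1), of ?b 9] init(3) by metis
qed

lemma list_code_correct:
  assumes length_ge: "10 \<le> length xs" and code: "code_at P p (list_code p)"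
    and H_ge: "2 * length xs + 9 \<le> H"
    and init: "list_state H [] r" "r 0 = length xs" "r 3 = length xs" "r 6 = 9"
    and high: "\<forall>i. 9 < i \<and> i \<le> length xs \<longrightarrow> r i = xs ! (i - 1)"
    and low: "\<forall>i<9. r (2 * length xs + i) = xs ! i"
  shows "\<exists>r'. reaches P (11 * length xs + 8) (p, r) (p + 26, r') \<and> list_state H xs r' \<and>
    r' 3 = length xs \<and> r' (length xs) = last xs"
proof -
  let ?L = "length xs" and ?switch = "[IAdd 6 3 3, ISub 6 6 1, IConst 5 9, IAdd 0 6 5]"
  have code: "code_at P p (push_code p)" "code_at P (p + 11) ?switch"
    "code_at P (p + 15) (push_code (p + 15))"
    using code by (simp_all add: list_code_def push_code_def numeral_eq_Suc)
  obtain r1 where r1: "reaches P ((?L - 9) * 11 + 2) (p, r) (p + 11, r1)"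
    "list_state H (drop 9 xs) r1" "\<forall>a<H. a \<notin> {0, 2, 4, 5, 7} \<longrightarrow> r1 a = r a"
    using push_high_correct[OF length_ge code(1) H_ge init(1,2,4) high] by blast
  have kept: "r1 1 = 1" "r1 3 = ?L" using r1(2,3) init(3) H_ge by (auto simp: list_state_def)
  define r2 where "r2 = r1(6 := 2 * ?L - 1, 5 := 9, 0 := 2 * ?L + 8)"
  have switch: "reaches P 4 (p + 11, r1) (p + 15, r2)"
    by (rule reaches_execI[OF code(2)]) (use kept length_ge in \<open>auto simp: r2_def fun_eq_iff\<close>)
  have "preserves H 0 r1 r2" using H_ge length_ge by (auto simp: preserves_def r2_def)
  then have "list_state H (drop 9 xs) r2"
    using r1(2) represents_preserves by (auto simp: list_state_def r2_def)
  moreover have "\<forall>i<9. r2 (2 * ?L + i) = xs ! i" using low r1(3) length_ge H_ge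
    by (auto simp: r2_def)
  ultimately obtain r3 where r3: "reaches P (9 * 11 + 2) (p + 15, r2) (p + 15 + 11, r3)"
    "list_state H xs r3" "\<forall>a<H. a \<notin> {0, 2, 4, 5, 7} \<longrightarrow> r3 a = r2 a"
    using push_low_correct[OF length_ge code(3) H_ge, of r2] by (auto simp: r2_def)
  have "reaches P ((?L - 9) * 11 + 2 + (4 + (9 * 11 + 2))) (p, r) (p + 15 + 11, r3)"
    by (rule reaches_trans[OF r1(1) reaches_trans[OF switch r3(1)]])
  then have "reaches P (11 * ?L + 8) (p, r) (p + 15 + 11, r3)"
    by (rule reaches_mono) (use length_ge in simp)
  then have "reaches P (11 * ?L + 8) (p, r) (p + 26, r3)" by (simp add: add.assoc)
  moreover have "r3 3 = ?L" using r3(3) kept H_ge by (simp add: r2_def)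
  moreover have "xs \<noteq> []" using length_ge by auto
  then have "r3 ?L = r ?L"
    using r3(3)[rule_format, of ?L] r1(3)[rule_format, of ?L] length_ge H_ge by (auto simp: r2_def)
  then have "r3 ?L = last xs" using high length_ge \<open>xs \<noteq> []\<close> by (simp add: last_conv_nth)
  ultimately show ?thesis using r3(2) by blast
qed

lemma bitlen_loop_correct:
  assumes code: "code_at P p (while_code p 8 [ISub 9 7 5] 9 [IAdd 5 5 5, IAdd 3 3 1])"
    and init: "r 1 = 1" "r 5 = 1" "r 7 = Suc S" "r 8 = 0"
  shows "\<exists>u v. reaches P (5 * bitlen S + 2) (p, r) (p + 5, r(3 := r 3 + bitlen S, 5 := u, 9 := v))"
proof -
  define Inv where "Inv i s \<longleftrightarrow> (\<exists>v. s = r(3 := r 3 + i, 5 := 2 ^ i, 9 := v))" for i s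
  have "\<exists>s. Inv (bitlen S) s \<and> reaches P (bitlen S * 5 + 2) (p, r) (p + 5, exec [ISub 9 7 5] s)"
  proof (rule reaches_while[OF code, of Inv])
    show "Inv 0 r" unfolding Inv_def using init by (intro exI[of _ "r 9"]) (auto simp: fun_eq_iff)
    show "exec [ISub 9 7 5] s 9 = 0" if "Inv (bitlen S) s" for s
      using that init bitlen_le_iff[of S "bitlen S"] by (auto simp: Inv_def)
  next
    fix i s
    assume i_less: "i < bitlen S" and "Inv i s"
    then obtain v where s: "s = r(3 := r 3 + i, 5 := 2 ^ i, 9 := v)" by (auto simp: Inv_def)
    have "2 ^ i \<le> S" using i_less bitlen_le_iff[of S i] by simp
    moreover have "exec ([ISub 9 7 5] @ [IAdd 5 5 5, IAdd 3 3 1]) s =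
        r(3 := r 3 + Suc i, 5 := 2 ^ Suc i, 9 := Suc S - 2 ^ i)"
      using init by (simp add: s fun_eq_iff)
    ultimately show "exec [ISub 9 7 5] s 9 \<noteq> 0 \<and>
        exec ([ISub 9 7 5] @ [IAdd 5 5 5, IAdd 3 3 1]) s 8 = 0 \<and>
        Inv (Suc i) (exec ([ISub 9 7 5] @ [IAdd 5 5 5, IAdd 3 3 1]) s)"
      using init by (auto simp: s Inv_def)
  qed simp_all
  then obtain s where s: "Inv (bitlen S) s"
    "reaches P (bitlen S * 5 + 2) (p, r) (p + 5, exec [ISub 9 7 5] s)"
    by blast
  then have "exec [ISub 9 7 5] s =
      r(3 := r 3 + bitlen S, 5 := 2 ^ bitlen S, 9 := Suc S - 2 ^ bitlen S)"
    using init by (auto simp: Inv_def)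
  then show ?thesis using s(2) unfolding mult.commute[of 5] by metis
qed

lemma size_code_correct:
  assumes code: "code_at P p (size_code p)" and H_gt: "9 < H"
    and init: "list_state H xs r" "r 3 = length xs" "r (length xs) = last xs"
  shows "\<exists>r'. reaches P (5 * bitlen (sum_list xs) + 7) (p, r) (p + 10, r') \<and>
    runtime_ok H (input_size xs) r' \<and> represents H r' (encode xs) (r' 4)"
proof -
  have code: "code_at P p [ILoad 5 3, IAdd 3 3 5, IConst 5 1, IAdd 7 7 1]"
    "code_at P (p + 4) (while_code (p + 4) 8 [ISub 9 7 5] 9 [IAdd 5 5 5, IAdd 3 3 1])"
    "code_at P (p + 9) [IConst 0 0]"
    using code by (simp_all add: size_code_def while_code_def numeral_eq_Suc)
  define r1 where "r1 = r(3 := length xs + last xs, 5 := 1, 7 := Suc (sum_list xs))"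
  have "reaches P 4 (p, r) (p + 4, r1)"
    by (rule reaches_execI[OF code(1)]) (use init in \<open>auto simp: r1_def list_state_def fun_eq_iff\<close>)
  moreover obtain u v where "reaches P (5 * bitlen (sum_list xs) + 2) (p + 4, r1)
      (p + 4 + 5, r1(3 := r1 3 + bitlen (sum_list xs), 5 := u, 9 := v))"
    using bitlen_loop_correct[OF code(2), of r1 "sum_list xs"] init
    by (auto simp: r1_def list_state_def)
  ultimately have "reaches P (4 + (5 * bitlen (sum_list xs) + 2)) (p, r)
      (p + 4 + 5, r1(3 := r1 3 + bitlen (sum_list xs), 5 := u, 9 := v))"
    by (rule reaches_trans)
  moreover define r2 where "r2 = r1(3 := input_size xs, 5 := u, 9 := v)"
  ultimately have loop: "reaches P (4 + (5 * bitlen (sum_list xs) + 2)) (p, r) (p + 9, r2)"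
    by (simp add: r1_def r2_def input_size_def add.assoc)
  have "reaches P 1 (p + 9, r2) (p + 10, r2(0 := 0))" by (rule reaches_execI[OF code(3)]) auto
  from reaches_trans[OF loop this]
  have "reaches P (5 * bitlen (sum_list xs) + 7) (p, r) (p + 10, r2(0 := 0))" by (simp add: add_ac)
  moreover have "preserves H 0 r (r2(0 := 0))" using H_gt
    by (auto simp: preserves_def r1_def r2_def)
  then have "represents H (r2(0 := 0)) (encode xs) ((r2(0 := 0)) 4)"
    using init represents_preserves by (auto simp: list_state_def r1_def r2_def)
  moreover have "runtime_ok H (input_size xs) (r2(0 := 0))"
    using init by (auto simp: runtime_ok_def list_state_def r1_def r2_def)
  ultimately show ?thesis by blast
qed

lemma input_code_correct:
  assumes length_ge: "10 \<le> length xs"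
    and code: "code_at P 0 (init_code B @ list_code 34 @ size_code 60)"
  defines "H \<equiv> 2 * length xs + 9 + B"
  shows "\<exists>r. reaches P (46 + 15 * input_size xs) (init_conf xs) (70, r) \<and>
    runtime_ok H (input_size xs) r \<and> represents H r (encode xs) (r 4)"
proof -
  have code: "code_at P 0 (init_code B)" "code_at P 34 (list_code 34)" "code_at P 60 (size_code 60)"
    using code by (simp_all add: length_init_code length_list_code)
  obtain r1 where r1: "reaches P (4 * length xs + 31) (init_conf xs) (34, r1)" "list_state H [] r1"
    "r1 0 = length xs" "r1 3 = length xs" "r1 6 = 9"
    "\<forall>i. 9 < i \<and> i \<le> length xs \<longrightarrow> r1 i = xs ! (i - 1)" "\<forall>i<9. r1 (2 * length xs + i) = xs ! i"
    using init_code_correct[OF length_ge code(1)] unfolding H_def by blast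
  obtain r2 where r2: "reaches P (11 * length xs + 8) (34, r1) (60, r2)" "list_state H xs r2"
    "r2 3 = length xs" "r2 (length xs) = last xs"
    using list_code_correct[OF length_ge code(2) _ r1(2-7)] by (auto simp: H_def)
  obtain r3 where r3: "reaches P (5 * bitlen (sum_list xs) + 7) (60, r2) (70, r3)"
    "runtime_ok H (input_size xs) r3" "represents H r3 (encode xs) (r3 4)"
    using size_code_correct[OF code(3) _ r2(2-4)] length_ge unfolding H_def by fastforce
  have "reaches P (4 * length xs + 31 + (11 * length xs + 8) + (5 * bitlen (sum_list xs) + 7))
      (init_conf xs) (70, r3)"
    by (rule reaches_trans[OF reaches_trans[OF r1(1) r2(1)] r3(1)])
  then have "reaches P (46 + 15 * input_size xs) (init_conf xs) (70, r3)"
    by (rule reaches_mono) (simp add: input_size_def)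
  then show ?thesis using r3 by blast
qed

subsection \<open>Writing the output\<close>

text \<open>The output is written from its end to its beginning, since its first entries overwrite the
  registers in use.  It is therefore delivered reversed, with its length placed before the first
  entry, and padded so that the first five entries always exist.\<close>

definition output_value :: "nat list \<Rightarrow> nat \<times> nat list" where
  "output_value ys = (let ws = ys @ replicate 5 0 in (length ws, rev (tl ws) @ [length ys, hd ws]))"

abbreviation copy_body :: "instr list" where
  "copy_body \<equiv> [ILoad 4 2, IStore 3 4, IAdd 2 2 1, ILoad 2 2, ISub 3 3 1]"

definition pop_code :: "nat \<Rightarrow> instr list" where
  "pop_code k = [ILoad k 0, IAdd 0 0 1, ILoad 0 0]"

definition unload_code :: "instr list" where
  "unload_code = [IAdd 0 2 0] @ pop_code 5 @ pop_code 4 @ pop_code 3 @ pop_code 2 @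
     [IAdd 1 0 1, ILoad 1 1, ILoad 1 1, ILoad 0 0]"

definition output_code :: "nat \<Rightarrow> instr list" where
  "output_code p = [ILoad 3 4, IAdd 4 4 1, ILoad 2 4, IConst 5 5] @
     while_code (p + 4) 0 [ISub 4 3 5] 4 copy_body @ unload_code"

lemma length_unload_code: "length unload_code = 17"
  by (simp add: unload_code_def pop_code_def)

lemma length_output_code: "length (output_code p) = 29"
  by (simp add: output_code_def length_unload_code)

definition reads_list :: "nat \<Rightarrow> (nat \<Rightarrow> nat) \<Rightarrow> nat list \<Rightarrow> nat \<Rightarrow> (nat \<Rightarrow> nat) \<Rightarrow> bool" where
  "reads_list H h zs a r \<longleftrightarrow> 5 < H \<and> represents H h (encode zs) (r a) \<and> (\<forall>b\<ge>H. r b = h b) \<and> r 1 = 1"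

lemma reads_list_Cons:
  "reads_list H h (x # zs) a r \<Longrightarrow> H \<le> r a \<and> r (r a) = x \<and> represents H h (encode zs) (r (Suc (r a)))"
  by (auto simp: reads_list_def encode_nat_def)

lemma exec_copy_body:
  assumes list: "reads_list H h (x # zs) 2 s" and state: "s 3 = u" "s 5 = 5"
    and bounds: "5 < u" "u < H"
  defines "s' \<equiv> exec ([ISub 4 3 5] @ copy_body) s"
  shows "s' = s(4 := x, u := x, 2 := s (Suc (s 2)), 3 := u - 1)" "reads_list H h zs 2 s'"
    "\<forall>a\<ge>u. s' a = (if a = u then x else s a)"
proof -
  note cell = reads_list_Cons[OF list]
  have "s 1 = 1" "5 < H" using list by (auto simp: reads_list_def)
  moreover have "s (s 2) = x" "Suc (s 2) \<notin> {2, 4, u}" "s 2 \<noteq> 4" "u \<notin> {1, 2, 3, 4}"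
    using cell bounds \<open>5 < H\<close> by auto
  ultimately show "s' = s(4 := x, u := x, 2 := s (Suc (s 2)), 3 := u - 1)" unfolding s'_def
    using state by simp
  then show "reads_list H h zs 2 s'" "\<forall>a\<ge>u. s' a = (if a = u then x else s a)"
    using list cell bounds by (auto simp: reads_list_def)
qed

lemma copy_loop_correct:
  assumes code: "code_at P p (while_code p 0 [ISub 4 3 5] 4 copy_body)"
    and Z_nth: "\<forall>i < m - 5. i < length Z \<and> Z ! i = ws ! (m - 1 - i)" and m_bounds: "5 \<le> m" "m < H"
    and init: "reads_list H h Z 2 r" "r 0 = 0" "r 3 = m" "r 5 = 5"
  shows "\<exists>r'. reaches P (8 * (m - 5) + 2) (p, r) (p + 8, r') \<and>
      reads_list H h (drop (m - 5) Z) 2 r' \<and> r' 0 = 0 \<and>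
    (\<forall>a. 5 < a \<and> a \<le> m \<longrightarrow> r' a = ws ! (a - 1))"
proof -
  define Inv where "Inv i s \<longleftrightarrow> reads_list H h (drop i Z) 2 s \<and> s 0 = 0 \<and> s 3 = m - i \<and> s 5 = 5 \<and>
    (\<forall>a. m - i < a \<and> a \<le> m \<longrightarrow> s a = ws ! (a - 1))" for i s
  have "\<exists>r'. Inv (m - 5) r' \<and> reaches P ((m - 5) * 8 + 2) (p, r) (p + 8, exec [ISub 4 3 5] r')"
  proof (rule reaches_while[OF code, of Inv])
    show "Inv 0 r" using init by (auto simp: Inv_def)
    show "exec [ISub 4 3 5] s 4 = 0" if "Inv (m - 5) s" for s using that m_bounds
      by (auto simp: Inv_def)
  next
    fix i s
    assume inv: "i < m - 5" "Inv i s"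
    define x where "x = ws ! (m - 1 - i)"
    have "drop i Z = x # drop (Suc i) Z" using Z_nth inv
      by (simp add: x_def Cons_nth_drop_Suc[symmetric])
    then have list: "reads_list H h (x # drop (Suc i) Z) 2 s" using inv by (simp add: Inv_def)
    define u where "u = m - i"
    define s' where "s' = exec ([ISub 4 3 5] @ copy_body) s"
    have state: "s 0 = 0" "s 3 = u" "s 5 = 5" "\<forall>a. u < a \<and> a \<le> m \<longrightarrow> s a = ws ! (a - 1)"
      using inv(2) by (auto simp: Inv_def u_def)
    have bounds: "5 < u" "u < H" "m - Suc i = u - 1" "m - 1 - i = u - 1" using inv(1) m_bounds
      by (auto simp: u_def)
    note copy = exec_copy_body[OF list state(2,3) bounds(1,2), folded s'_def]
    have "s' a = ws ! (a - 1)" if "u - 1 < a" "a \<le> m" for a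
      using copy(3) state(4) bounds that by (auto simp: x_def)
    moreover have "s' 0 = 0" "s' 3 = u - 1" "s' 5 = 5" using state bounds by (simp_all add: copy(1))
    ultimately have "Inv (Suc i) s'" using copy(2) unfolding Inv_def bounds(3) by blast
    moreover have "exec [ISub 4 3 5] s 4 \<noteq> 0" using state bounds by simp
    ultimately show "exec [ISub 4 3 5] s 4 \<noteq> 0 \<and> exec ([ISub 4 3 5] @ copy_body) s 0 = 0 \<and>
        Inv (Suc i) (exec ([ISub 4 3 5] @ copy_body) s)"
      using \<open>s' 0 = 0\<close> unfolding s'_def by blast
  qed simp_all
  then obtain r' where r': "Inv (m - 5) r'"
    "reaches P (8 * (m - 5) + 2) (p, r) (p + 8, exec [ISub 4 3 5] r')"
    by (auto simp: mult.commute)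
  then show ?thesis
    using m_bounds by (intro exI[of _ "exec [ISub 4 3 5] r'"]) (auto simp: Inv_def reads_list_def)
qed

lemma exec_pop_code:
  assumes "reads_list H h (x # zs) 0 s" "2 \<le> k" "k \<le> 5"
  shows "\<exists>q. exec (pop_code k) s = s(k := x, 0 := q) \<and> reads_list H h zs 0 (s(k := x, 0 := q))"
proof -
  note cell = reads_list_Cons[OF assms(1)]
  have "s 1 = 1" "5 < H" using assms(1) by (auto simp: reads_list_def)
  then have "exec (pop_code k) s = s(k := x, 0 := s (Suc (s 0)))"
    using cell assms(2,3) by (auto simp: pop_code_def fun_eq_iff)
  moreover have "reads_list H h zs 0 (s(k := x, 0 := s (Suc (s 0))))"
    using assms cell by (auto simp: reads_list_def)
  ultimately show ?thesis by blast
qed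

lemma exec_unload_code:
  assumes init: "reads_list H h [x5, x4, x3, x2, m, x1] 2 r" "r 0 = 0"
  defines "r' \<equiv> exec unload_code r"
  shows "r' 0 = m" "r' 1 = x1" "r' 2 = x2" "r' 3 = x3" "r' 4 = x4" "r' 5 = x5" "\<forall>a>5. r' a = r a"
proof -
  define s0 where "s0 = r(0 := r 2)"
  have "reads_list H h [x5, x4, x3, x2, m, x1] 0 s0" using init
    by (auto simp: s0_def reads_list_def)
  from exec_pop_code[OF this, of 5] obtain q1
    where pop5: "exec (pop_code 5) s0 = s0(5 := x5, 0 := q1)"
    "reads_list H h [x4, x3, x2, m, x1] 0 (s0(5 := x5, 0 := q1))" by auto
  from exec_pop_code[OF pop5(2), of 4] obtain q2
    where pop4: "exec (pop_code 4) (s0(5 := x5, 0 := q1)) =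
      s0(5 := x5, 0 := q1, 4 := x4, 0 := q2)"
    "reads_list H h [x3, x2, m, x1] 0 (s0(5 := x5, 0 := q1, 4 := x4, 0 := q2))" by auto
  from exec_pop_code[OF pop4(2), of 3] obtain q3
    where pop3: "exec (pop_code 3) (s0(5 := x5, 0 := q1, 4 := x4, 0 := q2)) =
      s0(5 := x5, 0 := q1, 4 := x4, 0 := q2, 3 := x3, 0 := q3)"
    "reads_list H h [x2, m, x1] 0 (s0(5 := x5, 0 := q1, 4 := x4, 0 := q2, 3 := x3, 0 := q3))"
      by auto
  define s3 where "s3 = s0(5 := x5, 0 := q1, 4 := x4, 0 := q2, 3 := x3, 0 := q3)"
  from exec_pop_code[OF pop3(2), of 2] obtain q4
    where pop2: "exec (pop_code 2) s3 = s3(2 := x2, 0 := q4)"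
    "reads_list H h [m, x1] 0 (s3(2 := x2, 0 := q4))" by (auto simp: s3_def)
  define s4 where "s4 = s3(2 := x2, 0 := q4)"
  have s4_regs: "s4 0 = q4" "s4 1 = 1" "5 < H" using pop2(2) by (auto simp: s4_def reads_list_def)
  have count_cell: "H \<le> q4" "s4 q4 = m" "represents H h (encode [x1]) (s4 (Suc q4))"
    using reads_list_Cons[OF pop2(2)] by (auto simp: s4_def)
  then have "H \<le> s4 (Suc q4)" "h (s4 (Suc q4)) = x1" by (auto simp: encode_nat_def)
  then have first_cell: "s4 (s4 (Suc q4)) = x1" "5 < s4 (Suc q4)"
    using pop2(2) s4_regs by (auto simp: s4_def reads_list_def)
  have "exec [IAdd 0 2 0] r = s0" using init by (simp add: s0_def)
  moreover have "exec [IAdd 1 0 1, ILoad 1 1, ILoad 1 1, ILoad 0 0] s4 = s4(1 := x1, 0 := m)"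
    using s4_regs count_cell first_cell by (auto simp: fun_eq_iff)
  ultimately have "r' = s4(1 := x1, 0 := m)"
    unfolding r'_def unload_code_def fold_append comp_apply using pop5(1) pop4(1) pop3(1) pop2(1)
    by (simp only: s3_def s4_def)
  then show "r' 0 = m" "r' 1 = x1" "r' 2 = x2" "r' 3 = x3" "r' 4 = x4" "r' 5 = x5"
    "\<forall>a>5. r' a = r a"
    by (simp_all add: s4_def s3_def s0_def)
qed

lemma output_of_exec_unload_code:
  assumes ws_eq: "ws = ys @ replicate 5 0"
    and init: "reads_list H h (drop (length ys) (rev (tl ws) @ [length ys, hd ws])) 2 r" "r 0 = 0"
      "\<forall>a. 5 < a \<and> a \<le> length ws \<longrightarrow> r a = ws ! (a - 1)"
  shows "output_of (exec unload_code r) = ys"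
proof -
  define r' where "r' = exec unload_code r"
  have "5 \<le> length ws" by (simp add: ws_eq)
  then obtain x1 x2 x3 x4 x5 us where first: "ws = x1 # x2 # x3 # x4 # x5 # us"
    by (auto simp: Suc_le_length_iff numeral_eq_Suc)
  have "length us = length ys" using arg_cong[OF ws_eq, of length] first by simp
  then have "reads_list H h [x5, x4, x3, x2, length ys, x1] 2 r" using init(1) by (simp add: first)
  note unload = exec_unload_code[OF this init(2), folded r'_def]
  have "r' (Suc i) = ws ! i" if "i < length ws" for i
  proof (cases "i < 5")
    case True
    then consider "i = 0" | "i = 1" | "i = 2" | "i = 3" | "i = 4" by linarith
    then show ?thesis using unload by cases (simp_all add: first numeral_eq_Suc)
  next
    case False
    then show ?thesis using init(3) unload(7) that by simp
  qed
  then have "output_of r' = ys"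
    using unload(1) by (auto simp: output_of_def ws_eq nth_append intro!: nth_equalityI)
  then show ?thesis by (simp only: r'_def)
qed

lemma output_code_correct:
  assumes init: "runtime_ok H N r" "represents H r (encode (output_value ys)) (r 4)"
    and code: "code_at P p (output_code p)" and H_gt: "length ys + 5 < H"
  shows "\<exists>r'. reaches P (23 + 8 * length ys) (p, r) (p + 29, r') \<and> output_of r' = ys"
proof -
  define ws where "ws = ys @ replicate 5 0"
  define Z where "Z = rev (tl ws) @ [length ys, hd ws]"
  define m where "m = length ws"
  have m_eq: "m = length ys + 5" "5 \<le> m" "m < H" using H_gt by (auto simp: m_def ws_def)
  let ?start = "[ILoad 3 4, IAdd 4 4 1, ILoad 2 4, IConst 5 5]"
  have code: "code_at P p ?start"
    "code_at P (p + 4) (while_code (p + 4) 0 [ISub 4 3 5] 4 copy_body)"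
    "code_at P (p + 12) unload_code"
    using code by (simp_all add: output_code_def numeral_eq_Suc)
  have head: "H \<le> r 4" "r (r 4) = m" "represents H r (encode Z) (r (Suc (r 4)))"
    using init(2) by (auto simp: output_value_def encode_prod_def encode_nat_def Z_def m_def ws_def
      Let_def)
  define r1 where "r1 = r(3 := m, 4 := Suc (r 4), 2 := r (Suc (r 4)), 5 := 5)"
  have start: "reaches P 4 (p, r) (p + 4, r1)"
    by (rule reaches_execI[OF code(1)]) (use head init(1) H_gt
      in \<open>auto simp: r1_def runtime_ok_def fun_eq_iff\<close>)
  have "reads_list H r Z 2 r1" using head init(1) m_eq
    by (auto simp: reads_list_def r1_def runtime_ok_def)
  moreover have "\<forall>i < m - 5. i < length Z \<and> Z ! i = ws ! (m - 1 - i)"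
    by (auto simp: Z_def m_def nth_append rev_nth nth_tl Suc_diff_Suc)
  ultimately obtain r2 where r2: "reaches P (8 * (m - 5) + 2) (p + 4, r1) (p + 4 + 8, r2)"
    "reads_list H r (drop (m - 5) Z) 2 r2" "r2 0 = 0" "\<forall>a. 5 < a \<and> a \<le> m \<longrightarrow> r2 a = ws ! (a - 1)"
    using copy_loop_correct[OF code(2), of m Z ws H r r1] m_eq init(1)
    by (auto simp: r1_def runtime_ok_def)
  define r3 where "r3 = exec unload_code r2"
  have "\<forall>i\<in>set unload_code. \<not> is_jump i" by (simp add: unload_code_def pop_code_def)
  then have "reaches P 17 (p + 12, r2) (p + 29, r3)"
    by (rule reaches_execI[OF code(3)]) (simp_all add: r3_def length_unload_code)
  then have "reaches P 17 (p + 4 + 8, r2) (p + 29, r3)" by (simp add: add.commute)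
  then have "reaches P (4 + (8 * (m - 5) + 2 + 17)) (p, r) (p + 29, r3)"
    by (rule reaches_trans[OF start reaches_trans[OF r2(1)]])
  then have "reaches P (23 + 8 * length ys) (p, r) (p + 29, r3)" by (simp add: m_eq(1) add_ac)
  moreover have "output_of r3 = ys"
    using output_of_exec_unload_code[OF ws_def] r2(2-4)
    by (simp add: r3_def Z_def m_def m_eq(1)[unfolded m_def])
  ultimately show ?thesis by blast
qed

subsection \<open>Running compiled programs\<close>

lemma ram_runs_expr:
  "\<exists>P. \<exists>T. poly_bounded T \<and> (\<forall>xs ys. 10 \<le> length xs \<and> length ys + 5 \<le> length xs \<and>
     evaluates (input_size xs) f (encode xs) (encode (output_value ys)) \<longrightarrow>
         runs_within P xs (T (input_size xs)) ys)"
proof -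
  define B where "B = regs f"
  define c where "c = compile 70 4 f"
  define P where "P = (init_code B @ list_code 34 @ size_code 60) @ c @ output_code (70 + length c)"
  define T where "T N = 46 + 15 * N + steps N f + (23 + 8 * N)" for N
  have len: "length P = 70 + length c + 29"
    by (simp add: P_def length_init_code length_list_code length_size_code length_output_code)
  have "code_at P 0 P" by (simp add: code_at_def)
  then have code: "code_at P 0 (init_code B @ list_code 34 @ size_code 60)" "code_at P 70 c"
    "code_at P (70 + length c) (output_code (70 + length c))"
    unfolding P_def by (simp_all add: length_init_code length_list_code length_size_code
      add.commute)
  have "runs_within P xs (T (input_size xs)) ys"
    if lengths: "10 \<le> length xs" "length ys + 5 \<le> length xs"
      and result: "evaluates (input_size xs) f (encode xs) (encode (output_value ys))" for xs ys
  proof -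
    let ?N = "input_size xs" and ?H = "2 * length xs + 9 + B"
    obtain r1 where r1: "reaches P (46 + 15 * ?N) (init_conf xs) (70, r1)" "runtime_ok ?H ?N r1"
      "represents ?H r1 (encode xs) (r1 4)"
      using input_code_correct[OF lengths(1) code(1)] by blast
    obtain r2 where r2: "reaches P (steps ?N f) (70, r1) (70 + length c, r2)" "preserves ?H 4 r1 r2"
      "represents ?H r2 (encode (output_value ys)) (r2 4)"
      by (rule compiles_correctlyD[OF compile_correct[OF result] _ _ _ r1(2,3)])
        (use code(2) in \<open>auto simp: c_def B_def\<close>)
    have "runtime_ok ?H ?N r2" by (rule runtime_ok_preserves[OF r1(2) r2(2)]) simp
    then obtain r3 where r3: "reaches P (23 + 8 * length ys) (70 + length c, r2) (length P, r3)"
      "output_of r3 = ys"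
      using output_code_correct[OF _ r2(3) code(3)] lengths len by auto
    have "reaches P (46 + 15 * ?N + steps ?N f + (23 + 8 * length ys))
        (init_conf xs) (length P, r3)"
      by (rule reaches_trans[OF reaches_trans[OF r1(1) r2(1)] r3(1)])
    then have "reaches P (T ?N) (init_conf xs) (length P, r3)"
      by (rule reaches_mono) (use lengths in \<open>simp add: T_def input_size_def\<close>)
    then show ?thesis using r3(2) unfolding runs_within_def reaches_def by fastforce
  qed
  moreover have "poly_bounded T"
    unfolding T_def by (intro poly_bounded_intros poly_bounded_steps)
  ultimately show ?thesis by blast
qed

definition output_value_upto :: "nat \<Rightarrow> nat list \<Rightarrow> nat \<times> nat list" where
  "output_value_upto W ys =
    (let ws = take W ys @ [0, 0, 0, 0, 0]; m = fold (\<lambda>y s. Suc s) (take W ys) 0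
     in (m + 5, take W (rev (take W (tl ws))) @ [m, nth_upto W ws 0]))"

lemma output_value_upto_eq:
  assumes "length ys + 5 \<le> W"
  shows "output_value_upto W ys = output_value ys"
proof -
  have "fold (\<lambda>y s. Suc s) vs a = a + length vs" for vs :: "nat list" and a
    by (induction vs arbitrary: a) auto
  moreover have "nth_upto W (ys @ [0, 0, 0, 0, 0]) 0 = hd (ys @ [0, 0, 0, 0, 0])"
    using assms by (simp add: nth_upto_eq hd_conv_nth)
  ultimately show ?thesis
    using assms by (simp add: output_value_upto_def output_value_def numeral_eq_Suc Let_def)
qed

lemma polytime_output_value: "polytime D output_value_upto"
  unfolding output_value_upto_def by (intro polytime_intros)

theorem ram_runs_polytime:
  assumes "polytime D F"
  shows "\<exists>P. \<exists>T. poly_bounded T \<and> (\<forall>xs. 10 \<le> length xs \<and>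
     length (F (input_size xs ^ D) xs) + 5 \<le> min (length xs) (input_size xs ^ D) \<longrightarrow>
     runs_within P xs (T (input_size xs)) (F (input_size xs ^ D) xs))"
proof -
  obtain f where f_value: "\<And>N x. evaluates N f (encode x)
      (encode (output_value_upto (N ^ D) (F (N ^ D) x)))"
    using polytime_compose[OF polytime_output_value assms] unfolding polytime_def by blast
  obtain P T where P: "poly_bounded T"
    and run: "\<And>xs ys. 10 \<le> length xs \<Longrightarrow> length ys + 5 \<le> length xs \<Longrightarrow>
      evaluates (input_size xs) f (encode xs) (encode (output_value ys)) \<Longrightarrow>
          runs_within P xs (T (input_size xs)) ys"
    using ram_runs_expr[of f] by blast
  have "runs_within P xs (T (input_size xs)) (F (input_size xs ^ D) xs)"
    if "10 \<le> length xs" "length (F (input_size xs ^ D) xs) + 5 \<le>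
        min (length xs) (input_size xs ^ D)" for xs
    using f_value[of "input_size xs" xs] that by (intro run) (auto simp: output_value_upto_eq)
  then show ?thesis using P by blast
qed

section \<open>Partial schedules\<close>

text \<open>A state lists its entries latest first.\<close>

type_synonym entry = "nat \<times> loc \<times> nat"
type_synonym state = "nat \<times> entry list"

abbreviation job :: "entry \<Rightarrow> nat" where "job a \<equiv> fst a"
abbreviation place :: "entry \<Rightarrow> loc" where "place a \<equiv> fst (snd a)"
abbreviation end_time :: "entry \<Rightarrow> nat" where "end_time a \<equiv> snd (snd a)"
abbreviation cost :: "state \<Rightarrow> nat" where "cost s \<equiv> fst s"
abbreviation entries :: "state \<Rightarrow> entry list" where "entries s \<equiv> snd s"
abbreviation jobs :: "entry list \<Rightarrow> nat set" where "jobs h \<equiv> fst ` set h"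

definition place_of :: "entry list \<Rightarrow> nat \<Rightarrow> loc" where
  "place_of h j = fst (the (map_of h j))"

definition end_of :: "entry list \<Rightarrow> nat \<Rightarrow> nat" where
  "end_of h j = snd (the (map_of h j))"

definition max_over :: "('a \<Rightarrow> nat) \<Rightarrow> 'a list \<Rightarrow> nat" where
  "max_over g h = fold (\<lambda>a s. max s (g a)) h 0"

lemma max_over_le_iff: "max_over g h \<le> B \<longleftrightarrow> (\<forall>a\<in>set h. g a \<le> B)"
proof -
  have "fold (\<lambda>a s. max s (g a)) h c \<le> B \<longleftrightarrow> c \<le> B \<and> (\<forall>a\<in>set h. g a \<le> B)" for c
    by (induction h arbitrary: c) auto
  then show ?thesis by (simp add: max_over_def)
qed

definition type_code :: "loc \<Rightarrow> nat" where
  "type_code l = (case l of Server m \<Rightarrow> 0 | Cloud c \<Rightarrow> Suc c)"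

lemma type_code_eq_iff: "type_code l = type_code l' \<longleftrightarrow> ltype l = ltype l'"
  by (cases l; cases l') (auto simp: type_code_def)

locale scheduling =
  fixes I :: inst
  assumes wf: "wf_inst I"
begin

abbreviation n :: nat where "n \<equiv> nj I"
abbreviation k :: nat where "k \<equiv> nk I"
abbreviation z :: nat where "z \<equiv> nz I"
abbreviation E :: "(nat \<times> nat) set" where "E \<equiv> edges I"

lemma n_pos: "0 < n" and z_pos: "0 < z" and src_less: "src I < n" and snk_less: "snk I < n"
  using wf by (auto simp: wf_inst_def)

lemma edge_less: "(i, j) \<in> E \<Longrightarrow> i < n \<and> j < n"
  using wf by (auto simp: wf_inst_def)

lemma finite_edges: "finite E"
  using wf finite_subset[of E "{0..<n} \<times> {0..<n}"] by (auto simp: wf_inst_def)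

lemma dly_same_type: "dly I m m i j = 0"
  using wf by (auto simp: wf_inst_def)

lemma wf_edges: "Wellfounded.wf E" and wf_converse_edges: "Wellfounded.wf (E\<inverse>)"
  using finite_acyclic_wf[OF finite_edges] finite_acyclic_wf_converse[OF finite_edges] wf
  by (auto simp: wf_inst_def)

lemma no_predecessor_eq_src: "j < n \<Longrightarrow> (\<And>i. (i, j) \<notin> E) \<Longrightarrow> j = src I"
  using wf unfolding wf_inst_def by blast

lemma no_successor_eq_snk: "j < n \<Longrightarrow> (\<And>i. (j, i) \<notin> E) \<Longrightarrow> j = snk I"
  using wf unfolding wf_inst_def by blast

definition proc_time :: "loc \<Rightarrow> nat \<Rightarrow> nat" where
  "proc_time l j = (case l of Server m \<Rightarrow> ps I j | Cloud c \<Rightarrow> pcl I c j)"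

definition price :: "loc \<Rightarrow> nat \<Rightarrow> nat" where
  "price l j = (case l of Server m \<Rightarrow> 0 | Cloud c \<Rightarrow> cst I j c)"

lemma ptime_eq: "ptime I \<eta> j = proc_time (\<eta> j) j"
  by (simp add: ptime_def proc_time_def)

lemma sched_cost_eq_sum: "sched_cost I \<eta> = (\<Sum>j\<in>{0..<n}. price (\<eta> j) j)"
proof -
  have "sched_cost I \<eta> = (\<Sum>j\<in>{j. j < n \<and> \<not> is_server (\<eta> j)}. price (\<eta> j) j)"
    unfolding sched_cost_def by (rule sum.cong) (auto simp: price_def split: loc.split)
  also have "\<dots> = (\<Sum>j\<in>{0..<n}. price (\<eta> j) j)"
    by (rule sum.mono_neutral_left) (auto simp: price_def split: loc.splits)
  finally show ?thesis .
qed

definition placements :: "nat \<Rightarrow> loc list" where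
  "placements j = map Server [0..<z] @ (if j = src I \<or> j = snk I then [] else map Cloud [0..<k])"

definition ready :: "entry list \<Rightarrow> nat \<Rightarrow> bool" where
  "ready h j \<longleftrightarrow> j \<notin> jobs h \<and> (\<forall>i. (i, j) \<in> E \<longrightarrow> i \<in> jobs h)"

definition live :: "entry list \<Rightarrow> nat \<Rightarrow> bool" where
  "live h j \<longleftrightarrow> (\<exists>i. (j, i) \<in> E \<and> i \<notin> jobs h)"

definition release :: "entry \<Rightarrow> nat \<Rightarrow> loc \<Rightarrow> nat" where
  "release a j l =
    (if (job a, j) \<in> E then end_time a + dly I (ltype (place a)) (ltype l) (job a) j
     else if place a = l \<and> is_server l then end_time a else 0)"

definition start :: "entry list \<Rightarrow> nat \<Rightarrow> loc \<Rightarrow> nat" where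
  "start h j l = max_over (\<lambda>a. release a j l) h"

definition add_job :: "state \<Rightarrow> nat \<Rightarrow> loc \<Rightarrow> state" where
  "add_job s j l = (cost s + price l j, (j, l, start (entries s) j l + proc_time l j) # entries s)"

lemma release_le_start: "a \<in> set h \<Longrightarrow> release a j l \<le> start h j l"
  using max_over_le_iff[of "\<lambda>a. release a j l" h "start h j l"] by (simp add: start_def)

inductive partial_schedule :: "state \<Rightarrow> bool" where
  empty: "partial_schedule (0, [])"
| add_job: "partial_schedule s \<Longrightarrow> j < n \<Longrightarrow> ready (entries s) j \<Longrightarrow> l \<in> set (placements j) \<Longrightarrow>
    partial_schedule (add_job s j l)"

lemma partial_schedule_jobs: "partial_schedule s \<Longrightarrow> jobs (entries s) \<subseteq> {0..<n}"
  by (induction rule: partial_schedule.induct) (auto simp: add_job_def)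

lemma partial_schedule_distinct: "partial_schedule s \<Longrightarrow> distinct (map fst (entries s))"
  by (induction rule: partial_schedule.induct) (auto simp: add_job_def ready_def)

lemma card_jobs: "partial_schedule s \<Longrightarrow> card (jobs (entries s)) = length (entries s)"
  using distinct_card[OF partial_schedule_distinct] by simp

lemma partial_schedule_length: "partial_schedule s \<Longrightarrow> length (entries s) \<le> n"
  using card_mono[OF _ partial_schedule_jobs] card_jobs by fastforce

lemma partial_schedule_map_of:
  "partial_schedule s \<Longrightarrow> a \<in> set (entries s) \<Longrightarrow> map_of (entries s) (job a) = Some (snd a)"
  using partial_schedule_distinct by simp

lemma partial_schedule_predecessor:
  "partial_schedule s \<Longrightarrow> j \<in> jobs (entries s) \<Longrightarrow> (i, j) \<in> E \<Longrightarrow> i \<in> jobs (entries s)"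
  by (induction rule: partial_schedule.induct) (auto simp: add_job_def ready_def)

lemma partial_schedule_place:
  "partial_schedule s \<Longrightarrow> a \<in> set (entries s) \<Longrightarrow> place a \<in> set (placements (job a))"
  by (induction rule: partial_schedule.induct) (auto simp: add_job_def)

lemma partial_schedule_cost:
  "partial_schedule s \<Longrightarrow> cost s = (\<Sum>a\<leftarrow>entries s. price (place a) (job a))"
  by (induction rule: partial_schedule.induct) (auto simp: add_job_def)

lemma partial_schedule_edge:
  assumes "partial_schedule s" "a \<in> set (entries s)" "b \<in> set (entries s)" "(job a, job b) \<in> E"
  shows "end_time a + dly I (ltype (place a)) (ltype (place b)) (job a) (job b) +
    proc_time (place b) (job b) \<le> end_time b"
  using assms
proof (induction rule: partial_schedule.induct)
  case (add_job s j l)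
  let ?new = "(j, l, start (entries s) j l + proc_time l j)"
  have "a \<noteq> ?new"
  proof
    assume "a = ?new"
    then have "(j, job b) \<in> E" "job b \<in> insert j (jobs (entries s))"
      using add_job.prems by (auto simp: add_job_def)
    then show False
      using add_job.hyps partial_schedule_predecessor[of s "job b" j] by (auto simp: ready_def)
  qed
  then have a: "a \<in> set (entries s)" using add_job.prems by (simp add: add_job_def)
  show ?case
  proof (cases "b = ?new")
    case True
    then show ?thesis
      using release_le_start[OF a, of j l] add_job.prems by (simp add: release_def)
  next
    case False
    then show ?thesis using add_job.IH a add_job.prems by (simp add: add_job_def)
  qed
qed simp

lemma partial_schedule_server:
  assumes "partial_schedule s" "a \<in> set (entries s)" "b \<in> set (entries s)"
    and "job a \<noteq> job b" "place a = place b" "is_server (place a)"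
  shows "end_time a + ps I (job b) \<le> end_time b \<or> end_time b + ps I (job a) \<le> end_time a"
  using assms
proof (induction rule: partial_schedule.induct)
  case (add_job s j l)
  let ?new = "(j, l, start (entries s) j l + proc_time l j)"
  have free: "end_time c \<le> start (entries s) j l"
    if "c \<in> set (entries s)" "place c = l" "is_server l" for c
    using release_le_start[OF that(1), of j l] that by (auto simp: release_def split: if_splits)
  have time: "proc_time l j = ps I j" if "is_server l"
    using that by (cases l) (auto simp: proc_time_def)
  consider (old) "a \<in> set (entries s)" "b \<in> set (entries s)"
    | (new_b) "a \<in> set (entries s)" "b = ?new" | (new_a) "a = ?new" "b \<in> set (entries s)"
    using add_job.prems by (auto simp: add_job_def)
  then show ?case
  proof cases
    case old
    then show ?thesis using add_job by blast
  next
    case new_b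
    then show ?thesis using free[of a] time add_job.prems by simp
  next
    case new_a
    then show ?thesis using free[of b] time add_job.prems by simp
  qed
qed simp

lemma placements_server: "l \<in> set (placements j) \<Longrightarrow> j = src I \<or> j = snk I \<Longrightarrow> is_server l"
  by (auto simp: placements_def)

lemma placements_valid:
  "l \<in> set (placements j) \<Longrightarrow> case l of Server m \<Rightarrow> m < z | Cloud c \<Rightarrow> c < k"
  by (auto simp: placements_def split: if_splits)

lemma complete_entry:
  assumes partial: "partial_schedule s" and full: "jobs (entries s) = {0..<n}" and "j < n"
  obtains a where "a \<in> set (entries s)" "job a = j" "place_of (entries s) j = place a"
    "end_of (entries s) j = end_time a"
proof -
  have "j \<in> jobs (entries s)" using full \<open>j < n\<close> by simp
  then obtain a where a: "a \<in> set (entries s)" "job a = j" by auto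
  then show thesis
    using that[OF a] partial_schedule_map_of[OF partial a(1)] by (simp add: place_of_def end_of_def)
qed

lemma complete_schedule_valid:
  assumes partial: "partial_schedule s" and full: "jobs (entries s) = {0..<n}"
  defines "C \<equiv> end_of (entries s)" and "\<eta> \<equiv> place_of (entries s)"
  shows "valid_sched I C \<eta>"
proof -
  note entry = complete_entry[OF partial full, folded C_def \<eta>_def]
  have \<eta>: "\<eta> j \<in> set (placements j)" if "j < n" for j
    using entry[OF that] partial_schedule_place[OF partial] by metis
  show ?thesis unfolding valid_sched_def
  proof (intro conjI allI impI)
    fix j assume "j < n"
    then show "case \<eta> j of Server m \<Rightarrow> m < z | Cloud c \<Rightarrow> c < k"
      using placements_valid[OF \<eta>] by blast
  next
    show "is_server (\<eta> (src I))" "is_server (\<eta> (snk I))"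
      using placements_server \<eta> src_less snk_less by blast+
  next
    fix i j assume less_n: "i < n" "j < n" and "i \<noteq> j \<and> \<eta> i = \<eta> j \<and> is_server (\<eta> i)"
    moreover obtain a b where "a \<in> set (entries s)" "job a = i" "\<eta> i = place a" "C i = end_time a"
      "b \<in> set (entries s)" "job b = j" "\<eta> j = place b" "C j = end_time b"
      using entry[OF less_n(1)] entry[OF less_n(2)] by metis
    ultimately have "C i + ps I j \<le> C j \<or> C j + ps I i \<le> C i"
      using partial_schedule_server[OF partial, of a b] by auto
    then show "int (C i) \<le> int (C j) - int (ps I j) \<or> int (C i) - int (ps I i) \<ge> int (C j)"
      by linarith
  next
    show "\<forall>(i, j)\<in>E. int (C i) + int (dly I (ltype (\<eta> i)) (ltype (\<eta> j)) i j) \<le>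
        int (C j) - int (ptime I \<eta> j)"
    proof (intro ballI, clarify)
      fix i j assume edge: "(i, j) \<in> E"
      then have less_n: "i < n" "j < n" using edge_less by auto
      obtain a b where "a \<in> set (entries s)" "job a = i" "\<eta> i = place a" "C i = end_time a"
        "b \<in> set (entries s)" "job b = j" "\<eta> j = place b" "C j = end_time b"
        using entry[OF less_n(1)] entry[OF less_n(2)] by metis
      then have "C i + dly I (ltype (\<eta> i)) (ltype (\<eta> j)) i j + ptime I \<eta> j \<le> C j"
        using partial_schedule_edge[OF partial, of a b] edge by (simp add: ptime_eq)
      then show "int (C i) + int (dly I (ltype (\<eta> i)) (ltype (\<eta> j)) i j) \<le>
          int (C j) - int (ptime I \<eta> j)"
        by linarith
    qed
  qed
qed

lemma complete_schedule_cost: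
  assumes partial: "partial_schedule s" and full: "jobs (entries s) = {0..<n}"
  shows "sched_cost I (place_of (entries s)) = cost s"
proof -
  have "cost s = (\<Sum>a\<in>set (entries s). price (place a) (job a))"
    using partial_schedule_cost[OF partial] partial_schedule_distinct[OF partial]
    by (simp add: sum_list_distinct_conv_sum_set distinct_map)
  also have "\<dots> = (\<Sum>a\<in>set (entries s). price (place_of (entries s) (job a)) (job a))"
    using partial_schedule_map_of[OF partial] by (intro sum.cong) (auto simp: place_of_def)
  also have "\<dots> = (\<Sum>j\<in>{0..<n}. price (place_of (entries s) j) j)"
    unfolding full[symmetric] using partial_schedule_distinct[OF partial]
    by (subst sum.reindex) (auto simp: distinct_map)
  finally show ?thesis by (simp add: sched_cost_eq_sum)
qed

section \<open>Keys and their number\<close>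

definition free_at :: "entry list \<Rightarrow> nat \<Rightarrow> nat" where
  "free_at h m = max_over (\<lambda>a. if place a = Server m then end_time a else 0) h"

lemma free_at_le_iff: "free_at h m \<le> B \<longleftrightarrow> (\<forall>a\<in>set h. place a = Server m \<longrightarrow> end_time a \<le> B)"
  by (auto simp: free_at_def max_over_le_iff)

text \<open>A scheduled job without unscheduled successors no longer constrains the schedule except through its
  server; it is marked by the tag 1 and its completion time is forgotten.\<close>

definition tag :: "entry list \<Rightarrow> nat \<Rightarrow> nat" where
  "tag h j = (case map_of h j of None \<Rightarrow> 0
    | Some (l, c) \<Rightarrow> if live h j then Suc (Suc (type_code l)) else 1)"

definition bucket :: "nat \<Rightarrow> entry list \<Rightarrow> nat \<Rightarrow> nat" where
  "bucket \<delta> h j = (case map_of h j of None \<Rightarrow> 0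
    | Some (l, c) \<Rightarrow> if live h j then c div \<delta> else 0)"

definition key :: "nat \<Rightarrow> entry list \<Rightarrow> nat list" where
  "key \<delta> h = map (tag h) [0..<n] @ map (bucket \<delta> h) [0..<n] @ map (\<lambda>m. free_at h m div \<delta>) [0..<z]"

abbreviation state_key :: "nat \<Rightarrow> state \<Rightarrow> nat list" where
  "state_key \<delta> \<equiv> \<lambda>s. key \<delta> (entries s)"

lemma length_key: "length (key \<delta> h) = n + n + z"
  by (simp add: key_def)

lemma key_eq_iff:
  "key \<delta> h = key \<delta> h' \<longleftrightarrow> (\<forall>j<n. tag h j = tag h' j \<and> bucket \<delta> h j = bucket \<delta> h' j) \<and>
    (\<forall>m<z. free_at h m div \<delta> = free_at h' m div \<delta>)"
  by (auto simp: key_def)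

lemma tag_eq_0_iff: "tag h j = 0 \<longleftrightarrow> j \<notin> jobs h"
  by (auto simp: tag_def dom_map_of_conv_image_fst[symmetric] split: option.split)

lemma div_eq_imp_le:
  fixes x y d :: nat
  assumes "x div d = y div d" "0 < d"
  shows "x \<le> y + (d - 1)"
proof -
  have "x = x div d * d + x mod d" "y = y div d * d + y mod d" by simp_all
  moreover have "x mod d < d" "x div d * d = y div d * d" using assms by simp_all
  ultimately show ?thesis by linarith
qed

lemma key_eq_jobs:
  assumes "partial_schedule s" "partial_schedule t" "key \<delta> (entries s) = key \<delta> (entries t)"
  shows "jobs (entries s) = jobs (entries t)"
proof -
  have "j \<in> jobs (entries s) \<longleftrightarrow> j \<in> jobs (entries t)" for j
  proof (cases "j < n")
    case True
    then have "tag (entries s) j = tag (entries t) j" using assms(3) by (simp add: key_eq_iff)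
    then show ?thesis using tag_eq_0_iff by metis
  next
    case False
    then show ?thesis using partial_schedule_jobs[OF assms(1)] partial_schedule_jobs[OF assms(2)]
      by auto
  qed
  then show ?thesis by blast
qed

lemma key_eq_live:
  assumes partial_s: "partial_schedule s" and partial_t: "partial_schedule t"
    and key_eq: "key \<delta> (entries s) = key \<delta> (entries t)"
    and "0 < \<delta>" and a_in: "a \<in> set (entries s)" and b_in: "b \<in> set (entries t)"
    and same_job: "job a = job b"
    and live: "live (entries s) (job a)"
  shows "ltype (place b) = ltype (place a)" "end_time b \<le> end_time a + (\<delta> - 1)"
proof -
  have "job a < n" using a_in partial_schedule_jobs[OF partial_s] by auto
  then have recorded: "tag (entries s) (job a) = tag (entries t) (job a)"
    "bucket \<delta> (entries s) (job a) = bucket \<delta> (entries t) (job a)"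
    using key_eq by (auto simp: key_eq_iff)
  have "live (entries t) (job a)" using live key_eq_jobs[OF partial_s partial_t key_eq]
    by (simp add: live_def)
  moreover have "map_of (entries s) (job a) = Some (snd a)"
    "map_of (entries t) (job a) = Some (snd b)"
    using partial_schedule_map_of[OF partial_s a_in] partial_schedule_map_of[OF partial_t b_in]
      same_job by simp_all
  ultimately have "type_code (place b) = type_code (place a)" "end_time b div \<delta> = end_time a div \<delta>"
    using recorded live by (auto simp: tag_def bucket_def split: prod.splits)
  then show "ltype (place b) = ltype (place a)" "end_time b \<le> end_time a + (\<delta> - 1)"
    using type_code_eq_iff div_eq_imp_le[OF _ \<open>0 < \<delta>\<close>] by auto
qed

lemma key_eq_free_at:
  "key \<delta> h = key \<delta> h' \<Longrightarrow> 0 < \<delta> \<Longrightarrow> m < z \<Longrightarrow> free_at h' m \<le> free_at h m + (\<delta> - 1)"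
  using div_eq_imp_le by (simp add: key_eq_iff)

definition crossing :: "entry list \<Rightarrow> (nat \<times> nat) set" where
  "crossing h = {(i, j) \<in> E. i \<in> jobs h \<and> j \<notin> jobs h}"

lemma finite_crossing: "finite (crossing h)"
  by (rule finite_subset[OF _ finite_edges]) (auto simp: crossing_def)

lemma live_iff_crossing: "j \<in> jobs h \<Longrightarrow> live h j \<longleftrightarrow> (\<exists>i. (j, i) \<in> crossing h)"
  by (auto simp: live_def crossing_def)

lemma src_scheduled: "partial_schedule s \<Longrightarrow> entries s \<noteq> [] \<Longrightarrow> src I \<in> jobs (entries s)"
proof (induction rule: partial_schedule.induct)
  case (add_job s j l)
  show ?case
  proof (cases "entries s = []")
    case True
    then have "j = src I" using add_job.hyps no_predecessor_eq_src by (auto simp: ready_def)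
    then show ?thesis by (simp add: add_job_def)
  next
    case False
    then show ?thesis using add_job.IH by (simp add: add_job_def)
  qed
qed simp

lemma card_crossing_le:
  assumes "partial_schedule s" "entries s \<noteq> []"
  shows "card (crossing (entries s)) \<le> cut_phi I"
proof -
  have "jobs (entries s) \<in> dividing_sets I"
    using partial_schedule_jobs[OF assms(1)] src_scheduled[OF assms]
      partial_schedule_predecessor[OF assms(1)]
    by (auto simp: dividing_sets_def)
  moreover have "finite (dividing_sets I)"
    by (rule finite_subset[of _ "Pow {0..<n}"]) (auto simp: dividing_sets_def)
  ultimately show ?thesis unfolding cut_phi_def crossing_def by (intro Max_ge) auto
qed

lemma unscheduled_iff_reachable:
  assumes state: "partial_schedule s" "entries s \<noteq> []" and "j < n"
  shows "j \<notin> jobs (entries s) \<longleftrightarrow> (\<exists>(a, b) \<in> crossing (entries s). (b, j) \<in> E\<^sup>*)"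
proof
  assume "j \<notin> jobs (entries s)"
  with \<open>j < n\<close> show "\<exists>(a, b) \<in> crossing (entries s). (b, j) \<in> E\<^sup>*"
  proof (induction j rule: wf_induct_rule[OF wf_edges, case_names less])
    case (less j)
    have "j \<noteq> src I" using src_scheduled[OF state] less.prems by auto
    then obtain i where edge: "(i, j) \<in> E" using no_predecessor_eq_src less.prems by blast
    show ?case
    proof (cases "i \<in> jobs (entries s)")
      case True
      then have "(i, j) \<in> crossing (entries s)" using edge less.prems by (auto simp: crossing_def)
      then show ?thesis by blast
    next
      case False
      then obtain a b where "(a, b) \<in> crossing (entries s)" "(b, i) \<in> E\<^sup>*"
        using less.IH[OF edge] edge_less[OF edge] by blast
      then show ?thesis using edge by (meson case_prodI rtrancl.rtrancl_into_rtrancl bexI)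
    qed
  qed
next
  assume "\<exists>(a, b) \<in> crossing (entries s). (b, j) \<in> E\<^sup>*"
  then obtain a b where path: "(a, b) \<in> crossing (entries s)" "(b, j) \<in> E\<^sup>*" by blast
  have "j \<in> jobs (entries s) \<Longrightarrow> b \<in> jobs (entries s)"
    using path(2) by (induction rule: converse_rtrancl_induct)
      (auto intro: partial_schedule_predecessor[OF state(1)])
  then show "j \<notin> jobs (entries s)" using path(1) by (auto simp: crossing_def)
qed

text \<open>A dividing set is determined by its crossing edges, so the key can be recovered from what it
  records along them.\<close>

definition trace :: "nat \<Rightarrow> entry list \<Rightarrow> (nat \<times> nat \<times> nat \<times> nat) set" where
  "trace \<delta> h = {(job a, j, type_code (place a), end_time a div \<delta>) |a j.
     a \<in> set h \<and> (job a, j) \<in> crossing h}"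

lemma crossing_eq_image_trace: "crossing h = (\<lambda>(i, j, _). (i, j)) ` trace \<delta> h"
proof
  show "crossing h \<subseteq> (\<lambda>(i, j, _). (i, j)) ` trace \<delta> h"
  proof clarify
    fix i j assume crossing: "(i, j) \<in> crossing h"
    then obtain a where "a \<in> set h" "job a = i" by (auto simp: crossing_def)
    then have "(i, j, type_code (place a), end_time a div \<delta>) \<in> trace \<delta> h"
      using crossing unfolding trace_def by blast
    then show "(i, j) \<in> (\<lambda>(i, j, _). (i, j)) ` trace \<delta> h" by force
  qed
  show "(\<lambda>(i, j, _). (i, j)) ` trace \<delta> h \<subseteq> crossing h" by (auto simp: trace_def)
qed

lemma trace_determines_live:
  assumes partial_t: "partial_schedule t"
    and trace: "trace \<delta> (entries s) = trace \<delta> (entries t)"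
    and a_in: "a \<in> set (entries s)" and b_in: "b \<in> set (entries t)" and same_job: "job a = job b"
    and live: "live (entries s) (job a)"
  shows "type_code (place a) = type_code (place b)" "end_time a div \<delta> = end_time b div \<delta>"
proof -
  obtain j where "(job a, j) \<in> crossing (entries s)" using live a_in live_iff_crossing by blast
  then have "(job a, j, type_code (place a), end_time a div \<delta>) \<in> trace \<delta> (entries t)"
    using a_in trace unfolding trace_def by blast
  then obtain b' where b': "b' \<in> set (entries t)" "job b' = job a"
    "type_code (place b') = type_code (place a)" "end_time b' div \<delta> = end_time a div \<delta>"
    unfolding trace_def by auto
  have "inj_on fst (set (entries t))" using partial_schedule_distinct[OF partial_t]
    by (simp add: distinct_map)
  then have "b' = b" using b_in b' same_job by (simp add: inj_onD)
  then show "type_code (place a) = type_code (place b)" "end_time a div \<delta> = end_time b div \<delta>"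
    using b' by simp_all
qed

lemma trace_determines_key:
  assumes state_s: "partial_schedule s" "entries s \<noteq> []"
    and state_t: "partial_schedule t" "entries t \<noteq> []"
    and trace: "trace \<delta> (entries s) = trace \<delta> (entries t)"
    and free: "\<forall>m<z. free_at (entries s) m div \<delta> = free_at (entries t) m div \<delta>"
  shows "key \<delta> (entries s) = key \<delta> (entries t)"
proof -
  have crossing: "crossing (entries s) = crossing (entries t)"
    using trace crossing_eq_image_trace by metis
  have "tag (entries s) j = tag (entries t) j \<and> bucket \<delta> (entries s) j = bucket \<delta> (entries t) j"
    if "j < n" for j
  proof (cases "j \<in> jobs (entries s)")
    case False
    then have "j \<notin> jobs (entries t)"
      using unscheduled_iff_reachable[OF state_s that] unscheduled_iff_reachable[OF state_t that]
        crossing by simp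
    then show ?thesis using False by (simp add: tag_def bucket_def map_of_eq_None_iff[THEN iffD2])
  next
    case True
    then have "j \<in> jobs (entries t)"
      using unscheduled_iff_reachable[OF state_s that] unscheduled_iff_reachable[OF state_t that]
        crossing by simp
    with True obtain a b where a: "a \<in> set (entries s)" "job a = j"
      and b: "b \<in> set (entries t)" "job b = j"
      by auto
    have "live (entries s) j \<longleftrightarrow> live (entries t) j"
      using live_iff_crossing True \<open>j \<in> jobs (entries t)\<close> crossing by metis
    moreover have "live (entries s) j \<Longrightarrow>
        type_code (place a) = type_code (place b) \<and> end_time a div \<delta> = end_time b div \<delta>"
      using trace_determines_live[OF state_t(1) trace a(1) b(1)] a b by simp
    moreover have "map_of (entries s) j = Some (snd a)" "map_of (entries t) j = Some (snd b)"
      using partial_schedule_map_of[OF state_s(1) a(1)] partial_schedule_map_of[OF state_t(1) b(1)]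
        a b by simp_all
    ultimately show ?thesis by (cases "snd a"; cases "snd b") (auto simp: tag_def bucket_def)
  qed
  then show ?thesis using free by (simp add: key_eq_iff)
qed

lemma card_trace_le:
  assumes "partial_schedule s"
  shows "card (trace \<delta> (entries s)) \<le> card (crossing (entries s))"
proof -
  define f where "f = (\<lambda>(i, j :: nat). (i, j, type_code (place_of (entries s) i),
      end_of (entries s) i div \<delta>))"
  have "trace \<delta> (entries s) \<subseteq> f ` crossing (entries s)"
    using partial_schedule_map_of[OF assms]
    by (force simp: trace_def f_def place_of_def end_of_def)
  then show ?thesis by (meson card_image_le card_mono finite_crossing finite_imageI le_trans)
qed

definition bounded :: "nat \<Rightarrow> state \<Rightarrow> bool" where
  "bounded U s \<longleftrightarrow> partial_schedule s \<and> (\<forall>a\<in>set (entries s). end_time a \<le> U)"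

abbreviation nonempty_bounded :: "nat \<Rightarrow> state set" where
  "nonempty_bounded U \<equiv> {s. bounded U s \<and> entries s \<noteq> []}"

lemma trace_subset:
  assumes "bounded (M * \<delta>) s" "0 < \<delta>"
  shows "trace \<delta> (entries s) \<subseteq> {0..<n} \<times> {0..<n} \<times> {0..<Suc k} \<times> {0..<Suc M}"
proof
  have partial: "partial_schedule s" using assms(1) by (simp add: bounded_def)
  fix x assume "x \<in> trace \<delta> (entries s)"
  then obtain a j where x_eq: "x = (job a, j, type_code (place a), end_time a div \<delta>)"
    and a_in: "a \<in> set (entries s)" and edge: "(job a, j) \<in> E"
    by (auto simp: trace_def crossing_def)
  have "end_time a \<le> M * \<delta>" using a_in assms(1) by (simp add: bounded_def)
  then have "end_time a div \<delta> \<le> M" using div_le_mono[of _ "M * \<delta>" \<delta>] assms(2) by simp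
  moreover have "type_code (place a) \<le> k"
    using placements_valid[OF partial_schedule_place[OF partial a_in]]
    by (auto simp: type_code_def split: loc.splits)
  ultimately show "x \<in> {0..<n} \<times> {0..<n} \<times> {0..<Suc k} \<times> {0..<Suc M}"
    using x_eq edge_less[OF edge] by auto
qed

lemma free_at_bounded:
  assumes "bounded (M * \<delta>) s" "0 < \<delta>"
  shows "free_at (entries s) m div \<delta> \<le> M"
proof -
  have "free_at (entries s) m \<le> M * \<delta>" using assms(1) by (auto simp: free_at_le_iff bounded_def)
  then show ?thesis using div_le_mono[of _ "M * \<delta>" \<delta>] assms(2) by simp
qed

definition max_keys :: "nat \<Rightarrow> nat" where
  "max_keys M = (n * (n * (Suc k * Suc M)) + 1) ^ cut_phi I * Suc M ^ z"

lemma max_keys_pos: "1 \<le> max_keys M"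
  by (simp add: max_keys_def)

end

lemma card_small_subsets_le:
  assumes "finite U"
  shows "finite {X. X \<subseteq> U \<and> card X \<le> p}" "card {X. X \<subseteq> U \<and> card X \<le> p} \<le> (card U + 1) ^ p"
proof -
  define A where "A = {ys. set ys \<subseteq> insert None (Some ` U) \<and> length ys = p}"
  define f where "f ys = {x. Some x \<in> set ys}" for ys :: "'a option list"
  have "{X. X \<subseteq> U \<and> card X \<le> p} \<subseteq> f ` A"
  proof
    fix X assume X_small: "X \<in> {X. X \<subseteq> U \<and> card X \<le> p}"
    then obtain ws where ws: "set ws = X" "distinct ws"
      using assms finite_subset finite_distinct_list by (metis mem_Collect_eq)
    then have "length ws \<le> p" using X_small distinct_card by fastforce
    then have "map Some ws @ replicate (p - length ws) None \<in> A" using X_small ws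
      by (auto simp: A_def)
    moreover have "f (map Some ws @ replicate (p - length ws) None) = X" using ws
      by (auto simp: f_def)
    ultimately show "X \<in> f ` A" by blast
  qed
  moreover have "finite A" "card A = (card U + 1) ^ p"
    using assms finite_lists_length_eq[of "insert None (Some ` U)" p]
      card_lists_length_eq[of "insert None (Some ` U)" p]
    by (auto simp: A_def card_image)
  ultimately show "finite {X. X \<subseteq> U \<and> card X \<le> p}" "card {X. X \<subseteq> U \<and> card X \<le> p} \<le> (card U + 1) ^ p"
    by (meson finite_imageI finite_subset) (metis \<open>card A = _\<close> \<open>finite A\<close> \<open>_ \<subseteq> f ` A\<close> surj_card_le)
qed

lemma card_image_le_determined:
  assumes codomain: "finite B" "g ` A \<subseteq> B" and det: "\<And>x y. x \<in> A \<Longrightarrow> y \<in> A \<Longrightarrow> g x = g y \<Longrightarrow> f x = f y"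
  shows "finite (f ` A)" "card (f ` A) \<le> card B"
proof -
  have "f x = f (inv_into A g (g x))" if "x \<in> A" for x
    using that by (intro det) (auto simp: inv_into_into f_inv_into_f)
  then have "f ` A = (f \<circ> inv_into A g) ` (g ` A)" by (auto simp: image_iff)
  moreover have "finite (g ` A)" using codomain finite_subset by blast
  ultimately have "finite (f ` A)" "card (f ` A) \<le> card (g ` A)"
    by (simp_all add: card_image_le)
  then show "finite (f ` A)" "card (f ` A) \<le> card B"
    using card_mono[OF codomain] by simp_all
qed

context scheduling
begin

lemma card_keys:
  fixes M \<delta> :: nat
  assumes "0 < \<delta>"
  defines "K \<equiv> state_key \<delta> ` nonempty_bounded (M * \<delta>)"
  shows "finite K" "card K \<le> max_keys M"
proof -
  define U where "U = {0..<n} \<times> {0..<n} \<times> {0..<Suc k} \<times> {0..<Suc M}"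
  define B where "B = {X. X \<subseteq> U \<and> card X \<le> cut_phi I} \<times> {fs. set fs \<subseteq> {0..<Suc M} \<and> length fs = z}"
  define g where "g s = (trace \<delta> (entries s), map (\<lambda>m. free_at (entries s) m div \<delta>) [0..<z])" for s
  have card_U: "finite U" "card U = n * (n * (Suc k * Suc M))" by (simp_all add: U_def)
  then have card_B: "finite B" "card B \<le> max_keys M"
    using card_small_subsets_le[OF card_U(1), of "cut_phi I"]
      finite_lists_length_eq[of "{0..<Suc M}" z]
    by (simp_all add: B_def max_keys_def card_cartesian_product card_lists_length_eq)
  have img: "g ` nonempty_bounded (M * \<delta>) \<subseteq> B"
  proof (rule image_subsetI)
    fix s assume "s \<in> nonempty_bounded (M * \<delta>)"
    then have state: "bounded (M * \<delta>) s" "entries s \<noteq> []" by simp_all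
    then have "partial_schedule s" by (simp add: bounded_def)
    from card_crossing_le[OF this state(2)] card_trace_le[OF this, of \<delta>]
    show "g s \<in> B"
      using trace_subset[OF state(1) assms(1)] free_at_bounded[OF state(1) assms(1)]
      by (auto simp: g_def B_def U_def less_Suc_eq_le)
  qed
  have det: "key \<delta> (entries s) = key \<delta> (entries t)"
    if "s \<in> nonempty_bounded (M * \<delta>)" "t \<in> nonempty_bounded (M * \<delta>)" "g s = g t"
    for s t
    using that by (intro trace_determines_key) (auto simp: g_def bounded_def)
  note keys = card_image_le_determined[of B g _ "state_key \<delta>", OF card_B(1) img det, folded K_def]
  show "finite K" by (rule keys)
  show "card K \<le> max_keys M" by (rule order_trans[OF keys(2) card_B(2)])
qed

end

section \<open>The dynamic program\<close>

definition insert_min :: "('a \<Rightarrow> 'k) \<Rightarrow> ('a \<Rightarrow> nat) \<Rightarrow> 'a \<Rightarrow> 'a list \<Rightarrow> 'a list" where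
  "insert_min f w x L =
    (if \<exists>y\<in>set L. f y = f x \<and> w y \<le> w x then L else x # filter (\<lambda>y. f y \<noteq> f x) L)"

lemma set_insert_min_subset: "set (insert_min f w x L) \<subseteq> insert x (set L)"
  by (auto simp: insert_min_def)

lemma distinct_insert_min: "distinct (map f L) \<Longrightarrow> distinct (map f (insert_min f w x L))"
  by (auto simp: insert_min_def distinct_map_filter)

lemma insert_min_dominates:
  assumes "y \<in> insert x (set L)"
  shows "\<exists>u\<in>set (insert_min f w x L). f u = f y \<and> w u \<le> w y"
proof (cases "\<exists>y\<in>set L. f y = f x \<and> w y \<le> w x")
  case True
  then show ?thesis using assms by (auto simp: insert_min_def)
next
  case new: False
  show ?thesis
  proof (cases "f y = f x")
    case True
    then have "w x \<le> w y" using assms new nat_le_linear by blast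
    then show ?thesis using True new by (auto simp: insert_min_def)
  next
    case False
    then show ?thesis using assms new by (auto simp: insert_min_def)
  qed
qed

lemma set_fold_insert_min_subset: "set (fold (insert_min f w) xs L) \<subseteq> set xs \<union> set L"
proof (induction xs arbitrary: L)
  case (Cons x xs)
  then show ?case using set_insert_min_subset[of f w x L] by fastforce
qed simp

lemma distinct_fold_insert_min:
  "distinct (map f L) \<Longrightarrow> distinct (map f (fold (insert_min f w) xs L))"
  by (induction xs arbitrary: L) (simp_all add: distinct_insert_min)

lemma fold_insert_min_dominates:
  "y \<in> set xs \<union> set L \<Longrightarrow> \<exists>u\<in>set (fold (insert_min f w) xs L). f u = f y \<and> w u \<le> w y"
proof (induction xs arbitrary: L y)
  case (Cons x xs)
  have "\<exists>v \<in> set xs \<union> set (insert_min f w x L). f v = f y \<and> w v \<le> w y"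
  proof (cases "y \<in> set xs")
    case False
    then have "y \<in> insert x (set L)" using Cons.prems by auto
    then show ?thesis using insert_min_dominates[of y x L f w] by blast
  qed blast
  then obtain v where v: "v \<in> set xs \<union> set (insert_min f w x L)" "f v = f y" "w v \<le> w y" by blast
  then obtain u where "u \<in> set (fold (insert_min f w) (x # xs) L)" "f u = f v" "w u \<le> w v"
    using Cons.IH[OF v(1)] by auto
  then show ?case using v le_trans by metis
qed auto

lemma length_le_card_image:
  assumes "distinct (map f L)" "set L \<subseteq> S" "finite (f ` S)"
  shows "length L \<le> card (f ` S)"
proof -
  have "length L = card (f ` set L)" using distinct_card[OF assms(1)] by simp
  also have "\<dots> \<le> card (f ` S)" using assms(2,3) by (intro card_mono image_mono)
  finally show ?thesis .
qed

context scheduling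
begin

definition successors :: "state \<Rightarrow> state list" where
  "successors s = concat (map (\<lambda>j. map (add_job s j) (placements j))
      (filter (ready (entries s)) [0..<n]))"

definition admissible :: "nat \<Rightarrow> state \<Rightarrow> bool" where
  "admissible U s \<longleftrightarrow> cost s \<le> bud I \<and> (case entries s of [] \<Rightarrow> False | a # _ \<Rightarrow> end_time a \<le> U)"

definition candidates :: "nat \<Rightarrow> state list \<Rightarrow> state list" where
  "candidates U L = filter (admissible U) (concat (map successors L))"

definition prune :: "nat \<Rightarrow> state list \<Rightarrow> state list" where
  "prune \<delta> L = fold (insert_min (state_key \<delta>) fst) L []"

fun layer :: "nat \<Rightarrow> nat \<Rightarrow> nat \<Rightarrow> state list" where
  "layer M \<delta> 0 = [(0, [])]"
| "layer M \<delta> (Suc i) = prune \<delta> (candidates (M * \<delta>) (layer M \<delta> i))"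

lemma set_successors:
  "set (successors s) = {add_job s j l |j l. j < n \<and> ready (entries s) j \<and> l \<in> set (placements j)}"
  by (auto simp: successors_def)

lemma set_prune_subset: "set (prune \<delta> L) \<subseteq> set L"
  using set_fold_insert_min_subset[of "state_key \<delta>" fst L "[]"] by (simp add: prune_def)

lemma candidates_invariant:
  assumes invariant: "\<forall>s\<in>set L. bounded U s \<and> length (entries s) = i"
    and t_in: "t \<in> set (candidates U L)"
  shows "bounded U t" "length (entries t) = Suc i" "cost t \<le> bud I"
proof -
  obtain s j l where s: "s \<in> set L" and t_eq: "admissible U t" "t = add_job s j l"
    and choice: "j < n" "ready (entries s) j" "l \<in> set (placements j)"
    using t_in by (auto simp: candidates_def set_successors)
  have "bounded U s" "length (entries s) = i" using invariant s by auto
  then show "bounded U t" "length (entries t) = Suc i" "cost t \<le> bud I"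
    using partial_schedule.add_job[OF _ choice] t_eq
    by (auto simp: bounded_def admissible_def add_job_def)
qed

lemma layer_invariant:
  "s \<in> set (layer M \<delta> i) \<Longrightarrow> bounded (M * \<delta>) s \<and> length (entries s) = i \<and> cost s \<le> bud I"
proof (induction i arbitrary: s)
  case 0
  then show ?case by (simp add: bounded_def partial_schedule.empty)
next
  case (Suc i)
  then have s: "s \<in> set (candidates (M * \<delta>) (layer M \<delta> i))" using set_prune_subset by fastforce
  have "\<forall>s\<in>set (layer M \<delta> i). bounded (M * \<delta>) s \<and> length (entries s) = i" using Suc.IH by blast
  from candidates_invariant[OF this s] show ?case by blast
qed

lemma layer_complete:
  assumes "s \<in> set (layer M \<delta> n)"
  shows "partial_schedule s" "jobs (entries s) = {0..<n}" "cost s \<le> bud I"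
proof -
  show partial: "partial_schedule s" "cost s \<le> bud I" using layer_invariant[OF assms]
    by (auto simp: bounded_def)
  have "card (jobs (entries s)) = n" using layer_invariant[OF assms] card_jobs[OF partial(1)]
    by simp
  then show "jobs (entries s) = {0..<n}" using partial_schedule_jobs[OF partial(1)]
    by (intro card_subset_eq) auto
qed

lemma length_layer_le:
  assumes "0 < \<delta>"
  shows "length (layer M \<delta> i) \<le> max_keys M"
proof (cases i)
  case 0
  then show ?thesis using max_keys_pos by simp
next
  case (Suc i')
  let ?S = "nonempty_bounded (M * \<delta>)"
  have "distinct (map (state_key \<delta>) (layer M \<delta> i))"
    unfolding Suc layer.simps prune_def by (rule distinct_fold_insert_min) simp
  moreover have "set (layer M \<delta> i) \<subseteq> ?S" using layer_invariant[of _ M \<delta> i] Suc by fastforce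
  ultimately have "length (layer M \<delta> i) \<le> card (state_key \<delta> ` ?S)"
    using card_keys(1)[OF assms] by (rule length_le_card_image)
  then show ?thesis using card_keys(2)[OF assms, of M] by linarith
qed

lemma layer_dominates:
  assumes "s \<in> set (layer M \<delta> i)" "j < n" "ready (entries s) j" "l \<in> set (placements j)"
    and "admissible (M * \<delta>) (add_job s j l)"
  shows "\<exists>t\<in>set (layer M \<delta> (Suc i)).
    key \<delta> (entries t) = key \<delta> (entries (add_job s j l)) \<and> cost t \<le> cost (add_job s j l)"
proof -
  have "add_job s j l \<in> set (candidates (M * \<delta>) (layer M \<delta> i))"
    using assms by (auto simp: candidates_def set_successors)
  then show ?thesis
    unfolding layer.simps prune_def by (intro fold_insert_min_dominates[where L = "[]"]) simp
qed

definition depth :: "nat \<Rightarrow> nat" where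
  "depth j = card {i. (i, j) \<in> E\<^sup>+}"

lemma depth_less:
  assumes "(i, j) \<in> E"
  shows "depth i < depth j"
proof -
  have "{a. (a, j) \<in> E\<^sup>+} \<subseteq> {0..<n}" using edge_less by (auto dest: tranclD)
  then have "finite {a. (a, j) \<in> E\<^sup>+}" using finite_subset by blast
  moreover have "acyclic E" using wf by (simp add: wf_inst_def)
  then have "{a. (a, i) \<in> E\<^sup>+} \<subset> {a. (a, j) \<in> E\<^sup>+}" using assms by (auto simp: acyclic_def)
  ultimately show ?thesis unfolding depth_def by (rule psubset_card_mono)
qed

end

section \<open>Tracking a given schedule\<close>

locale reference_schedule = scheduling +
  fixes C :: "nat \<Rightarrow> nat" and \<eta> :: "nat \<Rightarrow> loc"
  assumes valid: "valid_sched I C \<eta>"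
begin

definition begin_time :: "nat \<Rightarrow> nat" where
  "begin_time j = C j - proc_time (\<eta> j) j"

lemma edge_int:
  "(i, j) \<in> E \<Longrightarrow>
    int (C i) + int (dly I (ltype (\<eta> i)) (ltype (\<eta> j)) i j) \<le> int (C j) - int (proc_time (\<eta> j) j)"
  using valid unfolding valid_sched_def ptime_eq by blast

lemma proc_time_le:
  assumes "j < n"
  shows "proc_time (\<eta> j) j \<le> C j"
proof (cases "\<exists>i. (i, j) \<in> E")
  case True
  then show ?thesis using edge_int by fastforce
next
  case False
  then have "j = src I" using no_predecessor_eq_src[OF assms] by blast
  moreover have "is_server (\<eta> (src I))" using valid by (simp add: valid_sched_def)
  moreover have "ps I (src I) = 0" using wf by (simp add: wf_inst_def)
  ultimately have "proc_time (\<eta> j) j = 0" by (cases "\<eta> j") (auto simp: proc_time_def)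
  then show ?thesis by simp
qed

lemma begin_time_add: "j < n \<Longrightarrow> begin_time j + proc_time (\<eta> j) j = C j"
  using proc_time_le by (simp add: begin_time_def)

lemma begin_time_le: "begin_time j \<le> C j"
  by (simp add: begin_time_def)

lemma edge_begin_time:
  "(i, j) \<in> E \<Longrightarrow> C i + dly I (ltype (\<eta> i)) (ltype (\<eta> j)) i j \<le> begin_time j"
  using edge_int[of i j] begin_time_add[of j] edge_less[of i j] by linarith

lemma server_begin_time:
  assumes less_n: "i < n" "j < n" "i \<noteq> j" "\<eta> i = \<eta> j" "is_server (\<eta> i)"
  shows "C i \<le> begin_time j \<or> C j \<le> begin_time i"
proof -
  obtain m where "\<eta> i = Server m" using less_n(5) by (cases "\<eta> i") auto
  then have "proc_time (\<eta> i) i = ps I i" "proc_time (\<eta> j) j = ps I j"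
    using less_n(4) by (auto simp: proc_time_def)
  moreover have "int (C i) \<le> int (C j) - int (ps I j) \<or> int (C i) - int (ps I i) \<ge> int (C j)"
    using valid less_n unfolding valid_sched_def by blast
  ultimately show ?thesis using begin_time_add[OF less_n(1)] begin_time_add[OF less_n(2)]
    by linarith
qed

lemma placement: "j < n \<Longrightarrow> \<eta> j \<in> set (placements j)"
proof -
  assume "j < n"
  then have "case \<eta> j of Server m \<Rightarrow> m < z | Cloud c \<Rightarrow> c < k"
    "is_server (\<eta> (src I))" "is_server (\<eta> (snk I))"
    using valid unfolding valid_sched_def by blast+
  then show ?thesis by (cases "\<eta> j") (auto simp: placements_def)
qed

lemma C_le_makespan: "j < n \<Longrightarrow> C j \<le> C (snk I)"
proof (induction j rule: wf_induct_rule[OF wf_converse_edges, case_names less])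
  case (less j)
  show ?case
  proof (cases "j = snk I")
    case False
    then obtain i where edge: "(j, i) \<in> E" using no_successor_eq_snk less.prems by blast
    then have "C i \<le> C (snk I)" using less.IH[of i] edge_less by auto
    then show ?thesis using edge_begin_time[OF edge] begin_time_le[of i] by linarith
  qed simp
qed

text \<open>Jobs of length 0 may begin and end at the same time as their predecessors, hence the last
  component.\<close>

definition rank :: "nat \<Rightarrow> nat \<times> nat \<times> nat" where
  "rank j = (begin_time j, C j, depth j)"

lemma rank_less_edge:
  assumes "(i, j) \<in> E"
  shows "rank i < rank j"
proof -
  have "begin_time i \<le> C i" "C i \<le> begin_time j" "begin_time j \<le> C j"
    using edge_begin_time[OF assms] by (simp_all add: begin_time_le)
  then show ?thesis using depth_less[OF assms]
    by (auto simp: rank_def less_prod_def' less_eq_prod_def)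
qed

lemma rank_le_server:
  assumes "i < n" "j < n" "i \<noteq> j" "\<eta> i = \<eta> j" "is_server (\<eta> i)" "rank i \<le> rank j"
  shows "C i \<le> begin_time j"
proof (rule ccontr)
  assume "\<not> C i \<le> begin_time j"
  then have "C j \<le> begin_time i" using server_begin_time[OF assms(1-5)] by blast
  moreover have "begin_time j \<le> C j" "begin_time i \<le> C i" by (simp_all add: begin_time_le)
  ultimately show False
    using assms(6) \<open>\<not> C i \<le> begin_time j\<close> by (auto simp: rank_def less_prod_def' less_eq_prod_def)
qed

definition job_order :: "nat list" where
  "job_order = sort_key rank [0..<n]"

definition first_jobs :: "nat \<Rightarrow> nat set" where
  "first_jobs i = set (take i job_order)"

lemma first_jobs_0 [simp]: "first_jobs 0 = {}"
  by (simp add: first_jobs_def)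

lemma first_jobs_subset: "first_jobs i \<subseteq> {0..<n}"
  using set_take_subset[of i job_order] by (simp add: first_jobs_def job_order_def)

lemma first_jobs_Suc:
  assumes "i < n"
  obtains j where "j < n" "j \<notin> first_jobs i" "first_jobs (Suc i) = insert j (first_jobs i)"
    "\<forall>b<n. b \<notin> first_jobs i \<longrightarrow> rank j \<le> rank b"
proof
  let ?j = "job_order ! i"
  have len: "length job_order = n" and dist: "distinct job_order" and set: "set job_order = {0..<n}"
    and sorted: "sorted (map rank job_order)"
    by (simp_all add: job_order_def)
  have "?j \<in> set job_order" using assms len by (intro nth_mem) simp
  then show "?j < n" using set by simp
  have take: "take (Suc i) job_order = take i job_order @ [?j]"
    using assms len by (simp add: take_Suc_conv_app_nth)
  then show "first_jobs (Suc i) = insert ?j (first_jobs i)" by (simp add: first_jobs_def)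
  have "distinct (take (Suc i) job_order)" using dist by simp
  then show "?j \<notin> first_jobs i" unfolding take by (simp add: first_jobs_def)
  show "\<forall>b<n. b \<notin> first_jobs i \<longrightarrow> rank ?j \<le> rank b"
  proof (intro allI impI)
    fix b assume b_late: "b < n" "b \<notin> first_jobs i"
    then have "b \<in> set job_order" using set by simp
    then obtain i' where i': "i' < n" "b = job_order ! i'" using len by (metis in_set_conv_nth)
    have "\<not> i' < i"
    proof
      assume "i' < i"
      then have "b = take i job_order ! i'" "i' < length (take i job_order)" using i' len assms
        by simp_all
      then have "b \<in> first_jobs i" unfolding first_jobs_def using nth_mem by blast
      then show False using b_late by blast
    qed
    then show "rank ?j \<le> rank b"
      using sorted_nth_mono[OF sorted, of i i'] i' len assms by simp
  qed
qed

text \<open>\<open>d\<close> bounds how far the times of the stored state lag behind those of the given schedule.  Only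
  jobs with an unscheduled successor have to be compared: the others are forgotten by the key.\<close>

definition tracks :: "nat \<Rightarrow> nat set \<Rightarrow> state \<Rightarrow> bool" where
  "tracks d A s \<longleftrightarrow> jobs (entries s) = A \<and> cost s \<le> (\<Sum>j\<in>A. price (\<eta> j) j) \<and>
     (\<forall>a\<in>set (entries s). live (entries s) (job a) \<longrightarrow>
        ltype (place a) = ltype (\<eta> (job a)) \<and> end_time a \<le> C (job a) + d) \<and>
     (\<forall>m<z. free_at (entries s) m \<le> C (snk I) + d \<and>
        (\<forall>b<n. b \<notin> A \<and> \<eta> b = Server m \<longrightarrow> free_at (entries s) m \<le> begin_time b + d))"

lemma tracks_start_le:
  assumes tracked: "tracks d A s" and unscheduled: "j < n" "j \<notin> A"
  shows "start (entries s) j (\<eta> j) \<le> begin_time j + d"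
  unfolding start_def max_over_le_iff
proof
  fix a assume a_in: "a \<in> set (entries s)"
  show "release a j (\<eta> j) \<le> begin_time j + d"
  proof (cases "(job a, j) \<in> E")
    case True
    then have "live (entries s) (job a)" using tracked unscheduled(2)
      by (auto simp: live_def tracks_def)
    then have "ltype (place a) = ltype (\<eta> (job a))" "end_time a \<le> C (job a) + d"
      using tracked a_in unfolding tracks_def by blast+
    then show ?thesis using edge_begin_time[OF True] True by (simp add: release_def)
  next
    case False
    show ?thesis
    proof (cases "place a = \<eta> j \<and> is_server (\<eta> j)")
      case True
      then obtain m where server: "\<eta> j = Server m" by (cases "\<eta> j") auto
      then have "m < z" using placements_valid[OF placement[OF unscheduled(1)]] by simp
      then have "free_at (entries s) m \<le> begin_time j + d" using tracked server unscheduled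
        unfolding tracks_def by blast
      then have "end_time a \<le> begin_time j + d" using free_at_le_iff a_in True server by metis
      then show ?thesis using \<open>(job a, j) \<notin> E\<close> by (simp add: release_def)
    next
      case False
      then show ?thesis using \<open>(job a, j) \<notin> E\<close> by (auto simp: release_def)
    qed
  qed
qed

lemma tracks_ready:
  assumes "tracks d A s" "j < n" "j \<notin> A" "\<forall>b<n. b \<notin> A \<longrightarrow> rank j \<le> rank b"
  shows "ready (entries s) j"
proof -
  have "i \<in> A" if "(i, j) \<in> E" for i
    using assms(4) rank_less_edge[OF that] edge_less[OF that] leD by blast
  then show ?thesis using assms(1,3) by (simp add: ready_def tracks_def)
qed

lemma tracks_add_job:
  assumes finite_A: "finite A" and tracked: "tracks d A s"
    and unscheduled: "j < n" "j \<notin> A" and min: "\<forall>b<n. b \<notin> A \<longrightarrow> rank j \<le> rank b"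
  shows "tracks d (insert j A) (add_job s j (\<eta> j))"
proof -
  define c where "c = start (entries s) j (\<eta> j) + proc_time (\<eta> j) j"
  have c_le: "c \<le> C j + d"
    using tracks_start_le[OF tracked unscheduled] begin_time_add[OF unscheduled(1)]
    by (simp add: c_def)
  have ext: "add_job s j (\<eta> j) = (cost s + price (\<eta> j) j, (j, \<eta> j, c) # entries s)"
    by (simp add: add_job_def c_def)
  have jobs: "jobs ((j, \<eta> j, c) # entries s) = insert j A" using tracked by (simp add: tracks_def)
  have "cost s + price (\<eta> j) j \<le> (\<Sum>i\<in>insert j A. price (\<eta> i) i)"
    using tracked finite_A unscheduled(2) by (simp add: tracks_def)
  moreover have "ltype (place a) = ltype (\<eta> (job a)) \<and> end_time a \<le> C (job a) + d"
    if a_in: "a \<in> set ((j, \<eta> j, c) # entries s)"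
      and live: "live ((j, \<eta> j, c) # entries s) (job a)" for a
  proof (cases "a = (j, \<eta> j, c)")
    case True
    then show ?thesis using c_le by simp
  next
    case False
    moreover have "live (entries s) (job a)" using live by (auto simp: live_def)
    ultimately show ?thesis using tracked a_in unfolding tracks_def by simp
  qed
  moreover have "free_at ((j, \<eta> j, c) # entries s) m \<le> C (snk I) + d" if "m < z" for m
  proof -
    have "free_at (entries s) m \<le> C (snk I) + d" using tracked that unfolding tracks_def by blast
    then show ?thesis using c_le C_le_makespan[OF unscheduled(1)] by (simp add: free_at_le_iff)
  qed
  moreover have "free_at ((j, \<eta> j, c) # entries s) m \<le> begin_time b + d"
    if m_less: "m < z" and b_late: "b < n" "b \<notin> insert j A" "\<eta> b = Server m" for m b
  proof -
    have "C j \<le> begin_time b" if "\<eta> j = Server m"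
      using rank_le_server[OF unscheduled(1) b_late(1)] that b_late min by auto
    moreover have "free_at (entries s) m \<le> begin_time b + d" using tracked m_less b_late
      unfolding tracks_def by blast
    ultimately show ?thesis using c_le by (auto simp: free_at_le_iff)
  qed
  ultimately show ?thesis unfolding tracks_def ext fst_conv snd_conv using jobs by blast
qed

lemma tracks_key:
  assumes partial_s: "partial_schedule s" and partial_t: "partial_schedule t" and "0 < \<delta>"
    and key_eq: "key \<delta> (entries t) = key \<delta> (entries s)" and cost_le: "cost t \<le> cost s"
    and tracked: "tracks d A s"
  shows "tracks (d + (\<delta> - 1)) A t"
proof -
  have jobs: "jobs (entries s) = A" "jobs (entries t) = A"
    using tracked key_eq_jobs[OF partial_t partial_s key_eq] by (auto simp: tracks_def)
  have "ltype (place b) = ltype (\<eta> (job b)) \<and> end_time b \<le> C (job b) + (d + (\<delta> - 1))"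
    if b_in: "b \<in> set (entries t)" and live: "live (entries t) (job b)" for b
  proof -
    have "job b \<in> jobs (entries s)" using b_in jobs by auto
    then obtain a where a: "a \<in> set (entries s)" "job a = job b" by auto
    have live': "live (entries s) (job a)" using live jobs a(2) by (simp add: live_def)
    then have "ltype (place a) = ltype (\<eta> (job a))" "end_time a \<le> C (job a) + d"
      using tracked a(1) unfolding tracks_def by blast+
    then show ?thesis
      using key_eq_live[OF partial_s partial_t key_eq[symmetric] \<open>0 < \<delta>\<close> a(1) b_in a(2) live'] a(2)
      by simp
  qed
  moreover have "free_at (entries t) m \<le> free_at (entries s) m + (\<delta> - 1)" if "m < z" for m
    using key_eq_free_at[OF key_eq[symmetric] \<open>0 < \<delta>\<close> that] .
  then have "free_at (entries t) m \<le> C (snk I) + (d + (\<delta> - 1)) \<and>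
      (\<forall>b<n. b \<notin> A \<and> \<eta> b = Server m \<longrightarrow> free_at (entries t) m \<le> begin_time b + (d + (\<delta> - 1)))"
    if "m < z" for m
    using tracked that unfolding tracks_def by (smt (verit) add.assoc add_le_mono1 le_trans)
  moreover have "cost t \<le> (\<Sum>j\<in>A. price (\<eta> j) j)" using cost_le tracked unfolding tracks_def
    by linarith
  ultimately show ?thesis using jobs unfolding tracks_def by blast
qed

lemma tracks_admissible:
  assumes tracked: "tracks d (insert j A) (add_job s j l)" and A_subset: "insert j A \<subseteq> {0..<n}"
    and budget: "sched_cost I \<eta> \<le> bud I" and end_le: "end_time (hd (entries (add_job s j l))) \<le> U"
  shows "admissible U (add_job s j l)"
proof -
  have "cost (add_job s j l) \<le> (\<Sum>i\<in>insert j A. price (\<eta> i) i)" using tracked unfolding tracks_def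
    by blast
  also have "\<dots> \<le> (\<Sum>i\<in>{0..<n}. price (\<eta> i) i)" using A_subset by (intro sum_mono2) auto
  finally show ?thesis using budget end_le
    by (simp add: admissible_def sched_cost_eq_sum add_job_def)
qed

lemma layer_tracks:
  assumes "0 < \<delta>" and budget: "sched_cost I \<eta> \<le> bud I"
    and horizon: "C (snk I) + n * (\<delta> - 1) \<le> M * \<delta>"
  shows "i \<le> n \<Longrightarrow> \<exists>s\<in>set (layer M \<delta> i). tracks (i * (\<delta> - 1)) (first_jobs i) s"
proof (induction i)
  case 0
  show ?case by (simp add: tracks_def free_at_def max_over_def)
next
  case (Suc i)
  let ?d = "i * (\<delta> - 1)"
  obtain s where s: "s \<in> set (layer M \<delta> i)" "tracks ?d (first_jobs i) s" using Suc by auto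
  have partial: "partial_schedule s" using layer_invariant[OF s(1)] by (simp add: bounded_def)
  obtain j where next_job: "j < n" "j \<notin> first_jobs i"
    and insert: "first_jobs (Suc i) = insert j (first_jobs i)"
    and min: "\<forall>b<n. b \<notin> first_jobs i \<longrightarrow> rank j \<le> rank b"
    using first_jobs_Suc[of i] Suc.prems by auto
  let ?s = "add_job s j (\<eta> j)"
  have ready: "ready (entries s) j" by (rule tracks_ready[OF s(2) next_job min])
  have tracked: "tracks ?d (first_jobs (Suc i)) ?s"
    unfolding insert using tracks_add_job[OF _ s(2) next_job min] first_jobs_subset
      finite_subset by blast
  have "end_time (hd (entries ?s)) \<le> C j + ?d"
    using tracks_start_le[OF s(2) next_job] begin_time_add[OF next_job(1)]
    by (simp add: add_job_def)
  moreover have "?d \<le> n * (\<delta> - 1)" using Suc.prems by (intro mult_le_mono1) simp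
  ultimately have "end_time (hd (entries ?s)) \<le> M * \<delta>" using C_le_makespan[OF next_job(1)] horizon
    by linarith
  then have "admissible (M * \<delta>) ?s"
    using tracks_admissible tracked budget first_jobs_subset[of "Suc i"] unfolding insert by blast
  from layer_dominates[OF s(1) next_job(1) ready placement[OF next_job(1)] this] obtain t where
    t: "t \<in> set (layer M \<delta> (Suc i))" "key \<delta> (entries t) = key \<delta> (entries ?s)" "cost t \<le> cost ?s"
    by blast
  have "partial_schedule t" using layer_invariant[OF t(1)] by (simp add: bounded_def)
  then have "tracks (?d + (\<delta> - 1)) (first_jobs (Suc i)) t"
    using tracks_key[OF _ _ assms(1) t(2,3) tracked]
      partial_schedule.add_job[OF partial next_job(1) ready placement[OF next_job(1)]]
    by blast
  then show ?case using t(1) by (auto simp: add.commute)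
qed

lemma complete_end_of_snk_le:
  assumes "partial_schedule s" "jobs (entries s) = {0..<n}" "\<forall>m<z. free_at (entries s) m \<le> B"
  shows "end_of (entries s) (snk I) \<le> B"
proof -
  obtain a where a: "a \<in> set (entries s)" "job a = snk I" "end_of (entries s) (snk I) = end_time a"
    using complete_entry[OF assms(1,2) snk_less] by metis
  then have place: "place a \<in> set (placements (snk I))"
    using partial_schedule_place[OF assms(1) a(1)] by simp
  then have "is_server (place a)" by (rule placements_server) simp
  then obtain m where server: "place a = Server m" by (cases "place a") auto
  then have "m < z" using placements_valid[OF place] by simp
  then show ?thesis using assms(3) a server free_at_le_iff by metis
qed

lemma layer_approximates:
  assumes "0 < \<delta>" "sched_cost I \<eta> \<le> bud I" "C (snk I) + n * (\<delta> - 1) \<le> M * \<delta>"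
  shows "\<exists>s\<in>set (layer M \<delta> n). end_of (entries s) (snk I) \<le> C (snk I) + n * (\<delta> - 1)"
proof -
  obtain s where s: "s \<in> set (layer M \<delta> n)" "tracks (n * (\<delta> - 1)) (first_jobs n) s"
    using layer_tracks[OF assms, of n] by blast
  then have "\<forall>m<z. free_at (entries s) m \<le> C (snk I) + n * (\<delta> - 1)" unfolding tracks_def by blast
  then show ?thesis using complete_end_of_snk_le layer_complete[OF s(1)] s(1) by blast
qed

end

section \<open>The approximation ratio\<close>

context scheduling
begin

definition grid_size :: "nat \<Rightarrow> nat" where
  "grid_size e = Suc (2 * n * e + n)"

definition final_layer :: "nat \<Rightarrow> nat \<Rightarrow> state list" where
  "final_layer e q = layer (grid_size e) (2 ^ q) n"

lemma final_layer_approximates: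
  assumes "valid_sched I C \<eta>" "sched_cost I \<eta> \<le> bud I"
      "C (snk I) + n * (2 ^ q - 1) \<le> grid_size e * 2 ^ q"
  shows "\<exists>s\<in>set (final_layer e q). end_of (entries s) (snk I) \<le> C (snk I) + n * (2 ^ q - 1)"
proof -
  interpret reference_schedule I C \<eta> using assms(1) by unfold_locales
  show ?thesis unfolding final_layer_def using assms(2,3) by (intro layer_approximates) auto
qed

lemma final_layer_bounded:
  assumes "s \<in> set (final_layer e q)"
  shows "end_of (entries s) (snk I) \<le> grid_size e * 2 ^ q"
proof -
  note s = assms[unfolded final_layer_def]
  obtain a where "a \<in> set (entries s)" "end_of (entries s) (snk I) = end_time a"
    using complete_entry[OF layer_complete(1,2)[OF s] snk_less] by metis
  then show ?thesis using layer_invariant[OF s] by (simp add: bounded_def)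
qed

lemma first_success_ratio:
  assumes failed: "\<forall>p<q. final_layer e p = []"
    and s_in: "s \<in> set (final_layer e q)"
    and best: "\<forall>t\<in>set (final_layer e q). end_of (entries s) (snk I) \<le> end_of (entries t) (snk I)"
    and feasible: "valid_sched I C \<eta>" "sched_cost I \<eta> \<le> bud I"
  shows "e * end_of (entries s) (snk I) \<le> (e + 1) * C (snk I)"
proof -
  let ?T = "C (snk I)" and ?\<delta> = "2 ^ q :: nat"
  have "end_of (entries s) (snk I) \<le> ?T + n * (?\<delta> - 1)"
  proof (cases "?T + n * (?\<delta> - 1) \<le> grid_size e * ?\<delta>")
    case True
    then show ?thesis using final_layer_approximates[OF feasible] best le_trans by blast
  next
    case False
    then show ?thesis using final_layer_bounded[OF s_in] by linarith
  qed
  then have "e * end_of (entries s) (snk I) \<le> e * ?T + e * (n * (?\<delta> - 1))"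
    unfolding distrib_left[symmetric] by (rule mult_le_mono2)
  moreover have "e * (n * (?\<delta> - 1)) \<le> ?T"
  proof (cases q)
    case 0
    then show ?thesis by simp
  next
    case (Suc p)
    define g where "g = (2 :: nat) ^ p"
    have "final_layer e p = []" using failed Suc by simp
    then have "grid_size e * g < ?T + n * (g - 1)"
      using final_layer_approximates[OF feasible, of p e] by (auto simp: g_def not_le[symmetric])
    moreover have "grid_size e * g = e * (n * (2 * g)) + n * g + g"
      by (simp add: grid_size_def algebra_simps)
    moreover have "n * (g - 1) \<le> n * g" by simp
    moreover have "e * (n * (?\<delta> - 1)) \<le> e * (n * (2 * g))" by (simp add: Suc g_def)
    ultimately show ?thesis by linarith
  qed
  ultimately show ?thesis by simp
qed

text \<open>All jobs are processed on one server in topological order.\<close>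

lemma serial_schedule:
  "\<exists>C \<eta>. valid_sched I C \<eta> \<and> sched_cost I \<eta> = 0 \<and> C (snk I) \<le> (\<Sum>j\<in>{0..<n}. ps I j)"
proof -
  define P where "P j = {i. i < n \<and> (depth i, i) \<le> (depth j, j)}" for j
  define C where "C j = (\<Sum>i\<in>P j. ps I i)" for j
  have fin: "finite (P j)" for j by (simp add: P_def)
  have order: "C i + ps I j \<le> C j" if "j < n" "(depth i, i) < (depth j, j)" for i j
  proof -
    have "j \<notin> P i" "insert j (P i) \<subseteq> P j" using that by (auto simp: P_def)
    then have "(\<Sum>a\<in>insert j (P i). ps I a) \<le> C j" unfolding C_def by (intro sum_mono2 fin) auto
    then show ?thesis using \<open>j \<notin> P i\<close> fin by (simp add: C_def)
  qed
  have "valid_sched I C (\<lambda>_. Server 0)" unfolding valid_sched_def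
  proof (intro conjI allI impI)
    show "case Server 0 of Server m \<Rightarrow> m < z | Cloud c \<Rightarrow> c < k" for j using z_pos by simp
    show "is_server (Server 0)" "is_server (Server 0)" by simp_all
    fix i j assume distinct_jobs: "i < n" "j < n"
      "i \<noteq> j \<and> Server 0 = Server 0 \<and> is_server (Server 0)"
    then have "(depth i, i) < (depth j, j) \<or> (depth j, j) < (depth i, i)" by auto
    then show "int (C i) \<le> int (C j) - int (ps I j) \<or> int (C j) \<le> int (C i) - int (ps I i)"
      using order[of i j] order[of j i] distinct_jobs by fastforce
  next
    show "\<forall>(i, j)\<in>E. int (C i) + int (dly I (ltype (Server 0)) (ltype (Server 0)) i j)
        \<le> int (C j) - int (ptime I (\<lambda>_. Server 0) j)"
    proof (intro ballI, clarify)
      fix i j assume edge: "(i, j) \<in> E"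
      have "C i + ps I j \<le> C j" using order depth_less[OF edge] edge_less[OF edge] by auto
      then show "int (C i) + int (dly I (ltype (Server 0)) (ltype (Server 0)) i j)
        \<le> int (C j) - int (ptime I (\<lambda>_. Server 0) j)"
        using dly_same_type by (simp add: ptime_def)
    qed
  qed
  moreover have "sched_cost I (\<lambda>_. Server 0) = 0" by (simp add: sched_cost_def)
  moreover have "C (snk I) \<le> (\<Sum>j\<in>{0..<n}. ps I j)" unfolding C_def
    by (rule sum_mono2) (auto simp: P_def)
  ultimately show ?thesis by blast
qed

lemma final_layer_nonempty:
  assumes "(\<Sum>j\<in>{0..<n}. ps I j) \<le> 2 ^ q"
  shows "final_layer e q \<noteq> []"
proof -
  obtain C \<eta> where feasible: "valid_sched I C \<eta>" "sched_cost I \<eta> = 0"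
    "C (snk I) \<le> (\<Sum>j\<in>{0..<n}. ps I j)"
    using serial_schedule by blast
  have "n * (2 ^ q - 1) \<le> n * 2 ^ q" by simp
  moreover have "2 ^ q + n * 2 ^ q \<le> grid_size e * 2 ^ q" by (simp add: grid_size_def algebra_simps)
  ultimately have "C (snk I) + n * (2 ^ q - 1) \<le> grid_size e * 2 ^ q" using feasible(3) assms
    by linarith
  then show ?thesis using final_layer_approximates[OF feasible(1)] feasible(2) by fastforce
qed

end

section \<open>The program\<close>

text \<open>The input \<open>xs\<close> is \<open>enc I @ [e]\<close>: six numbers, the tables stored row by row, and \<open>e\<close>.\<close>

abbreviation read_n :: "nat \<Rightarrow> nat list \<Rightarrow> nat" where "read_n W xs \<equiv> nth_upto W xs 0"
abbreviation read_src :: "nat \<Rightarrow> nat list \<Rightarrow> nat" where "read_src W xs \<equiv> nth_upto W xs 1"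
abbreviation read_snk :: "nat \<Rightarrow> nat list \<Rightarrow> nat" where "read_snk W xs \<equiv> nth_upto W xs 2"
abbreviation read_z :: "nat \<Rightarrow> nat list \<Rightarrow> nat" where "read_z W xs \<equiv> nth_upto W xs 3"
abbreviation read_k :: "nat \<Rightarrow> nat list \<Rightarrow> nat" where "read_k W xs \<equiv> nth_upto W xs 4"
abbreviation read_bud :: "nat \<Rightarrow> nat list \<Rightarrow> nat" where "read_bud W xs \<equiv> nth_upto W xs 5"

abbreviation all_jobs :: "nat \<Rightarrow> nat list \<Rightarrow> nat list" where
  "all_jobs W xs \<equiv> take W (upt_upto W (read_n W xs))"

abbreviation all_servers :: "nat \<Rightarrow> nat list \<Rightarrow> nat list" where
  "all_servers W xs \<equiv> take W (upt_upto W (read_z W xs))"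

definition edge_prog :: "nat \<Rightarrow> nat list \<Rightarrow> nat \<Rightarrow> nat \<Rightarrow> bool" where
  "edge_prog W xs i j \<longleftrightarrow> nth_upto W xs (6 + mult_upto W i (read_n W xs) + j) = 1"

definition proc_time_prog :: "nat \<Rightarrow> nat list \<Rightarrow> loc \<Rightarrow> nat \<Rightarrow> nat" where
  "proc_time_prog W xs l j =
    nth_upto W xs (6 + mult_upto W (read_n W xs + type_code l) (read_n W xs) + j)"

definition delay_prog :: "nat \<Rightarrow> nat list \<Rightarrow> loc \<Rightarrow> loc \<Rightarrow> nat \<Rightarrow> nat \<Rightarrow> nat" where
  "delay_prog W xs l l' i j = (let n = read_n W xs; k = Suc (read_k W xs) in
    nth_upto W xs (6 + mult_upto W (n + k) n +
      mult_upto W (mult_upto W (mult_upto W (type_code l) k + type_code l') n + i) n + j))"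

definition price_prog :: "nat \<Rightarrow> nat list \<Rightarrow> loc \<Rightarrow> nat \<Rightarrow> nat" where
  "price_prog W xs l j = (case l of Server m \<Rightarrow> 0 | Cloud c \<Rightarrow>
    (let n = read_n W xs; k = Suc (read_k W xs) in
     nth_upto W xs (6 + mult_upto W (n + k) n + mult_upto W (mult_upto W (mult_upto W k k) n) n +
       mult_upto W j (read_k W xs) + c)))"

definition placements_prog :: "nat \<Rightarrow> nat list \<Rightarrow> nat \<Rightarrow> loc list" where
  "placements_prog W xs j = take W (map (\<lambda>m. Server m) (all_servers W xs)) @
    (if j = read_src W xs \<or> j = read_snk W xs then []
     else map (\<lambda>c. Cloud c) (take W (upt_upto W (read_k W xs))))"

definition same_server :: "loc \<Rightarrow> loc \<Rightarrow> bool" where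
  "same_server l l' \<longleftrightarrow>
    (case l of Server m \<Rightarrow> (case l' of Server m' \<Rightarrow> m = m' | Cloud c \<Rightarrow> False) | Cloud c \<Rightarrow> False)"

definition scheduled_prog :: "nat \<Rightarrow> entry list \<Rightarrow> nat \<Rightarrow> bool" where
  "scheduled_prog W h j \<longleftrightarrow> list_ex (\<lambda>a. job a = j) (take W h)"

definition ready_prog :: "nat \<Rightarrow> nat list \<Rightarrow> entry list \<Rightarrow> nat \<Rightarrow> bool" where
  "ready_prog W xs h j \<longleftrightarrow> \<not> scheduled_prog W h j \<and>
    \<not> list_ex (\<lambda>i. edge_prog W xs i j \<and> \<not> scheduled_prog W h i) (all_jobs W xs)"

definition live_prog :: "nat \<Rightarrow> nat list \<Rightarrow> entry list \<Rightarrow> nat \<Rightarrow> bool" where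
  "live_prog W xs h j \<longleftrightarrow> list_ex (\<lambda>i. edge_prog W xs j i \<and> \<not> scheduled_prog W h i) (all_jobs W xs)"

definition release_prog :: "nat \<Rightarrow> nat list \<Rightarrow> entry \<Rightarrow> nat \<Rightarrow> loc \<Rightarrow> nat" where
  "release_prog W xs a j l =
    (if edge_prog W xs (job a) j then end_time a + delay_prog W xs (place a) l (job a) j
     else if same_server (place a) l then end_time a else 0)"

definition start_prog :: "nat \<Rightarrow> nat list \<Rightarrow> entry list \<Rightarrow> nat \<Rightarrow> loc \<Rightarrow> nat" where
  "start_prog W xs h j l = fold (\<lambda>a s. max s (release_prog W xs a j l)) (take W h) 0"

definition add_job_prog :: "nat \<Rightarrow> nat list \<Rightarrow> state \<Rightarrow> nat \<Rightarrow> loc \<Rightarrow> state" where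
  "add_job_prog W xs s j l = (cost s + price_prog W xs l j,
    (j, l, start_prog W xs (entries s) j l + proc_time_prog W xs l j) # entries s)"

definition successors_prog :: "nat \<Rightarrow> nat list \<Rightarrow> state \<Rightarrow> state list" where
  "successors_prog W xs s = concat_upto W
    (map (\<lambda>j. map (\<lambda>l. add_job_prog W xs s j l) (take W (placements_prog W xs j)))
      (take W (filter (\<lambda>j. ready_prog W xs (entries s) j) (all_jobs W xs))))"

definition admissible_prog :: "nat \<Rightarrow> nat list \<Rightarrow> nat \<Rightarrow> state \<Rightarrow> bool" where
  "admissible_prog W xs U s \<longleftrightarrow> cost s \<le> read_bud W xs \<and>
    (case entries s of [] \<Rightarrow> False | a # h \<Rightarrow> end_time a \<le> U)"

definition candidates_prog :: "nat \<Rightarrow> nat list \<Rightarrow> nat \<Rightarrow> state list \<Rightarrow> state list" where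
  "candidates_prog W xs U L = filter (\<lambda>s. admissible_prog W xs U s)
    (take W (concat_upto W (map (\<lambda>s. successors_prog W xs s) (take W L))))"

definition entry_prog :: "nat \<Rightarrow> entry list \<Rightarrow> nat \<Rightarrow> entry list" where
  "entry_prog W h j = filter (\<lambda>a. job a = j) (take W h)"

definition tag_prog :: "nat \<Rightarrow> nat list \<Rightarrow> entry list \<Rightarrow> nat \<Rightarrow> nat" where
  "tag_prog W xs h j = (case entry_prog W h j of [] \<Rightarrow> 0
    | a # _ \<Rightarrow> if live_prog W xs h j then Suc (Suc (type_code (place a))) else 1)"

definition bucket_prog :: "nat \<Rightarrow> nat list \<Rightarrow> nat \<Rightarrow> entry list \<Rightarrow> nat \<Rightarrow> nat" where
  "bucket_prog W xs \<delta> h j = (case entry_prog W h j of [] \<Rightarrow> 0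
    | a # _ \<Rightarrow> if live_prog W xs h j then div_upto W (end_time a) \<delta> else 0)"

definition free_at_prog :: "nat \<Rightarrow> entry list \<Rightarrow> nat \<Rightarrow> nat" where
  "free_at_prog W h m =
    fold (\<lambda>a s. max s (if same_server (place a) (Server m) then end_time a else 0)) (take W h) 0"

definition key_prog :: "nat \<Rightarrow> nat list \<Rightarrow> nat \<Rightarrow> entry list \<Rightarrow> nat list" where
  "key_prog W xs \<delta> h = take W (map (\<lambda>j. tag_prog W xs h j) (all_jobs W xs)) @
    take W (map (\<lambda>j. bucket_prog W xs \<delta> h j) (all_jobs W xs)) @
    map (\<lambda>m. div_upto W (free_at_prog W h m) \<delta>) (all_servers W xs)"

definition same_key_prog :: "nat \<Rightarrow> nat list \<Rightarrow> nat \<Rightarrow> state \<Rightarrow> state \<Rightarrow> bool" where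
  "same_key_prog W xs \<delta> s t \<longleftrightarrow>
    eq_upto W (key_prog W xs \<delta> (entries s)) (key_prog W xs \<delta> (entries t))"

definition insert_min_prog :: "nat \<Rightarrow> nat list \<Rightarrow> nat \<Rightarrow> state \<Rightarrow> state list \<Rightarrow> state list" where
  "insert_min_prog W xs \<delta> s L =
    (if list_ex (\<lambda>t. same_key_prog W xs \<delta> t s \<and> cost t \<le> cost s) (take W L) then L
     else s # filter (\<lambda>t. \<not> same_key_prog W xs \<delta> t s) (take W L))"

definition layer_step_prog :: "nat \<Rightarrow> nat list \<Rightarrow> nat \<Rightarrow> nat \<Rightarrow> state list \<Rightarrow> state list" where
  "layer_step_prog W xs M \<delta> L =
    fold (\<lambda>s L'. insert_min_prog W xs \<delta> s L')
        (take W (candidates_prog W xs (mult_upto W \<delta> M) L)) []"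

definition final_layer_prog :: "nat \<Rightarrow> nat list \<Rightarrow> nat \<Rightarrow> nat \<Rightarrow> state list" where
  "final_layer_prog W xs M \<delta> = fold (\<lambda>i L. layer_step_prog W xs M \<delta> L) (all_jobs W xs) [(0, [])]"

definition search_step_prog :: "nat \<Rightarrow> nat list \<Rightarrow> nat \<Rightarrow> nat \<times> state list \<Rightarrow> nat \<times> state list" where
  "search_step_prog W xs M y =
    (if snd y = [] then (fst y + fst y, final_layer_prog W xs M (fst y + fst y)) else y)"

definition grid_size_prog :: "nat \<Rightarrow> nat list \<Rightarrow> nat \<Rightarrow> nat" where
  "grid_size_prog W xs e = (let n = read_n W xs in Suc (mult_upto W (n + n) e + n))"

definition search_prog :: "nat \<Rightarrow> nat list \<Rightarrow> nat \<Rightarrow> nat \<times> state list" where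
  "search_prog W xs M = (search_step_prog W xs M ^^ W) (1, final_layer_prog W xs M 1)"

definition end_prog :: "nat \<Rightarrow> entry list \<Rightarrow> nat \<Rightarrow> nat" where
  "end_prog W h j = (case entry_prog W h j of [] \<Rightarrow> 0 | a # _ \<Rightarrow> end_time a)"

definition place_code_prog :: "nat \<Rightarrow> entry list \<Rightarrow> nat \<Rightarrow> nat" where
  "place_code_prog W h j = (case entry_prog W h j of [] \<Rightarrow> 0
    | a # _ \<Rightarrow> (case place a of Server m \<Rightarrow> m + m | Cloud c \<Rightarrow> Suc (c + c)))"

definition best_prog :: "nat \<Rightarrow> nat list \<Rightarrow> state \<Rightarrow> state list \<Rightarrow> state" where
  "best_prog W xs s L = fold (\<lambda>t b.
     if end_prog W (entries t) (read_snk W xs) < end_prog W (entries b) (read_snk W xs) then t else b)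
     (take W L) s"

definition output_prog :: "nat \<Rightarrow> nat list \<Rightarrow> entry list \<Rightarrow> nat list" where
  "output_prog W xs h = concat_upto W
      (map (\<lambda>j. [end_prog W h j, place_code_prog W h j]) (all_jobs W xs))"

definition main_prog :: "nat \<Rightarrow> nat list \<Rightarrow> nat list" where
  "main_prog W xs = (let e = nth_upto W (rev (take W xs)) 0 in
    case snd (search_prog W xs (grid_size_prog W xs e)) of [] \<Rightarrow> []
    | s # L \<Rightarrow> output_prog W xs (entries (best_prog W xs s L)))"

lemma polytime_type_code: "polytime D l \<Longrightarrow> polytime D (\<lambda>W x. type_code (l W x))"
  unfolding type_code_def by (intro polytime_intros)

lemma polytime_same_server [THEN polytime_compose2]: "polytime2 D (\<lambda>W. same_server)"
  unfolding same_server_def by (intro polytime_intros)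

lemma polytime_edge [THEN polytime_compose3]: "polytime3 D edge_prog"
  unfolding edge_prog_def by (intro polytime_intros)

lemma polytime_proc_time [THEN polytime_compose3]: "polytime3 D proc_time_prog"
  unfolding proc_time_prog_def by (intro polytime_intros polytime_type_code)

lemma polytime_delay [THEN polytime_compose5]: "polytime5 D delay_prog"
  unfolding delay_prog_def by (intro polytime_intros polytime_type_code)

lemma polytime_price [THEN polytime_compose3]: "polytime3 D price_prog"
  unfolding price_prog_def by (intro polytime_intros)

lemma polytime_placements [THEN polytime_compose2]: "polytime2 D placements_prog"
  unfolding placements_prog_def by (intro polytime_intros)

lemma polytime_scheduled [THEN polytime_compose2]: "polytime2 D scheduled_prog"
  unfolding scheduled_prog_def by (intro polytime_intros)

lemma polytime_ready [THEN polytime_compose3]: "polytime3 D ready_prog"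
  unfolding ready_prog_def by (intro polytime_intros polytime_edge polytime_scheduled)

lemma polytime_live [THEN polytime_compose3]: "polytime3 D live_prog"
  unfolding live_prog_def by (intro polytime_intros polytime_edge polytime_scheduled)

lemma polytime_release [THEN polytime_compose4]: "polytime4 D release_prog"
  unfolding release_prog_def
  by (intro polytime_intros polytime_edge polytime_delay polytime_same_server)

lemma polytime_start [THEN polytime_compose4]: "polytime4 D start_prog"
  unfolding start_prog_def by (intro polytime_intros polytime_release)

lemma polytime_add_job [THEN polytime_compose4]: "polytime4 D add_job_prog"
  unfolding add_job_prog_def by (intro polytime_intros polytime_price polytime_start
    polytime_proc_time)

lemma polytime_successors [THEN polytime_compose2]: "polytime2 D successors_prog"
  unfolding successors_prog_def
  by (intro polytime_intros polytime_add_job polytime_ready polytime_placements)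

lemma polytime_admissible [THEN polytime_compose3]: "polytime3 D admissible_prog"
  unfolding admissible_prog_def by (intro polytime_intros)

lemma polytime_candidates [THEN polytime_compose3]: "polytime3 D candidates_prog"
  unfolding candidates_prog_def by (intro polytime_intros polytime_admissible polytime_successors)

lemma polytime_entry [THEN polytime_compose2]: "polytime2 D entry_prog"
  unfolding entry_prog_def by (intro polytime_intros)

lemma polytime_tag [THEN polytime_compose3]: "polytime3 D tag_prog"
  unfolding tag_prog_def by (intro polytime_intros polytime_entry polytime_live polytime_type_code)

lemma polytime_bucket [THEN polytime_compose4]: "polytime4 D bucket_prog"
  unfolding bucket_prog_def by (intro polytime_intros polytime_entry polytime_live)

lemma polytime_free_at [THEN polytime_compose2]: "polytime2 D free_at_prog"
  unfolding free_at_prog_def by (intro polytime_intros polytime_same_server)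

lemma polytime_key [THEN polytime_compose3]: "polytime3 D key_prog"
  unfolding key_prog_def by (intro polytime_intros polytime_tag polytime_bucket polytime_free_at)

lemma polytime_same_key [THEN polytime_compose4]: "polytime4 D same_key_prog"
  unfolding same_key_prog_def by (intro polytime_intros polytime_key)

lemma polytime_insert_min [THEN polytime_compose4]: "polytime4 D insert_min_prog"
  unfolding insert_min_prog_def by (intro polytime_intros polytime_same_key)

lemma polytime_layer_step [THEN polytime_compose4]: "polytime4 D layer_step_prog"
  unfolding layer_step_prog_def by (intro polytime_intros polytime_candidates polytime_insert_min)

lemma polytime_final_layer [THEN polytime_compose3]: "polytime3 D final_layer_prog"
  unfolding final_layer_prog_def by (intro polytime_intros polytime_layer_step)

lemma polytime_search_step [THEN polytime_compose3]: "polytime3 D search_step_prog"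
  unfolding search_step_prog_def by (intro polytime_intros polytime_final_layer)

lemma polytime_grid_size [THEN polytime_compose2]: "polytime2 D grid_size_prog"
  unfolding grid_size_prog_def by (intro polytime_intros)

lemma polytime_search [THEN polytime_compose2]: "polytime2 D search_prog"
  unfolding search_prog_def
  by (intro polytime_intros polytime_iter polytime_final_layer polytime_search_step)

lemma polytime_end [THEN polytime_compose2]: "polytime2 D end_prog"
  unfolding end_prog_def by (intro polytime_intros polytime_entry)

lemma polytime_place_code [THEN polytime_compose2]: "polytime2 D place_code_prog"
  unfolding place_code_prog_def by (intro polytime_intros polytime_entry)

lemma polytime_best [THEN polytime_compose3]: "polytime3 D best_prog"
  unfolding best_prog_def by (intro polytime_intros polytime_end)

lemma polytime_output [THEN polytime_compose2]: "polytime2 D output_prog"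
  unfolding output_prog_def by (intro polytime_intros polytime_end polytime_place_code)

lemma polytime_main: "polytime D main_prog"
  unfolding main_prog_def
  by (intro polytime_intros polytime_grid_size polytime_search polytime_best polytime_output)

section \<open>Correctness of the program\<close>

lemma length_concat_uniform:
  "(\<And>x. x \<in> set xs \<Longrightarrow> length (g x) = m) \<Longrightarrow> length (concat (map g xs)) = length xs * m"
  by (induction xs) auto

lemma length_concat_le:
  "(\<And>x. x \<in> set xs \<Longrightarrow> length (g x) \<le> m) \<Longrightarrow> length (concat (map g xs)) \<le> length xs * m"
  by (induction xs) (simp, fastforce)

lemma nth_concat_uniform:
  "(\<And>x. x \<in> set xs \<Longrightarrow> length (g x) = m) \<Longrightarrow> i < length xs \<Longrightarrow> j < m \<Longrightarrow>
   concat (map g xs) ! (i * m + j) = g (xs ! i) ! j"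
proof (induction xs arbitrary: i)
  case (Cons x xs)
  show ?case
  proof (cases i)
    case 0
    then show ?thesis using Cons.prems by (simp add: nth_append)
  next
    case (Suc i')
    have "length (g x) = m" using Cons.prems by simp
    then show ?thesis using Cons.IH[of i'] Cons.prems Suc by (simp add: nth_append)
  qed
qed simp

lemma grid_index_less:
  fixes i j a b :: nat
  assumes "i < a" "j < b"
  shows "i * b + j < a * b"
proof -
  have "i * b + j < Suc i * b" using assms(2) by simp
  also have "\<dots> \<le> a * b" using assms(1) by (intro mult_le_mono1) simp
  finally show ?thesis .
qed

lemma fold_min_mem: "fold (\<lambda>y b. if f y < f b then y else b) xs x \<in> set (x # xs)"
  for f :: "'a \<Rightarrow> nat"
proof (induction xs arbitrary: x)
  case (Cons y ys)
  then show ?case using Cons[of "if f y < f x then y else x"] by (auto split: if_splits)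
qed simp

lemma fold_min_le: "t \<in> set (x # xs) \<Longrightarrow> f (fold (\<lambda>y b. if f y < f b then y else b) xs x) \<le> f t"
  for f :: "'a \<Rightarrow> nat"
proof (induction xs arbitrary: x t)
  case (Cons y ys)
  let ?x = "if f y < f x then y else x"
  have "f ?x \<le> f x" "f ?x \<le> f y" by auto
  then obtain u where "u \<in> set (?x # ys)" "f u \<le> f t" using Cons.prems by force
  then show ?case using Cons.IH[of u ?x] by simp
qed simp

locale encoded_instance = scheduling I for I :: inst +
  fixes e :: nat and xs :: "nat list"
  assumes xs_eq: "xs = enc I @ [e]" and e_pos: "1 \<le> e"
begin

definition header :: "nat list" where
  "header = [n, src I, snk I, z, k, bud I]"

definition edge_table :: "nat list" where
  "edge_table = [if (i, j) \<in> E then 1 else 0. i \<leftarrow> [0..<n], j \<leftarrow> [0..<n]]"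

definition time_table :: "nat list" where
  "time_table = map (ps I) [0..<n] @
    [if j = src I \<or> j = snk I then 0 else pcl I c j. c \<leftarrow> [0..<k], j \<leftarrow> [0..<n]]"

definition delay_row :: "nat option \<Rightarrow> nat option \<Rightarrow> nat \<Rightarrow> nat list" where
  "delay_row m m' i = map (\<lambda>j. if (i, j) \<in> E then dly I m m' i j else 0) [0..<n]"

definition delay_block :: "nat option \<Rightarrow> nat option \<Rightarrow> nat list" where
  "delay_block m m' = concat (map (delay_row m m') [0..<n])"

definition delay_table :: "nat list" where
  "delay_table = concat (map (\<lambda>m. concat (map (delay_block m) (mtypes I))) (mtypes I))"

definition cost_table :: "nat list" where
  "cost_table = [if j = src I \<or> j = snk I then 0 else cst I j c. j \<leftarrow> [0..<n], c \<leftarrow> [0..<k]]"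

lemma xs_tables: "xs = header @ edge_table @ time_table @ delay_table @ cost_table @ [e]"
  unfolding xs_eq enc_def header_def edge_table_def time_table_def delay_table_def delay_block_def
    delay_row_def cost_table_def
  by simp

lemma length_header: "length header = 6"
  by (simp add: header_def)

lemma length_mtypes: "length (mtypes I) = Suc k"
  by (simp add: mtypes_def)

lemma nth_mtypes: "type_code l \<le> k \<Longrightarrow> mtypes I ! type_code l = ltype l"
  by (cases l) (auto simp: mtypes_def type_code_def)

lemma length_edge_table: "length edge_table = n * n"
  unfolding edge_table_def by (subst length_concat_uniform[where m = n]) auto

lemma length_time_table: "length time_table = Suc k * n"
  unfolding time_table_def length_append by (subst length_concat_uniform[where m = n]) auto

lemma length_delay_row: "length (delay_row m m' i) = n"
  by (simp add: delay_row_def)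

lemma length_delay_block: "length (delay_block m m') = n * n"
  by (simp add: delay_block_def length_delay_row length_concat_uniform[where m = n])

lemma length_delay_blocks: "length (concat (map (delay_block m) (mtypes I))) = Suc k * (n * n)"
  using length_concat_uniform[of "mtypes I" "delay_block m" "n * n"]
  by (simp only: length_delay_block length_mtypes)

lemma length_delay_table: "length delay_table = Suc k * (Suc k * (n * n))"
  unfolding delay_table_def
  by (subst length_concat_uniform[where m = "Suc k * (n * n)"])
    (simp_all only: length_delay_blocks length_mtypes)

lemma length_cost_table: "length cost_table = n * k"
  unfolding cost_table_def by (subst length_concat_uniform[where m = k]) auto

lemma length_xs: "length xs = 6 + n * n + Suc k * n + Suc k * (Suc k * (n * n)) + n * k + 1"
  unfolding xs_tables by (simp add: length_header length_edge_table length_time_table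
    length_delay_table length_cost_table)

lemma length_xs_ge: "2 * n + 8 \<le> length xs" "Suc k \<le> length xs"
proof -
  have "n * 1 \<le> n * n" "1 * n \<le> Suc k * n" "1 * (1 * 1) \<le> Suc k * (Suc k * (n * n))"
    using n_pos by (intro mult_le_mono order_refl; simp)+
  then show "2 * n + 8 \<le> length xs" using length_xs by linarith
  have "Suc k * 1 \<le> Suc k * n" using n_pos by (intro mult_le_mono2) simp
  also have "\<dots> \<le> length xs" unfolding length_xs by simp
  finally show "Suc k \<le> length xs" by simp
qed

lemma sum_ps_le: "(\<Sum>j\<in>{0..<n}. ps I j) \<le> sum_list xs"
proof -
  have "(\<Sum>j\<in>{0..<n}. ps I j) = sum_list (map (ps I) [0..<n])"
    by (simp add: interv_sum_list_conv_sum_set_nat)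
  also have "\<dots> \<le> sum_list xs" unfolding xs_tables time_table_def by simp
  finally show ?thesis .
qed

end

locale program_run = encoded_instance +
  fixes W :: nat
  assumes length_le: "length xs \<le> W"
    and key_length_le: "n + n + z \<le> W"
    and capacity: "max_keys (grid_size e) * (n * (z + k)) \<le> W"
    and grid_size_le: "grid_size e \<le> W"
    and bitlen_less: "bitlen (sum_list xs) < W"
begin

lemma n_le: "n \<le> W" and z_le: "z \<le> W" and e_le: "e \<le> W" and Suc_k_le: "Suc k \<le> W"
proof -
  show "n \<le> W" "z \<le> W" using key_length_le by simp_all
  have "1 * e \<le> n * e" using n_pos by (intro mult_le_mono1) simp
  then show "e \<le> W" using grid_size_le unfolding grid_size_def mult.assoc by linarith
  show "Suc k \<le> W" using length_xs_ge(2) length_le by simp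
qed

lemma max_keys_le: "max_keys (grid_size e) \<le> W" and branching_le: "n * (z + k) \<le> W"
proof -
  have "1 \<le> n * (z + k)" using n_pos z_pos by simp
  then show "max_keys (grid_size e) \<le> W"
    using mult_le_mono2[of 1 "n * (z + k)" "max_keys (grid_size e)"] capacity by linarith
  show "n * (z + k) \<le> W"
    using mult_le_mono1[OF max_keys_pos, of "n * (z + k)" "grid_size e"] capacity by linarith
qed

lemma nth_upto_xs: "i < length xs \<Longrightarrow> nth_upto W xs i = xs ! i"
  using length_le by (intro nth_upto_eq) auto

lemma nth_header:
  "read_n W xs = n" "read_src W xs = src I" "read_snk W xs = snk I" "read_z W xs = z"
  "read_k W xs = k" "read_bud W xs = bud I"
proof -
  have "nth_upto W xs i = header ! i" if "i < 6" for i
  proof -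
    have "nth_upto W xs i = xs ! i" using that length_xs by (intro nth_upto_xs) simp
    then show ?thesis using that unfolding xs_tables by (simp add: nth_append length_header)
  qed
  then show "read_n W xs = n" "read_src W xs = src I" "read_snk W xs = snk I"
    "read_z W xs = z" "read_k W xs = k" "read_bud W xs = bud I"
    by (simp_all add: header_def)
qed

lemma mult_upto_n: "mult_upto W a n = a * n" and mult_upto_k: "mult_upto W a k = a * k"
  and mult_upto_Suc_k: "mult_upto W a (Suc k) = a * Suc k"
  using n_le Suc_k_le by (simp_all add: mult_upto_eq)

lemma all_jobs_eq: "all_jobs W xs = [0..<n]"
  using n_le by (simp add: nth_header upt_upto_eq)

lemma all_servers_eq: "all_servers W xs = [0..<z]"
  using z_le by (simp add: nth_header upt_upto_eq)

lemma nth_upto_table: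
  assumes "i < length table" "xs = pre @ table @ post"
  shows "nth_upto W xs (length pre + i) = table ! i"
proof -
  have "nth_upto W xs (length pre + i) = xs ! (length pre + i)" using assms
    by (intro nth_upto_xs) simp
  also have "\<dots> = table ! i" using assms(1) by (subst assms(2)) (simp add: nth_append)
  finally show ?thesis .
qed

lemma edge_prog_iff:
  assumes "i < n" "j < n"
  shows "edge_prog W xs i j \<longleftrightarrow> (i, j) \<in> E"
proof -
  have "nth_upto W xs (length header + (i * n + j)) = edge_table ! (i * n + j)"
    by (rule nth_upto_table[OF _ xs_tables]) (simp add: length_edge_table grid_index_less assms)
  also have "\<dots> = (if (i, j) \<in> E then 1 else 0)"
    unfolding edge_table_def using assms by (subst nth_concat_uniform[where m = n]) auto
  finally show ?thesis
    by (simp add: edge_prog_def nth_header mult_upto_n length_header add.assoc)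
qed

lemma proc_time_prog_eq:
  assumes l_in: "l \<in> set (placements j)" and j_less: "j < n"
  shows "proc_time_prog W xs l j = proc_time l j"
proof -
  have code: "type_code l < Suc k" using placements_valid[OF l_in]
    by (auto simp: type_code_def split: loc.splits)
  have "proc_time_prog W xs l j =
      nth_upto W xs (length (header @ edge_table) + (type_code l * n + j))"
    by (simp add: proc_time_prog_def nth_header mult_upto_n length_header length_edge_table
      algebra_simps)
  also have "\<dots> = time_table ! (type_code l * n + j)"
    by (rule nth_upto_table)
      (use grid_index_less[OF code j_less]
        in \<open>simp_all add: xs_tables length_time_table del: mult_Suc\<close>)
  also have "\<dots> = proc_time l j"
  proof (cases l)
    case (Server m)
    then show ?thesis using j_less
      by (simp add: time_table_def nth_append type_code_def proc_time_def)
  next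
    case (Cloud c)
    then have "time_table ! (type_code l * n + j) =
        [if j = src I \<or> j = snk I then 0 else pcl I c j. c \<leftarrow> [0..<k], j \<leftarrow> [0..<n]] ! (c * n + j)"
      by (simp add: time_table_def nth_append type_code_def)
    also have "\<dots> = (if j = src I \<or> j = snk I then 0 else pcl I c j)"
      using j_less code Cloud by (subst nth_concat_uniform[where m = n]) (auto simp: type_code_def)
    finally show ?thesis using Cloud placements_server[OF l_in] by (auto simp: proc_time_def)
  qed
  finally show ?thesis .
qed

lemma nth_delay_table:
  assumes l_le: "type_code l \<le> k" "type_code l' \<le> k" and edge: "(i, j) \<in> E"
  defines "b \<equiv> i * n + j"
  defines "c \<equiv> type_code l' * (n * n) + b"
  shows "c < Suc k * (n * n)"
    "delay_table ! (type_code l * (Suc k * (n * n)) + c) = dly I (ltype l) (ltype l') i j"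
proof -
  have less: "i < n" "j < n" using edge_less[OF edge] by auto
  have b_less: "b < n * n" unfolding b_def using less by (rule grid_index_less)
  show c_less: "c < Suc k * (n * n)" unfolding c_def using l_le b_less
    by (intro grid_index_less) auto
  have "delay_table ! (type_code l * (Suc k * (n * n)) + c) =
      concat (map (delay_block (mtypes I ! type_code l)) (mtypes I)) ! c"
    unfolding delay_table_def by (rule nth_concat_uniform) (use l_le c_less
      in \<open>simp_all only: length_delay_blocks length_mtypes less_Suc_eq_le\<close>)
  also have "\<dots> = delay_block (ltype l) (ltype l') ! b"
    unfolding c_def nth_mtypes[OF l_le(1)] nth_mtypes[OF l_le(2), symmetric]
    by (rule nth_concat_uniform) (use l_le b_less
      in \<open>simp_all add: length_delay_block length_mtypes\<close>)
  also have "\<dots> = delay_row (ltype l) (ltype l') ([0..<n] ! i) ! j"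
    unfolding b_def delay_block_def
    by (rule nth_concat_uniform) (use less in \<open>simp_all add: length_delay_row\<close>)
  also have "\<dots> = dly I (ltype l) (ltype l') i j" using less edge by (simp add: delay_row_def)
  finally show "delay_table ! (type_code l * (Suc k * (n * n)) + c) =
      dly I (ltype l) (ltype l') i j" .
qed

lemma delay_prog_eq:
  assumes l_le: "type_code l \<le> k" "type_code l' \<le> k" and edge: "(i, j) \<in> E"
  shows "delay_prog W xs l l' i j = dly I (ltype l) (ltype l') i j"
proof -
  define c where "c = type_code l' * (n * n) + (i * n + j)"
  note nth = nth_delay_table[OF assms, folded c_def]
  have "type_code l * (Suc k * (n * n)) + c < Suc k * (Suc k * (n * n))"
    using l_le nth(1) by (intro grid_index_less) auto
  then have "nth_upto W xs (length (header @ edge_table @ time_table)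
      + (type_code l * (Suc k * (n * n)) + c)) =
      dly I (ltype l) (ltype l') i j"
    unfolding nth(2)[symmetric]
    by (intro nth_upto_table) (simp_all add: length_delay_table xs_tables del: mult_Suc)
  then show ?thesis
    by (simp add: delay_prog_def nth_header mult_upto_n mult_upto_Suc_k Let_def length_header
        length_edge_table length_time_table c_def algebra_simps)
qed

lemma price_prog_eq:
  assumes l_in: "l \<in> set (placements j)" and j_less: "j < n"
  shows "price_prog W xs l j = price l j"
proof (cases l)
  case (Server m)
  then show ?thesis by (simp add: price_prog_def price_def)
next
  case (Cloud c)
  then have c_less: "c < k" and ends: "j \<noteq> src I" "j \<noteq> snk I"
    using placements_valid[OF l_in] placements_server[OF l_in] by auto
  have "nth_upto W xs (length (header @ edge_table @ time_table @ delay_table) + (j * k + c)) =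
      cost_table ! (j * k + c)"
    by (rule nth_upto_table) (use j_less c_less
      in \<open>simp_all add: length_cost_table xs_tables grid_index_less\<close>)
  also have "\<dots> = cst I j c"
    unfolding cost_table_def using j_less c_less ends
    by (subst nth_concat_uniform[where m = k]) auto
  finally show ?thesis
    using Cloud
    by (simp add: price_prog_def price_def nth_header mult_upto_n mult_upto_k mult_upto_Suc_k
      Let_def length_header
        length_edge_table length_time_table length_delay_table algebra_simps)
qed

lemma same_server_iff: "same_server l l' \<longleftrightarrow> l = l' \<and> is_server l'"
  by (cases l; cases l') (auto simp: same_server_def)

lemma placements_prog_eq: "placements_prog W xs j = placements j"
  using z_le Suc_k_le
  by (simp add: placements_prog_def placements_def all_servers_eq upt_upto_eq
    nth_header[simplified])

lemma length_placements_le: "length (placements j) \<le> z + k"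
  by (simp add: placements_def)

context
  fixes h :: "entry list"
  assumes length_h: "length h \<le> W"
begin

lemma scheduled_prog_iff: "scheduled_prog W h j \<longleftrightarrow> j \<in> jobs h"
  using length_h by (auto simp: scheduled_prog_def list_ex_iff image_iff)

lemma ready_prog_iff: "j < n \<Longrightarrow> ready_prog W xs h j \<longleftrightarrow> ready h j"
  unfolding ready_prog_def ready_def all_jobs_eq
  using edge_less by (auto simp: scheduled_prog_iff list_ex_iff edge_prog_iff)

lemma live_prog_iff: "j < n \<Longrightarrow> live_prog W xs h j \<longleftrightarrow> live h j"
  unfolding live_prog_def live_def all_jobs_eq
  using edge_less by (fastforce simp: scheduled_prog_iff list_ex_iff edge_prog_iff)

lemma map_of_entry_prog:
  "map_of h j = (case entry_prog W h j of [] \<Rightarrow> None | a # _ \<Rightarrow> Some (snd a))"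
proof -
  have "map_of h j = (case filter (\<lambda>a. job a = j) h of [] \<Rightarrow> None | a # _ \<Rightarrow> Some (snd a))"
    by (induction h) auto
  then show ?thesis using length_h by (simp add: entry_prog_def)
qed

lemma free_at_prog_eq: "free_at_prog W h m = free_at h m"
  using length_h by (simp add: free_at_prog_def free_at_def max_over_def same_server_iff)

lemma tag_prog_eq: "j < n \<Longrightarrow> tag_prog W xs h j = tag h j"
  by (auto simp: tag_prog_def tag_def map_of_entry_prog live_prog_iff split: list.split prod.split)

end

lemma partial_schedule_length_le: "partial_schedule s \<Longrightarrow> length (entries s) \<le> W"
  using partial_schedule_length n_le le_trans by blast

lemma start_prog_eq:
  assumes partial: "partial_schedule s" and l_in: "l \<in> set (placements j)" and j_less: "j < n"
  shows "start_prog W xs (entries s) j l = start (entries s) j l"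
proof -
  have code: "type_code l' \<le> k" if "l' \<in> set (placements j')" for l' j'
    using placements_valid[OF that] by (auto simp: type_code_def split: loc.splits)
  have "release_prog W xs a j l = release a j l" if a_in: "a \<in> set (entries s)" for a
  proof -
    have "job a < n" using partial_schedule_jobs[OF partial] a_in by auto
    then show ?thesis
      using delay_prog_eq[of "place a" l "job a" j] code[OF l_in]
        code[OF partial_schedule_place[OF partial a_in]] j_less
      by (simp add: release_prog_def release_def edge_prog_iff same_server_iff)
  qed
  then show ?thesis
    using partial_schedule_length_le[OF partial]
    by (auto simp: start_prog_def start_def max_over_def intro!: fold_cong)
qed

lemma add_job_prog_eq:
  assumes "partial_schedule s" "l \<in> set (placements j)" "j < n"
  shows "add_job_prog W xs s j l = add_job s j l"
  using assms by (simp add: add_job_prog_def add_job_def start_prog_eq price_prog_eq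
    proc_time_prog_eq)

lemma successors_prog_eq:
  assumes "partial_schedule s"
  shows "successors_prog W xs s = successors s"
proof -
  let ?js = "filter (ready (entries s)) [0..<n]"
  have filter: "filter (\<lambda>j. ready_prog W xs (entries s) j) [0..<n] = ?js"
    using ready_prog_iff[OF partial_schedule_length_le[OF assms]] by (intro filter_cong) auto
  have jobs_le: "length ?js \<le> W" using length_filter_le[of "ready (entries s)" "[0..<n]"] n_le
    by simp
  have "1 * (z + k) \<le> n * (z + k)" using n_pos by (intro mult_le_mono1) simp
  also have "\<dots> \<le> W" by (rule branching_le)
  finally have placements_le: "length (placements j) \<le> W" for j using length_placements_le[of j]
    by simp
  have map_eq: "map (\<lambda>j. map (\<lambda>l. add_job_prog W xs s j l) (placements j)) ?js =
      map (\<lambda>j. map (add_job s j) (placements j)) ?js"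
    using add_job_prog_eq[OF assms] by (intro map_cong) auto
  have "successors_prog W xs s = concat_upto W (map (\<lambda>j. map (add_job s j) (placements j)) ?js)"
    unfolding successors_prog_def all_jobs_eq filter placements_prog_eq take_all[OF jobs_le]
      take_all[OF placements_le] map_eq
    by (rule refl)
  also have "\<dots> = successors s"
    unfolding successors_def using jobs_le placements_le by (intro concat_upto_eq) auto
  finally show ?thesis .
qed

lemma length_successors_le: "length (successors s) \<le> n * (z + k)"
proof -
  have "length (successors s) \<le> length (filter (ready (entries s)) [0..<n]) * (z + k)"
    unfolding successors_def by (rule length_concat_le) (simp add: length_placements_le)
  also have "\<dots> \<le> n * (z + k)"
    using length_filter_le[of "ready (entries s)" "[0..<n]"] by (intro mult_le_mono1) simp
  finally show ?thesis .
qed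

lemma candidates_prog_eq:
  assumes length_L: "length L \<le> max_keys (grid_size e)" and partial: "\<forall>s\<in>set L. partial_schedule s"
  shows "take W (candidates_prog W xs U L) = candidates U L"
proof -
  have len: "length L \<le> W" using length_L max_keys_le by simp
  have map_eq: "map (\<lambda>s. successors_prog W xs s) L = map successors L"
    using partial successors_prog_eq by (intro map_cong) auto
  have concat_eq: "concat_upto W (map successors L) = concat (map successors L)"
    using len order_trans[OF length_successors_le branching_le] by (intro concat_upto_eq) auto
  have "length (concat (map successors L)) \<le> length L * (n * (z + k))"
    by (rule length_concat_le) (rule length_successors_le)
  also have "\<dots> \<le> max_keys (grid_size e) * (n * (z + k))" using length_L by (rule mult_le_mono1)
  also have "\<dots> \<le> W" by (rule capacity)
  finally have total: "length (concat (map successors L)) \<le> W" .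
  have "candidates_prog W xs U L = candidates U L"
    unfolding candidates_prog_def candidates_def take_all[OF len] map_eq concat_eq
      take_all[OF total]
    by (auto simp: admissible_prog_def admissible_def nth_header intro!: filter_cong)
  moreover have "length (candidates U L) \<le> W"
    unfolding candidates_def using total length_filter_le le_trans by blast
  ultimately show ?thesis by simp
qed

lemma key_prog_eq:
  assumes bounded_s: "bounded (grid_size e * \<delta>) s" and "0 < \<delta>"
  shows "key_prog W xs \<delta> (entries s) = key \<delta> (entries s)"
proof -
  have partial: "partial_schedule s" using bounded_s by (simp add: bounded_def)
  note len = partial_schedule_length_le[OF partial]
  have div: "div_upto W x \<delta> = x div \<delta>" if "x div \<delta> \<le> grid_size e" for x
    using that grid_size_le \<open>0 < \<delta>\<close> by (intro div_upto_eq) auto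
  have "bucket_prog W xs \<delta> (entries s) j = bucket \<delta> (entries s) j" if "j < n" for j
  proof (cases "entry_prog W (entries s) j")
    case Nil
    then show ?thesis by (simp add: bucket_prog_def bucket_def map_of_entry_prog[OF len])
  next
    case (Cons a as)
    then have "a \<in> set (entry_prog W (entries s) j)" by simp
    then have "a \<in> set (entries s)" by (auto simp: entry_prog_def dest: in_set_takeD)
    then have "end_time a div \<delta> \<le> grid_size e"
      using bounded_s \<open>0 < \<delta>\<close> div_le_mono[of "end_time a" "grid_size e * \<delta>" \<delta>]
      by (simp add: bounded_def)
    then show ?thesis
      using Cons div live_prog_iff[OF len that]
      by (simp add: bucket_prog_def bucket_def map_of_entry_prog[OF len] split: prod.split)
  qed
  moreover have "div_upto W (free_at_prog W (entries s) m) \<delta> = free_at (entries s) m div \<delta>" for m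
    unfolding free_at_prog_eq[OF len] by (rule div[OF free_at_bounded[OF bounded_s \<open>0 < \<delta>\<close>]])
  ultimately show ?thesis
    using n_le tag_prog_eq[OF len] by (simp add: key_prog_def key_def all_jobs_eq all_servers_eq)
qed

lemma same_key_prog_iff:
  assumes "bounded (grid_size e * \<delta>) s" "bounded (grid_size e * \<delta>) t" "0 < \<delta>"
  shows "same_key_prog W xs \<delta> s t \<longleftrightarrow> key \<delta> (entries s) = key \<delta> (entries t)"
  using assms key_length_le by (simp add: same_key_prog_def key_prog_eq eq_upto_iff length_key)

lemma insert_min_prog_eq:
  assumes bounded_s: "bounded (grid_size e * \<delta>) s"
    and bounded_L: "\<forall>t\<in>set L. bounded (grid_size e * \<delta>) t"
    and "0 < \<delta>" "length L \<le> W"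
  shows "insert_min_prog W xs \<delta> s L = insert_min (state_key \<delta>) fst s L"
proof -
  have same: "same_key_prog W xs \<delta> t s \<longleftrightarrow> key \<delta> (entries t) = key \<delta> (entries s)" if "t \<in> set L" for t
    using that bounded_s bounded_L \<open>0 < \<delta>\<close> by (intro same_key_prog_iff) auto
  then have "filter (\<lambda>t. \<not> same_key_prog W xs \<delta> t s) L =
      filter (\<lambda>t. key \<delta> (entries t) \<noteq> key \<delta> (entries s)) L"
    by (intro filter_cong) auto
  then show ?thesis
    using same \<open>length L \<le> W\<close> by (auto simp: insert_min_prog_def insert_min_def list_ex_iff)
qed

lemma fold_insert_min_prog_eq:
  assumes "0 < \<delta>"
  defines "S \<equiv> nonempty_bounded (grid_size e * \<delta>)"
  assumes "set ss \<subseteq> S" "set L \<subseteq> S" "distinct (map (state_key \<delta>) L)"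
  shows "fold (\<lambda>s L'. insert_min_prog W xs \<delta> s L') ss L = fold (insert_min (state_key \<delta>) fst) ss L"
  using assms(3-)
proof (induction ss arbitrary: L)
  case (Cons s ss)
  let ?L = "insert_min (state_key \<delta>) fst s L"
  have "length L \<le> card (state_key \<delta> ` S)"
    unfolding S_def by (rule length_le_card_image) (use Cons.prems card_keys(1)[OF assms(1)]
      in \<open>simp_all add: S_def\<close>)
  then have "length L \<le> W"
    using card_keys(2)[OF assms(1), of "grid_size e"] max_keys_le by (simp add: S_def)
  then have "insert_min_prog W xs \<delta> s L = ?L"
    using Cons.prems assms(1) by (intro insert_min_prog_eq) (auto simp: S_def)
  moreover have "set ?L \<subseteq> S" using set_insert_min_subset[of _ fst s L] Cons.prems by fastforce
  ultimately show ?case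
    using Cons.IH[of ?L] Cons.prems distinct_insert_min[OF Cons.prems(3)] by simp
qed simp

lemma layer_step_prog_eq:
  assumes "0 < \<delta>"
  shows "layer_step_prog W xs (grid_size e) \<delta> (layer (grid_size e) \<delta> i) =
      layer (grid_size e) \<delta> (Suc i)"
proof -
  let ?M = "grid_size e"
  have inv: "\<forall>s\<in>set (layer ?M \<delta> i). bounded (?M * \<delta>) s \<and> length (entries s) = i"
    using layer_invariant by blast
  have "mult_upto W \<delta> ?M = ?M * \<delta>" using grid_size_le by (simp add: mult_upto_eq mult.commute)
  then have cands: "take W (candidates_prog W xs (mult_upto W \<delta> ?M) (layer ?M \<delta> i)) =
      candidates (?M * \<delta>) (layer ?M \<delta> i)"
    using candidates_prog_eq[OF length_layer_le[OF assms]] inv by (simp add: bounded_def)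
  have "set (candidates (?M * \<delta>) (layer ?M \<delta> i)) \<subseteq> nonempty_bounded (?M * \<delta>)"
    using candidates_invariant[OF inv] by fastforce
  then show ?thesis
    unfolding layer_step_prog_def cands layer.simps prune_def
    by (intro fold_insert_min_prog_eq[OF assms]) auto
qed

lemma final_layer_prog_eq: "final_layer_prog W xs (grid_size e) (2 ^ q) = final_layer e q"
proof -
  let ?f = "layer_step_prog W xs (grid_size e) (2 ^ q)"
  have "fold (\<lambda>i L. ?f L) [0..<i] [(0, [])] = layer (grid_size e) (2 ^ q) i" for i
    by (induction i) (simp_all add: layer_step_prog_eq del: layer.simps(2))
  then show ?thesis by (simp add: final_layer_prog_def final_layer_def all_jobs_eq)
qed

lemma search_prog_finds:
  "\<exists>q. snd (search_prog W xs (grid_size e)) = final_layer e q \<and> final_layer e q \<noteq> [] \<and>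
    (\<forall>p<q. final_layer e p = [])"
proof -
  define search_state where "search_state t =
      (search_step_prog W xs (grid_size e) ^^ t) (1, final_layer_prog W xs (grid_size e) 1)" for t
  have "\<exists>q\<le>t. search_state t = (2 ^ q, final_layer e q) \<and> (q < t \<longrightarrow> final_layer e q \<noteq> []) \<and>
      (\<forall>p<q. final_layer e p = [])" for t
  proof (induction t)
    case 0
    show ?case using final_layer_prog_eq[of 0] by (simp add: search_state_def)
  next
    case (Suc t)
    then obtain q where q: "q \<le> t" "search_state t = (2 ^ q, final_layer e q)"
      "q < t \<longrightarrow> final_layer e q \<noteq> []"
      "\<forall>p<q. final_layer e p = []" by blast
    have step: "search_state (Suc t) = search_step_prog W xs (grid_size e) (search_state t)"
      by (simp add: search_state_def)
    show ?case
    proof (cases "final_layer e q = []")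
      case True
      then have "search_state (Suc t) = (2 ^ Suc q, final_layer e (Suc q))"
        using q(2) final_layer_prog_eq[of "Suc q"] by (simp add: step search_step_prog_def mult_2)
      then show ?thesis using q True by (intro exI[of _ "Suc q"]) (auto simp: less_Suc_eq)
    next
      case False
      then have "search_state (Suc t) = search_state t" using q(2)
        by (simp add: step search_step_prog_def)
      then show ?thesis using q False le_SucI by metis
    qed
  qed
  then obtain q where q: "q \<le> W" "search_state W = (2 ^ q, final_layer e q)"
    "q < W \<longrightarrow> final_layer e q \<noteq> []"
    "\<forall>p<q. final_layer e p = []" by blast
  have "sum_list xs < 2 ^ bitlen (sum_list xs)" using bitlen_le_iff by blast
  then have "final_layer e (bitlen (sum_list xs)) \<noteq> []" using sum_ps_le
    by (intro final_layer_nonempty) simp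
  then have "q < W" using q bitlen_less by (metis le_neq_implies_less)
  then show ?thesis using q by (auto simp: search_state_def search_prog_def)
qed

lemma end_prog_eq:
  assumes "length h \<le> W" "j \<in> jobs h"
  shows "end_prog W h j = end_of h j"
proof -
  have "map_of h j \<noteq> None" using assms(2) by (simp add: map_of_eq_None_iff)
  then show ?thesis
    by (simp add: end_prog_def end_of_def map_of_entry_prog[OF assms(1)] split: list.splits)
qed

lemma loc_of_place_code_prog:
  assumes "length h \<le> W" "j \<in> jobs h"
  shows "loc_of_code (place_code_prog W h j) = place_of h j"
proof -
  have "map_of h j \<noteq> None" using assms(2) by (simp add: map_of_eq_None_iff)
  then show ?thesis
    by (auto simp: place_code_prog_def place_of_def map_of_entry_prog[OF assms(1)] loc_of_code_def
        split: list.splits loc.split)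
qed

lemma best_prog_minimal:
  assumes members: "set (s # L) \<subseteq> {s. length (entries s) \<le> W \<and> snk I \<in> jobs (entries s)}"
      "length L \<le> W"
  defines "b \<equiv> best_prog W xs s L"
  shows "b \<in> set (s # L)" "\<forall>t\<in>set (s # L). end_of (entries b) (snk I) \<le> end_of (entries t) (snk I)"
proof -
  define f where "f t = end_prog W (entries t) (snk I)" for t
  have f_eq: "f t = end_of (entries t) (snk I)" if "t \<in> set (s # L)" for t
    unfolding f_def using that members(1) by (intro end_prog_eq) auto
  have "b = fold (\<lambda>t b. if f t < f b then t else b) L s"
    unfolding b_def best_prog_def take_all[OF members(2)] nth_header f_def by (rule refl)
  then show b_in: "b \<in> set (s # L)" using fold_min_mem[of f L s] by simp
  show "\<forall>t\<in>set (s # L). end_of (entries b) (snk I) \<le> end_of (entries t) (snk I)"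
  proof
    fix t assume t_in: "t \<in> set (s # L)"
    have "f b \<le> f t" using fold_min_le[OF t_in, of f] \<open>b = _\<close> by simp
    then show "end_of (entries b) (snk I) \<le> end_of (entries t) (snk I)"
      using f_eq[OF b_in] f_eq[OF t_in] by simp
  qed
qed

lemma output_prog_eq: "output_prog W xs h =
    concat (map (\<lambda>j. [end_prog W h j, place_code_prog W h j]) [0..<n])"
  unfolding output_prog_def all_jobs_eq using n_le length_xs length_le
  by (intro concat_upto_eq) auto

lemma length_output_prog: "length (output_prog W xs h) = 2 * n"
  unfolding output_prog_eq by (subst length_concat_uniform[where m = 2]) auto

lemma dec_sched_output_prog:
  assumes "length h \<le> W" "jobs h = {0..<n}" "j < n"
  shows "fst (dec_sched (output_prog W xs h)) j = end_of h j"
    "snd (dec_sched (output_prog W xs h)) j = place_of h j"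
proof -
  have nth: "output_prog W xs h ! (j * 2 + i) = [end_prog W h j, place_code_prog W h j] ! i"
    if "i < 2" for i
    unfolding output_prog_eq using assms(3) that by (subst nth_concat_uniform[where m = 2]) auto
  have "j \<in> jobs h" using assms(2,3) by simp
  then show "fst (dec_sched (output_prog W xs h)) j = end_of h j"
    "snd (dec_sched (output_prog W xs h)) j = place_of h j"
    using nth[of 0] nth[of 1] end_prog_eq[OF assms(1)] loc_of_place_code_prog[OF assms(1)]
    by (simp_all add: dec_sched_def mult.commute)
qed

lemma valid_sched_cong:
  assumes "\<And>j. j < n \<Longrightarrow> C j = C' j" "\<And>j. j < n \<Longrightarrow> \<eta> j = \<eta>' j"
  shows "valid_sched I C \<eta> \<longleftrightarrow> valid_sched I C' \<eta>'"
proof -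
  have "int (C i) + int (dly I (ltype (\<eta> i)) (ltype (\<eta> j)) i j) \<le> int (C j) - int (ptime I \<eta> j) \<longleftrightarrow>
      int (C' i) + int (dly I (ltype (\<eta>' i)) (ltype (\<eta>' j)) i j) \<le> int (C' j) - int (ptime I \<eta>' j)"
    if "(i, j) \<in> E" for i j
    using edge_less[OF that] assms by (simp add: ptime_eq)
  then show ?thesis
    unfolding valid_sched_def using assms src_less snk_less by (auto simp: Ball_def)
qed

lemma main_prog_eq:
  obtains q b where "main_prog W xs = output_prog W xs (entries b)" "b \<in> set (final_layer e q)"
    "\<forall>p<q. final_layer e p = []"
    "\<forall>t\<in>set (final_layer e q). end_of (entries b) (snk I) \<le> end_of (entries t) (snk I)"
proof -
  obtain q where q: "snd (search_prog W xs (grid_size e)) = final_layer e q" "final_layer e q \<noteq> []"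
    "\<forall>p<q. final_layer e p = []"
    using search_prog_finds by blast
  obtain s L where layer_eq: "final_layer e q = s # L" using q(2) by (cases "final_layer e q") auto
  have "length (final_layer e q) \<le> W"
    using length_layer_le[of "2 ^ q" "grid_size e" n] max_keys_le by (simp add: final_layer_def)
  moreover have "length (entries t) \<le> W \<and> snk I \<in> jobs (entries t)"
    if "t \<in> set (final_layer e q)" for t
    using layer_complete[OF that[unfolded final_layer_def]] partial_schedule_length_le snk_less
    by simp
  ultimately have "set (s # L) \<subseteq> {s. length (entries s) \<le> W \<and> snk I \<in> jobs (entries s)}"
    "length L \<le> W"
    unfolding layer_eq by auto
  note best = best_prog_minimal[OF this, folded layer_eq]
  have "nth_upto W (rev (take W xs)) 0 = e"
    using length_le by (subst nth_upto_eq) (auto simp: xs_eq)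
  moreover have "grid_size_prog W xs e = grid_size e"
    using e_le by (simp add: grid_size_prog_def grid_size_def nth_header mult_upto_eq Let_def
      mult_2)
  ultimately have "main_prog W xs = output_prog W xs (entries (best_prog W xs s L))"
    using q(1) layer_eq by (simp add: main_prog_def)
  then show thesis using that best q(3) by blast
qed

theorem main_prog_correct:
  defines "C \<equiv> fst (dec_sched (main_prog W xs))" and "\<eta> \<equiv> snd (dec_sched (main_prog W xs))"
  shows "length (main_prog W xs) = 2 * n" "valid_sched I C \<eta>" "sched_cost I \<eta> \<le> bud I"
    "valid_sched I C' \<eta>' \<Longrightarrow> sched_cost I \<eta>' \<le> bud I \<Longrightarrow> e * makespan I C \<le> (e + 1) * makespan I C'"
proof -
  obtain q b where main: "main_prog W xs = output_prog W xs (entries b)"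
    and b: "b \<in> set (final_layer e q)"
    and failed: "\<forall>p<q. final_layer e p = []"
    and best: "\<forall>t\<in>set (final_layer e q). end_of (entries b) (snk I) \<le> end_of (entries t) (snk I)"
    by (rule main_prog_eq)
  show "length (main_prog W xs) = 2 * n" unfolding main by (rule length_output_prog)
  note complete = layer_complete[OF b[unfolded final_layer_def]]
  have dec: "C j = end_of (entries b) j" "\<eta> j = place_of (entries b) j" if "j < n" for j
    using dec_sched_output_prog[OF partial_schedule_length_le[OF complete(1)] complete(2) that]
    by (simp_all add: C_def \<eta>_def main)
  show "valid_sched I C \<eta>"
    using valid_sched_cong[of C "end_of (entries b)" \<eta> "place_of (entries b)"] dec
      complete_schedule_valid[OF complete(1,2)] by blast
  have "sched_cost I \<eta> = sched_cost I (place_of (entries b))"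
    unfolding sched_cost_eq_sum using dec(2) by (intro sum.cong) auto
  then show "sched_cost I \<eta> \<le> bud I" using complete_schedule_cost[OF complete(1,2)] complete(3)
    by simp
  show "e * makespan I C \<le> (e + 1) * makespan I C'"
    if "valid_sched I C' \<eta>'" "sched_cost I \<eta>' \<le> bud I"
    using first_success_ratio[OF failed b best that] dec(1)[OF snk_less] by (simp add: makespan_def)
qed

end

section \<open>The window and the running time\<close>

lemma poly_bounded_le_power:
  assumes "poly_bounded F"
  shows "\<exists>D. \<forall>N\<ge>2. F N \<le> N ^ D"
proof -
  obtain A d where F_le: "\<And>N. F N \<le> A * Suc N ^ d" using assms unfolding poly_bounded_def by blast
  have "F N \<le> N ^ (A + 2 * d)" if N_ge: "2 \<le> N" for N
  proof -
    have "A \<le> 2 ^ A" by (rule less_imp_le) (rule less_exp)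
    also have "\<dots> \<le> N ^ A" using N_ge by (rule power_mono) simp
    finally have "A \<le> N ^ A" .
    moreover have "Suc N \<le> 2 * N" using N_ge by simp
    then have "Suc N \<le> N ^ 2"
      unfolding power2_eq_square using mult_le_mono1[OF N_ge] by (rule order_trans)
    then have "Suc N ^ d \<le> (N ^ 2) ^ d" by (rule power_mono) simp
    ultimately have "A * Suc N ^ d \<le> N ^ A * (N ^ 2) ^ d" by (rule mult_le_mono)
    then show ?thesis using F_le[of N] by (simp add: power_add power_mult)
  qed
  then show ?thesis by blast
qed

definition window_bound :: "nat \<Rightarrow> nat \<Rightarrow> nat \<Rightarrow> nat" where
  "window_bound \<phi> z N = (let M = 1 + (2 * N * N + N) in
    N + (N + N + z) + (N * (N * (N * (1 + M))) + 1) ^ \<phi> * (1 + M) ^ z * (N * (z + N)) + M + 1)"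

lemma poly_bounded_window_bound: "poly_bounded (window_bound \<phi> z)"
  unfolding window_bound_def Let_def by (intro poly_bounded_intros)

lemma program_runI:
  assumes wf: "wf_inst I" and cut: "cut_phi I \<le> \<phi>" and e_ge: "1 \<le> e"
    and xs_eq: "xs = enc I @ [e]" and window: "window_bound \<phi> (nz I) (input_size xs) \<le> W"
  shows "program_run I e xs W"
proof -
  interpret encoded_instance I e xs using wf e_ge xs_eq by unfold_locales
  define N where "N = input_size xs"
  define M where "M = 1 + (2 * N * N + N)"
  have N_ge: "n \<le> N" "Suc k \<le> N" "e \<le> N" "length xs \<le> N" "bitlen (sum_list xs) \<le> N"
    using length_xs_ge by (auto simp: N_def input_size_def xs_eq)
  have grid_le: "grid_size e \<le> M"
    unfolding grid_size_def M_def using N_ge by (simp add: add_mono mult_le_mono)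
  have "max_keys (grid_size e) * (n * (z + k)) \<le>
      (N * (N * (N * (1 + M))) + 1) ^ cut_phi I * (1 + M) ^ z * (N * (z + N))"
    unfolding max_keys_def using N_ge grid_le by (intro mult_le_mono power_mono add_mono) auto
  also have "\<dots> \<le> (N * (N * (N * (1 + M))) + 1) ^ \<phi> * (1 + M) ^ z * (N * (z + N))"
    using cut by (intro mult_le_mono1 power_increasing) auto
  finally have "max_keys (grid_size e) * (n * (z + k)) \<le>
      (N * (N * (N * (1 + M))) + 1) ^ \<phi> * (1 + M) ^ z * (N * (z + N))" .
  moreover have "N + (N + N + z) + (N * (N * (N * (1 + M))) + 1) ^ \<phi> * (1 + M) ^ z * (N * (z + N))
      + M + 1 \<le> W"
    using window by (simp only: window_bound_def N_def M_def Let_def)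
  ultimately show ?thesis
    using N_ge grid_le by unfold_locales linarith+
qed

lemma bitlen_sum_list_le: "bitlen (sum_list xs) \<le> enc_size xs"
proof -
  have "sum_list xs < 2 ^ enc_size xs"
  proof (induction xs)
    case Nil
    then show ?case by (simp add: enc_size_def)
  next
    case (Cons x xs)
    define b where "b = bitlen x"
    define m where "m = enc_size xs"
    have "x < 2 ^ b" "sum_list xs < 2 ^ m" using bitlen_le_iff Cons by (auto simp: b_def m_def)
    moreover have "(2::nat) ^ b * 1 \<le> 2 ^ b * 2 ^ m" "(2::nat) ^ m * 1 \<le> 2 ^ m * 2 ^ b"
      by (intro mult_le_mono2; simp)+
    moreover have "(2::nat) ^ enc_size (x # xs) = 2 ^ b * 2 ^ m + 2 ^ m * 2 ^ b"
      by (simp add: enc_size_def b_def m_def power_add)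
    moreover have "sum_list (x # xs) = x + sum_list xs" by simp
    ultimately show ?case by linarith
  qed
  then show ?thesis by (simp add: bitlen_le_iff)
qed

lemma Suc_input_size_le:
  assumes "1 \<le> e"
  shows "Suc (input_size (xs @ [e])) \<le> 5 * (enc_size xs + e)"
proof -
  have "bitlen e \<le> e" by (simp add: bitlen_le_iff less_exp)
  moreover have "bitlen (sum_list (xs @ [e])) \<le> enc_size xs + 1 + bitlen e"
    using bitlen_sum_list_le[of "xs @ [e]"] by (simp add: enc_size_def)
  moreover have "length xs \<le> enc_size xs" by (simp add: enc_size_def)
  ultimately show ?thesis using assms by (simp add: input_size_def)
qed

lemma poly_bounded_input_size:
  assumes "poly_bounded T"
  shows "\<exists>c d. \<forall>xs e. 1 \<le> e \<longrightarrow> T (input_size (xs @ [e])) \<le> c * (enc_size xs + e) ^ d + c"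
proof -
  obtain A d where T_le: "\<And>N. T N \<le> A * Suc N ^ d" using assms unfolding poly_bounded_def by blast
  have "T (input_size (xs @ [e])) \<le> A * 5 ^ d * (enc_size xs + e) ^ d + A * 5 ^ d"
    if "1 \<le> e" for xs e
  proof -
    have "T (input_size (xs @ [e])) \<le> A * (5 * (enc_size xs + e)) ^ d"
      using T_le Suc_input_size_le[OF that] by (meson le_trans mult_le_mono2 power_mono le0)
    also have "\<dots> = A * 5 ^ d * (enc_size xs + e) ^ d" by (simp only: power_mult_distrib mult.assoc)
    finally show ?thesis by (rule trans_le_add1)
  qed
  then show ?thesis by blast
qed

lemma runs_within_mono: "runs_within P xs t ys \<Longrightarrow> t \<le> t' \<Longrightarrow> runs_within P xs t' ys"
  unfolding runs_within_def using le_trans by blast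

definition approximates :: "inst \<Rightarrow> nat \<Rightarrow> nat list \<Rightarrow> bool" where
  "approximates I e ys \<longleftrightarrow> length ys = 2 * nj I \<and>
     valid_sched I (fst (dec_sched ys)) (snd (dec_sched ys)) \<and>
         sched_cost I (snd (dec_sched ys)) \<le> bud I \<and>
     (\<forall>C' \<eta>'. valid_sched I C' \<eta>' \<and> sched_cost I \<eta>' \<le> bud I \<longrightarrow>
        real (makespan I (fst (dec_sched ys))) \<le> (1 + 1 / real e) * real (makespan I C'))"

lemma (in program_run) main_prog_approximates: "approximates I e (main_prog W xs)"
proof -
  have ratio: "real m \<le> (1 + 1 / real e) * real m'" if "e * m \<le> (e + 1) * m'" for m m'
  proof -
    have "real e * real m \<le> (real e + 1) * real m'"
      using of_nat_mono[OF that, where ?'a = real] by (simp add: algebra_simps)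
    then show ?thesis using e_pos by (simp add: field_simps)
  qed
  show ?thesis unfolding approximates_def using main_prog_correct ratio by blast
qed

theorem theorem16:
  fixes \<phi> z :: nat
  shows "\<exists>P :: instr list. \<exists>c d :: nat. \<forall>I e.
     wf_inst I \<and> nz I = z \<and> cut_phi I \<le> \<phi> \<and> 1 \<le> e \<longrightarrow>
     (\<exists>ys. runs_within P (enc I @ [e]) (c * (enc_size (enc I) + e) ^ d + c) ys \<and>
           length ys = 2 * nj I \<and>
           valid_sched I (fst (dec_sched ys)) (snd (dec_sched ys)) \<and>
           sched_cost I (snd (dec_sched ys)) \<le> bud I \<and>
           (\<forall>C' \<eta>'. valid_sched I C' \<eta>' \<and> sched_cost I \<eta>' \<le> bud I \<longrightarrow>
               real (makespan I (fst (dec_sched ys)))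
                 \<le> (1 + 1 / real e) * real (makespan I C')))"
proof -
  obtain D where window_le: "\<And>N. 2 \<le> N \<Longrightarrow> window_bound \<phi> z N \<le> N ^ D"
    using poly_bounded_le_power[OF poly_bounded_window_bound] by blast
  obtain P T where "poly_bounded T" and run: "\<And>xs. 10 \<le> length xs \<Longrightarrow>
      length (main_prog (input_size xs ^ D) xs) + 5 \<le> min (length xs) (input_size xs ^ D) \<Longrightarrow>
      runs_within P xs (T (input_size xs)) (main_prog (input_size xs ^ D) xs)"
    using ram_runs_polytime[OF polytime_main, of D] by blast
  then obtain c d where T_le: "\<And>xs e. 1 \<le> e \<Longrightarrow>
      T (input_size (xs @ [e])) \<le> c * (enc_size xs + e) ^ d + c"
    using poly_bounded_input_size by blast
  have "\<exists>ys. runs_within P (enc I @ [e]) (c * (enc_size (enc I) + e) ^ d + c) ys \<and>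
      approximates I e ys"
    if inst: "wf_inst I" "nz I = z" "cut_phi I \<le> \<phi>" and e_ge: "1 \<le> e" for I e
  proof -
    define xs where "xs = enc I @ [e]"
    interpret encoded_instance I e xs using inst(1) e_ge xs_def by unfold_locales
    have len: "10 \<le> length xs" using length_xs_ge(1) n_pos by simp
    then have "window_bound \<phi> (nz I) (input_size xs) \<le> input_size xs ^ D"
      unfolding inst(2) by (intro window_le) (simp add: input_size_def)
    then interpret program_run I e xs "input_size xs ^ D"
      by (rule program_runI[OF inst(1,3) e_ge xs_def])
    have "runs_within P xs (T (input_size xs)) (main_prog (input_size xs ^ D) xs)"
      using len length_xs_ge(1) length_le main_prog_correct(1) by (intro run) simp_all
    then show ?thesis
      using main_prog_approximates runs_within_mono T_le[OF e_ge] unfolding xs_def by blast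
  qed
  then show ?thesis unfolding approximates_def by blast
qed

end
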